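(* Let $K(\zeta_1,\zeta_2)=(\exp\zeta_1\mid\exp\zeta_2)=e^{(\zeta_1\mid\zeta_2)}=e^{\langle\zeta_1\mid\zeta_2\rangle}$ for $\zeta_1,\zeta_2\in\mathcal H_\Lambda^D$. Then every function $\varphi\in\mathcal F^\Lambda(\mathcal H_\Lambda^D)$ satisfies, for every $\eta\in\mathcal H^D_\Lambda$, $$\big(K(\cdot,\eta)\,\|\,\varphi\big)=\varphi(\eta).$$
   Context: Fock space. $\mathcal H=\mathcal H_{\bar0}\oplus\mathcal H_{\bar1}$ is a $\mathbb Z_2$-graded complex separable Hilbert space (inner product antilinear in the first argument), $\mathcal H_{\bar k}=\mathcal E_{\bar k}\oplus\mathcal E_{\bar k}^*$, with an antiunitary involution $f\mapsto f^*$, $f^{**}=f$, exchanging $\mathcal E_{\bar k}$ and its dual $\mathcal E_{\bar k}^*$. Parity: $\pi(f)=k$ for $0\ne f\in\mathcal H_{\bar k}$. Let $P^{(n)}f_1\otimes\cdots\otimes f_n=\frac1{n!}\sum_\sigma\chi_\sigma f_{\sigma(1)}\otimes\cdots\otimes f_{\sigma(n)}$ for vectors of definite parity, where $\chi_\sigma=(-1)^{N_\sigma}$, $N_\sigma$ the number of pairs $i<j$ with $\sigma(i)>\sigma(j)$ and $\pi(f_{\sigma(i)})=\pi(f_{\sigma(j)})=1$; it extends to a projection. $\mathcal H^{\odot n}=P^{(n)}\mathcal H^{\otimes n}$, $\mathcal S_{fin}(\mathcal H)=\bigoplus_n\mathcal H^{\odot n}$ with product $F\odot G=\sqrt{\frac{(p+q)!}{p!q!}}P^{(p+q)}F\otimes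 G$ ($F\in\mathcal H^{\odot p}$, $G\in\mathcal H^{\odot q}$), norm inherited from $\|f_1\otimes\cdots\otimes f_n\|_n=\prod\|f_a\|$, $\|F\|^2=\sum_n\|F_n\|_n^2$; its completion is $\mathcal S(\mathcal H)$. The involution extends to an antiunitary involution of $\mathcal S(\mathcal H)$ with $(F\odot G)^*=G^*\odot F^*$, and $\langle F\mid G\rangle:=(F^*\mid G)$. Grassmann extension. $\Lambda$ is the completion of the antisymmetric tensor algebra over a separable infinite-dimensional complex Hilbert space $\Lambda_1$, $\Lambda=\bigoplus_p\Lambda_p$, unit $\kappa_0$, product $\lambda\mu=\sqrt{\frac{(p+q)!}{p!q!}}\mathrm{Alt}(\lambda\otimes\mu)$ for $\lambda\in\Lambda_p,\mu\in\Lambda_q$, norm $\|\lambda\|_\Lambda^2=\sum_p(p!)^{-2}\|\lambda_p\|_p^2$, and an antiunitary involution preserving each $\Lambda_p$ with $(\lambda\mu)^*=\mu^*\lambda^*$; $\Lambda_{\bar0},\Lambda_{\bar1}$ are the even and odd parts. $\mathcal S^\Lambda(\mathcal H)=\Lambda\widehat\otimes\mathcal S(\mathcal H)$ (Hilbert tensor product), with $(\lambda_1\otimes F_1)(\lambda_2\otimes F_2)=\lambda_1\lambda_2\otimes(F_1\odot F_2)$ where defined, $(\lambda\otimes F)^*=\lambda^*\otimes F^*$, the continuous $\Lambda$-valued bilinear form $\langle\lambda_1\otimes F_1\mid\lambda_2\otimes F_2\rangle=\lambda_1\lambda_2\langle F_1\mid F_2\rangle$ and the sesquilinear form $(\Xi_1\mid\Xi_2)=\langle\Xi_1^*\mid\Xi_2\rangle$.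 $\mathcal H_\Lambda=(\Lambda_{\bar0}\widehat\otimes\mathcal H_{\bar0})\oplus(\Lambda_{\bar1}\widehat\otimes\mathcal H_{\bar1})\subset \mathcal S^\Lambda(\mathcal H)$, and $\exp\zeta=\sum_p\frac1{p!}\zeta^p\in\mathcal S^\Lambda(\mathcal H)$ for $\zeta\in\mathcal H_\Lambda$. The real subspace is $\mathcal H_\Lambda^D=\{\zeta\in\mathcal H_\Lambda:\zeta^*=\zeta\}$. Function space. For $\Xi\in\mathcal S^\Lambda(\mathcal H)$ let $\varphi_\Xi(\zeta)=\langle\exp\zeta\mid\Xi\rangle\in\Lambda$, $\zeta\in\mathcal H_\Lambda^D$. $\mathcal F^\Lambda(\mathcal H_\Lambda^D)=\{\varphi_\Xi:\Xi\in\mathcal S^\Lambda(\mathcal H)\}$; the map $\Xi\mapsto\varphi_\Xi$ is injective, and $(\varphi_\Xi\,\|\,\varphi_{\mathrm H}):=(\Xi\mid \mathrm H)\in\Lambda$ for $\Xi,\mathrm H\in\mathcal S^\Lambda(\mathcal H)$. For fixed $\eta$ the function $K(\cdot,\eta)$ is $\varphi_{\exp\eta}$. *)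

theory Defs
  imports "HOL-Analysis.Analysis" "HOL-Combinatorics.Permutations"
begin

section \<open>Complex Hilbert spaces\<close>

class complex_inner = real_inner +
  fixes scaleC :: "complex \<Rightarrow> 'a \<Rightarrow> 'a"  (infixr \<open>*\<^sub>C\<close> 75)
    and cinner :: "'a \<Rightarrow> 'a \<Rightarrow> complex"
  assumes scaleC_add_right: "c *\<^sub>C (x + y) = c *\<^sub>C x + c *\<^sub>C y"
    and scaleC_add_left: "(c + d) *\<^sub>C x = c *\<^sub>C x + d *\<^sub>C x"
    and scaleC_scaleC: "c *\<^sub>C d *\<^sub>C x = (c * d) *\<^sub>C x"
    and scaleC_of_real: "complex_of_real r *\<^sub>C x = r *\<^sub>R x"
    and cinner_commute: "cinner x y = cnj (cinner y x)"
    and cinner_add_right: "cinner x (y + z) = cinner x y + cinner x z"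
    and cinner_scaleC_right: "cinner x (c *\<^sub>C y) = c * cinner x y"
    and inner_eq_Re_cinner: "inner x y = Re (cinner x y)"

class chilbert_space = complex_inner + complete_space

class separable_chilbert_space = chilbert_space +
  assumes separable: "\<exists>D. countable D \<and> (\<forall>x. \<forall>e>0. \<exists>d\<in>D. dist x d < e)"

text \<open>A separable Hilbert space with an antiunitary involution.\<close>

class star_chilbert_space = separable_chilbert_space +
  fixes star :: "'a \<Rightarrow> 'a"
  assumes star_add: "star (x + y) = star x + star y"
    and star_scaleC: "star (c *\<^sub>C x) = cnj c *\<^sub>C star x"
    and star_star: "star (star x) = x"
    and cinner_star_star: "cinner (star x) (star y) = cinner y x"

text \<open>
  The one-particle space \<open>H = H\<^sub>0 \<oplus> H\<^sub>1\<close> with \<open>H\<^sub>k = E\<^sub>k \<oplus> star E\<^sub>k\<close>, all sums being orthogonal.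
  Parities are Booleans, \<open>True\<close> being odd.
\<close>

class super_chilbert_space = star_chilbert_space +
  fixes E :: "bool \<Rightarrow> 'a set"
  assumes zero_in_E: "0 \<in> E k"
    and add_in_E: "x \<in> E k \<Longrightarrow> y \<in> E k \<Longrightarrow> x + y \<in> E k"
    and scaleC_in_E: "x \<in> E k \<Longrightarrow> c *\<^sub>C x \<in> E k"
    and closed_E: "closed (E k)"
    and orthogonal_E_E: "x \<in> E k \<Longrightarrow> y \<in> E l \<Longrightarrow> k \<noteq> l \<Longrightarrow> cinner x y = 0"
    and orthogonal_E_star: "x \<in> E k \<Longrightarrow> y \<in> E l \<Longrightarrow> cinner x (star y) = 0"
    and E_decomposition:
      "\<exists>x\<in>E False. \<exists>y\<in>E False. \<exists>x'\<in>E True. \<exists>y'\<in>E True. f = x + star y + (x' + star y')"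

text \<open>The generating space of the Grassmann algebra.\<close>

class grassmann_generators = star_chilbert_space +
  assumes infinite_dimensional: "finite B \<Longrightarrow> \<exists>x. \<forall>c. x \<noteq> (\<Sum>b\<in>B. c b *\<^sub>C b)"

definition hpart :: "bool \<Rightarrow> 'h::super_chilbert_space set" where
  "hpart k = {x + star y | x y. x \<in> E k \<and> y \<in> E k}"

definition hproj :: "bool \<Rightarrow> 'h \<Rightarrow> 'h::super_chilbert_space" where
  "hproj k f = (THE g. g \<in> hpart k \<and> f - g \<in> hpart (\<not> k))"


subsection \<open>Orthonormal bases\<close>

definition orthonormal :: "'a::complex_inner set \<Rightarrow> bool" where
  "orthonormal B \<longleftrightarrow> (\<forall>b\<in>B. norm b = 1) \<and> pairwise (\<lambda>b c. cinner b c = 0) B"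

definition is_onb :: "'a::complex_inner set \<Rightarrow> bool" where
  "is_onb B \<longleftrightarrow> orthonormal B \<and> (\<forall>x. (\<forall>b\<in>B. cinner b x = 0) \<longrightarrow> x = 0)"

text \<open>
  Orthonormal bases only serve to write down Hilbert-Schmidt norms and inner products, which do not
  depend on them. On a graded space we take a basis compatible with the grading and the involution.
\<close>

definition onb :: "'a::chilbert_space set" where
  "onb = (SOME B. is_onb B)"

definition honb :: "'h::super_chilbert_space set" where
  "honb = (SOME B. is_onb B \<and> B \<subseteq> hpart False \<union> hpart True \<and> star ` B = B)"


section \<open>Tensors\<close>

text \<open>
  An element of the Hilbert tensor power \<open>V\<^sup>\<otimes>\<^sup>n\<close> is represented by the bounded functional, antilinear
  in each of its \<open>n\<close> arguments, whose value at \<open>g\<^sub>1, \<dots>, g\<^sub>n\<close> is its inner product with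
  \<open>g\<^sub>1 \<otimes> \<dots> \<otimes> g\<^sub>n\<close>; thus \<open>f\<^sub>1 \<otimes> \<dots> \<otimes> f\<^sub>n\<close> is \<open>\<lambda>[g\<^sub>1, \<dots>, g\<^sub>n]. \<Prod>i. cinner g\<^sub>i f\<^sub>i\<close>. The functionals
  arising in this way are those of Hilbert-Schmidt type, and the tensor norm is the
  Hilbert-Schmidt norm. A function on lists collects one such functional for each degree \<open>n\<close>.
  The tensor product is \<open>(T \<otimes> U) (xs @ ys) = T xs * U ys\<close>.
\<close>

type_synonym 'a tensor = "'a list \<Rightarrow> complex"

definition multi_antilinear :: "'a::complex_inner tensor \<Rightarrow> bool" where
  "multi_antilinear T \<longleftrightarrow>
     (\<forall>xs x y zs. T (xs @ (x + y) # zs) = T (xs @ x # zs) + T (xs @ y # zs)) \<and>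
     (\<forall>xs c x zs. T (xs @ (c *\<^sub>C x) # zs) = cnj c * T (xs @ x # zs))"

definition bounded_tensor :: "'a::complex_inner tensor \<Rightarrow> bool" where
  "bounded_tensor T \<longleftrightarrow>
     (\<forall>n. \<exists>C. \<forall>xs. length xs = n \<longrightarrow> cmod (T xs) \<le> C * prod_list (map norm xs))"


subsection \<open>The Grassmann algebra\<close>

definition alt :: "'l tensor \<Rightarrow> 'l tensor" where
  "alt T xs = (\<Sum>\<sigma> | \<sigma> permutes {..<length xs}. of_int (sign \<sigma>) * T (permute_list \<sigma> xs))
     / fact (length xs)"

definition grassmann :: "'l::grassmann_generators tensor set" where
  "grassmann = {T. multi_antilinear T \<and> bounded_tensor T \<and> alt T = T \<and>
     (\<lambda>xs. (cmod (T xs))\<^sup>2 / (fact (length xs))\<^sup>2) summable_on lists onb}"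

definition gmult :: "'l tensor \<Rightarrow> 'l tensor \<Rightarrow> 'l tensor" where
  "gmult S T = alt (\<lambda>xs. \<Sum>p\<le>length xs.
     complex_of_real (sqrt (length xs choose p)) * (S (take p xs) * T (drop p xs)))"

definition gone :: "'l tensor" where
  "gone xs = (if xs = [] then 1 else 0)"

primrec gpow :: "'l tensor \<Rightarrow> nat \<Rightarrow> 'l tensor" where
  "gpow T 0 = gone"
| "gpow T (Suc n) = gmult T (gpow T n)"

text \<open>
  The exponential series is evaluated argumentwise. Evaluation of a tensor at fixed arguments is a
  continuous functional, so this is the limit of the series whenever the latter converges in norm.
\<close>

definition gexp :: "'l tensor \<Rightarrow> 'l tensor" where
  "gexp T xs = (\<Sum>n. gpow T n xs / fact n)"

text \<open>The antiunitary extension of \<open>star\<close> that reverses products.\<close>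

definition tstar :: "'a::star_chilbert_space tensor \<Rightarrow> 'a tensor" where
  "tstar T xs = cnj (T (rev (map star xs)))"


subsection \<open>The Fock space\<close>

definition chi :: "(nat \<Rightarrow> nat) \<Rightarrow> bool list \<Rightarrow> complex" where
  "chi \<sigma> ks = (-1) ^ card {(i, j). i < j \<and> j < length ks \<and> \<sigma> i > \<sigma> j \<and> ks ! \<sigma> i \<and> ks ! \<sigma> j}"

text \<open>
  The projection \<open>P\<^sup>(\<^sup>n\<^sup>)\<close>. Passing from \<open>f\<^sub>1 \<otimes> \<dots> \<otimes> f\<^sub>n\<close> to functionals replaces \<open>\<sigma>\<close> by its inverse and
  the parities of the \<open>f\<^sub>i\<close> by those of the arguments, under which \<open>chi\<close> is invariant; arguments
  without definite parity are split into their even and odd parts.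
\<close>

definition gsym :: "'h::super_chilbert_space tensor \<Rightarrow> 'h tensor" where
  "gsym T xs = (\<Sum>ks | length ks = length xs. \<Sum>\<sigma> | \<sigma> permutes {..<length xs}.
     chi \<sigma> ks * T (permute_list \<sigma> (map2 hproj ks xs))) / fact (length xs)"

definition fock :: "'h::super_chilbert_space tensor set" where
  "fock = {T. multi_antilinear T \<and> bounded_tensor T \<and> gsym T = T \<and>
     (\<lambda>xs. (cmod (T xs))\<^sup>2) summable_on lists honb}"

definition fmult :: "'h::super_chilbert_space tensor \<Rightarrow> 'h tensor \<Rightarrow> 'h tensor" where
  "fmult F G = gsym (\<lambda>xs. \<Sum>p\<le>length xs.
     complex_of_real (sqrt (length xs choose p)) * (F (take p xs) * G (drop p xs)))"

definition finner :: "'h::super_chilbert_space tensor \<Rightarrow> 'h tensor \<Rightarrow> complex" where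
  "finner F G = (\<Sum>\<^sub>\<infinity>xs\<in>lists honb. cnj (F xs) * G xs)"

definition fpair :: "'h::super_chilbert_space tensor \<Rightarrow> 'h tensor \<Rightarrow> complex" where
  "fpair F G = finner (tstar F) G"


section \<open>The Grassmann extension of the Fock space\<close>

text \<open>
  The Hilbert tensor product of the Grassmann algebra and the Fock space consists of
  Hilbert-Schmidt functionals of arguments from both generating spaces. It is written as a function
  of the arguments in \<open>H\<close> with values in the Grassmann algebra.
\<close>

type_synonym ('h, 'l) stensor = "'h list \<Rightarrow> 'l tensor"

definition stimes :: "'l tensor \<Rightarrow> 'h tensor \<Rightarrow> ('h, 'l) stensor" where
  "stimes T F hs ls = T ls * F hs"

definition sfock :: "('h::super_chilbert_space, 'l::grassmann_generators) stensor set" where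
  "sfock = {\<Xi>.
     (\<forall>ls. multi_antilinear (\<lambda>hs. \<Xi> hs ls)) \<and> (\<forall>hs. multi_antilinear (\<Xi> hs)) \<and>
     (\<forall>m n. \<exists>C. \<forall>hs ls. length hs = m \<longrightarrow> length ls = n \<longrightarrow>
        cmod (\<Xi> hs ls) \<le> C * (prod_list (map norm hs) * prod_list (map norm ls))) \<and>
     (\<forall>ls. gsym (\<lambda>hs. \<Xi> hs ls) = (\<lambda>hs. \<Xi> hs ls)) \<and> (\<forall>hs. alt (\<Xi> hs) = \<Xi> hs) \<and>
     (\<lambda>(hs, ls). (cmod (\<Xi> hs ls))\<^sup>2 / (fact (length ls))\<^sup>2) summable_on lists honb \<times> lists onb}"

definition sprod ::
    "('h::super_chilbert_space, 'l) stensor \<Rightarrow> ('h, 'l) stensor \<Rightarrow> ('h, 'l) stensor" where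
  "sprod \<Xi> \<Psi> hs ls = gsym (\<lambda>xs. \<Sum>p\<le>length xs.
     complex_of_real (sqrt (length xs choose p)) * gmult (\<Xi> (take p xs)) (\<Psi> (drop p xs)) ls) hs"

definition sone :: "('h, 'l) stensor" where
  "sone = stimes gone (\<lambda>hs. if hs = [] then 1 else 0)"

primrec spow :: "('h::super_chilbert_space, 'l) stensor \<Rightarrow> nat \<Rightarrow> ('h, 'l) stensor" where
  "spow \<zeta> 0 = sone"
| "spow \<zeta> (Suc n) = sprod \<zeta> (spow \<zeta> n)"

definition sexp :: "('h::super_chilbert_space, 'l) stensor \<Rightarrow> ('h, 'l) stensor" where
  "sexp \<zeta> hs ls = (\<Sum>n. spow \<zeta> n hs ls / fact n)"

definition sstar ::
    "('h::super_chilbert_space, 'l::grassmann_generators) stensor \<Rightarrow> ('h, 'l) stensor" where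
  "sstar \<Xi> hs = tstar (\<Xi> (rev (map star hs)))"

text \<open>
  For complex-valued \<open>F\<close> and \<open>G\<close> one has \<open>fpair F G = \<Sum> hs. F (rev (map star hs)) * G hs\<close>; here the
  product of the values is taken in the Grassmann algebra.
\<close>

definition spair ::
    "('h::super_chilbert_space, 'l) stensor \<Rightarrow> ('h, 'l) stensor \<Rightarrow> 'l tensor" where
  "spair \<Xi> \<Psi> ls = (\<Sum>\<^sub>\<infinity>hs\<in>lists honb. gmult (\<Xi> (rev (map star hs))) (\<Psi> hs) ls)"

definition sform ::
    "('h::super_chilbert_space, 'l::grassmann_generators) stensor \<Rightarrow> ('h, 'l) stensor \<Rightarrow> 'l tensor"
  where "sform \<Xi> \<Psi> = spair (sstar \<Xi>) \<Psi>"

text \<open>\<open>HL_part k\<close> is the Hilbert tensor product of \<open>\<Lambda>\<^sub>k\<close> and \<open>H\<^sub>k\<close>.\<close>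

definition HL_part ::
    "bool \<Rightarrow> ('h::super_chilbert_space, 'l::grassmann_generators) stensor set" where
  "HL_part k = {\<zeta> \<in> sfock.
     (\<forall>hs ls. \<zeta> hs ls \<noteq> 0 \<longrightarrow> length hs = 1 \<and> odd (length ls) = k) \<and>
     (\<forall>h \<in> hpart (\<not> k). \<forall>ls. \<zeta> [h] ls = 0)}"

definition HL :: "('h::super_chilbert_space, 'l::grassmann_generators) stensor set" where
  "HL = {\<lambda>hs ls. \<zeta>0 hs ls + \<zeta>1 hs ls | \<zeta>0 \<zeta>1. \<zeta>0 \<in> HL_part False \<and> \<zeta>1 \<in> HL_part True}"

definition HLD :: "('h::super_chilbert_space, 'l::grassmann_generators) stensor set" where
  "HLD = {\<zeta> \<in> HL. sstar \<zeta> = \<zeta>}"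


section \<open>The function space\<close>

text \<open>Functions on \<open>HLD\<close> are extended by \<open>undefined\<close>.\<close>

definition phi ::
    "('h::super_chilbert_space, 'l::grassmann_generators) stensor \<Rightarrow>
     ('h, 'l) stensor \<Rightarrow> 'l tensor" where
  "phi \<Xi> = (\<lambda>\<zeta>\<in>HLD. spair (sexp \<zeta>) \<Xi>)"

definition fun_space ::
    "(('h::super_chilbert_space, 'l::grassmann_generators) stensor \<Rightarrow> 'l tensor) set" where
  "fun_space = phi ` sfock"

definition fun_form ::
    "(('h::super_chilbert_space, 'l::grassmann_generators) stensor \<Rightarrow> 'l tensor) \<Rightarrow>
     (('h, 'l) stensor \<Rightarrow> 'l tensor) \<Rightarrow> 'l tensor" where
  "fun_form \<phi> \<psi> = sform (inv_into sfock phi \<phi>) (inv_into sfock phi \<psi>)"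

definition rep_kernel ::
    "('h::super_chilbert_space, 'l::grassmann_generators) stensor \<Rightarrow> ('h, 'l) stensor \<Rightarrow> 'l tensor"
  where "rep_kernel \<zeta> \<eta> = sform (sexp \<zeta>) (sexp \<eta>)"


section \<open>Basic properties\<close>

lemma scaleC_vector_space: "vector_space ((*\<^sub>C) :: complex \<Rightarrow> 'a::complex_inner \<Rightarrow> 'a)"
  by unfold_locales
    (use scaleC_of_real[of 1] in
      \<open>simp_all add: scaleC_add_right scaleC_add_left scaleC_scaleC\<close>)

interpretation cvec: vector_space "(*\<^sub>C) :: complex \<Rightarrow> 'a::complex_inner \<Rightarrow> 'a"
  by (rule scaleC_vector_space)

lemma cinner_zero_right [simp]: "cinner x 0 = 0"
  using cinner_add_right[of x 0 0] by simp

lemma cinner_zero_left [simp]: "cinner 0 x = 0"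
  by (metis cinner_commute cinner_zero_right complex_cnj_zero)

lemma star_zero [simp]: "star 0 = 0"
  using star_add[of 0 0] by simp

lemma norm_star [simp]: "norm (star x) = norm x"
  by (simp add: norm_eq_sqrt_inner inner_eq_Re_cinner cinner_star_star)

lemma cinner_self_eq_0: "cinner x x = 0 \<Longrightarrow> x = 0"
  using inner_eq_Re_cinner[of x x] by simp

lemma orthonormal_extension:
  fixes V :: "'a::complex_inner set"
  assumes V: "module.subspace scaleC V"
  obtains B where "B \<subseteq> V" "orthonormal B" "\<And>x. x \<in> V \<Longrightarrow> (\<And>b. b \<in> B \<Longrightarrow> cinner b x = 0) \<Longrightarrow> x = 0"
proof -
  let ?A = "{B. B \<subseteq> V \<and> orthonormal B}"
  have "\<exists>M\<in>?A. \<forall>X\<in>?A. M \<subseteq> X \<longrightarrow> X = M"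
  proof (rule subset_Zorn')
    fix C assume C: "subset.chain ?A C"
    have "pairwise (\<lambda>b c. cinner b c = 0) (\<Union>C)"
    proof (rule pairwiseI)
      fix b c assume "b \<in> \<Union>C" "c \<in> \<Union>C" "b \<noteq> c"
      then obtain X Y where XY: "X \<in> C" "Y \<in> C" "b \<in> X" "c \<in> Y" by blast
      moreover have "X \<subseteq> Y \<or> Y \<subseteq> X"
        using C XY by (simp add: subset_chain_def)
      ultimately obtain Z where "Z \<in> C" "b \<in> Z" "c \<in> Z" by blast
      then show "cinner b c = 0"
        using C \<open>b \<noteq> c\<close> unfolding subset_chain_def orthonormal_def pairwise_def by blast
    qed
    then show "\<Union>C \<in> ?A"
      using C unfolding subset_chain_def orthonormal_def by blast
  qed
  then obtain B where "B \<in> ?A" and max': "\<forall>X\<in>?A. B \<subseteq> X \<longrightarrow> X = B"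
    by (rule bexE)
  then have B: "B \<subseteq> V" "orthonormal B" by simp_all
  have max: "X = B" if "X \<subseteq> V" "orthonormal X" "B \<subseteq> X" for X
    using max' that by simp
  have total: "x = 0" if x: "x \<in> V" "\<And>b. b \<in> B \<Longrightarrow> cinner b x = 0" for x
  proof (rule ccontr)
    assume "x \<noteq> 0"
    define u where "u = complex_of_real (inverse (norm x)) *\<^sub>C x"
    have u: "u \<in> V" "norm u = 1" "\<And>b. b \<in> B \<Longrightarrow> cinner b u = 0"
    proof -
      show "u \<in> V" unfolding u_def using V x(1) by (rule cvec.subspace_scale)
      show "norm u = 1" unfolding u_def scaleC_of_real using \<open>x \<noteq> 0\<close> by simp
      show "cinner b u = 0" if "b \<in> B" for b
        unfolding u_def using x(2)[OF that] by (simp only: cinner_scaleC_right mult_zero_right)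
    qed
    then have u': "cinner u b = 0" if "b \<in> B" for b
      using that by (metis cinner_commute complex_cnj_zero)
    have "orthonormal (insert u B)"
      using B u u' unfolding orthonormal_def pairwise_def by auto
    then have "insert u B = B" using max[of "insert u B"] B u by blast
    then have "cinner u u = 0" using u by blast
    then show False using cinner_self_eq_0[of u] u by simp
  qed
  show thesis using B total by (rule that)
qed

lemma is_onb_onb: "is_onb (onb :: 'a::chilbert_space set)"
proof -
  obtain B :: "'a set" where "orthonormal B" "\<And>x. (\<And>b. b \<in> B \<Longrightarrow> cinner b x = 0) \<Longrightarrow> x = 0"
    using orthonormal_extension[OF cvec.subspace_UNIV] by (metis UNIV_I)
  then have "is_onb B" by (auto simp: is_onb_def)
  then show ?thesis unfolding onb_def by (rule someI)
qed

lemma subspace_E: "module.subspace scaleC (E k)"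
  by (simp add: cvec.subspace_def zero_in_E add_in_E scaleC_in_E)

lemma honb:
  "is_onb (honb :: 'h::super_chilbert_space set)"
  "(honb :: 'h set) \<subseteq> hpart False \<union> hpart True"
  "star ` (honb :: 'h set) = honb"
proof -
  have "\<exists>B. B \<subseteq> E k \<and> orthonormal B \<and>
      (\<forall>x\<in>E k. (\<forall>b\<in>B. cinner b x = 0) \<longrightarrow> x = 0)" for k :: bool
    using orthonormal_extension[OF subspace_E[of k]] by metis
  then obtain A :: "bool \<Rightarrow> 'h set" where A: "\<And>k. A k \<subseteq> E k" "\<And>k. orthonormal (A k)"
    and total: "\<And>k x. x \<in> E k \<Longrightarrow> (\<forall>b\<in>A k. cinner b x = 0) \<Longrightarrow> x = 0" by metis
  define B where "B = (\<Union>k. A k \<union> star ` A k)"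
  have sE: "cinner (star y) x = 0" if "x \<in> E k" "y \<in> E l" for x y :: 'h and k l
    by (metis orthogonal_E_star[OF that] cinner_commute complex_cnj_zero)
  have AA: "cinner x y = 0" if "x \<in> A k" "y \<in> A l" "x \<noteq> y" for x y k l
    using that A[of k] A[of l] orthogonal_E_E[of x k y l]
    unfolding orthonormal_def pairwise_def by blast
  have "orthonormal B"
    unfolding orthonormal_def
  proof
    show "\<forall>b\<in>B. norm b = 1" using A by (auto simp: B_def orthonormal_def)
    show "pairwise (\<lambda>b c. cinner b c = 0) B"
    proof (rule pairwiseI)
      fix b c assume "b \<in> B" "c \<in> B" "b \<noteq> c"
      then obtain k l where "b \<in> A k \<union> star ` A k" "c \<in> A l \<union> star ` A l" by (auto simp: B_def)
      then consider "b \<in> A k" "c \<in> A l" | x where "b = star x" "x \<in> A k" "c \<in> A l"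
        | y where "b \<in> A k" "c = star y" "y \<in> A l"
        | x y where "b = star x" "c = star y" "x \<in> A k" "y \<in> A l" by blast
      then show "cinner b c = 0"
      proof cases
        case 1 then show ?thesis using AA \<open>b \<noteq> c\<close> by blast
      next
        case 2 then show ?thesis using sE A by blast
      next
        case 3 then show ?thesis using orthogonal_E_star A by blast
      next
        case 4 then show ?thesis using AA[of y l x k] \<open>b \<noteq> c\<close> by (auto simp: cinner_star_star)
      qed
    qed
  qed
  moreover have "x = 0" if x: "\<And>b. b \<in> B \<Longrightarrow> cinner b x = 0" for x
  proof -
    obtain p q where pq: "\<And>k. p k \<in> E k" "\<And>k. q k \<in> E k"
      and eq: "x = p False + star (q False) + (p True + star (q True))"
    proof -
      obtain a b c d where "a \<in> E False" "b \<in> E False" "c \<in> E True" "d \<in> E True"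
        "x = a + star b + (c + star d)" using E_decomposition[of x] by blast
      then show thesis
        using that[of "\<lambda>k. if k then c else a" "\<lambda>k. if k then d else b"] by auto
    qed
    have "p k = 0" for k
    proof (rule total[OF pq(1)], rule ballI)
      fix b assume b: "b \<in> A k"
      then have "cinner b x = 0" using x by (auto simp: B_def)
      moreover have bE: "b \<in> E k" using b A by blast
      ultimately show "cinner b (p k) = 0"
        using orthogonal_E_E[OF bE pq(1)[of "\<not> k"]] orthogonal_E_star[OF bE pq(2)]
        by (cases k) (auto simp: eq cinner_add_right)
    qed
    moreover have "q k = 0" for k
    proof (rule total[OF pq(2)], rule ballI)
      fix b assume b: "b \<in> A k"
      then have bE: "b \<in> E k" using A by blast
      have "cinner (star b) x = 0" using x b by (auto simp: B_def)
      then have "cinner (q k) b = 0"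
        using orthogonal_E_E[OF pq(2)[of "\<not> k"] bE] sE[OF pq(1) bE]
        by (cases k) (auto simp: eq cinner_add_right cinner_star_star)
      then show "cinner b (q k) = 0" by (metis cinner_commute complex_cnj_zero)
    qed
    ultimately show "x = 0" by (simp add: eq)
  qed
  moreover have "B \<subseteq> hpart False \<union> hpart True"
  proof -
    have "A k \<union> star ` A k \<subseteq> hpart k" for k
      using A(1)[of k] zero_in_E[of k] unfolding hpart_def
      by (force intro: exI[of _ 0])
    then show ?thesis unfolding B_def using UNIV_bool by blast
  qed
  moreover have "star ` B = B"
    by (auto simp: B_def image_Un image_UN image_image star_star)
  ultimately have "is_onb B \<and> B \<subseteq> hpart False \<union> hpart True \<and> star ` B = B"
    by (auto simp: is_onb_def)
  then have "is_onb (honb :: 'h set) \<and> (honb :: 'h set) \<subseteq> hpart False \<union> hpart True \<and>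
      star ` (honb :: 'h set) = honb"
    unfolding honb_def by (rule someI)
  then show "is_onb (honb :: 'h set)" "(honb :: 'h set) \<subseteq> hpart False \<union> hpart True"
    "star ` (honb :: 'h set) = honb" by auto
qed

lemma alt_scale: "alt (\<lambda>xs. c * T xs) xs = c * alt T xs"
  by (simp add: alt_def sum_distrib_left mult_ac)

lemma gsym_scale: "gsym (\<lambda>xs. c * T xs) xs = c * gsym T xs"
  by (simp add: gsym_def sum_distrib_left mult_ac)

text \<open>On elementary tensors the operations have their defining values.\<close>

lemma stimes_in_sfock:
  fixes T :: "'l::grassmann_generators tensor" and F :: "'h::super_chilbert_space tensor"
  assumes T: "T \<in> grassmann" and F: "F \<in> fock"
  shows "stimes T F \<in> sfock"
proof -
  have "\<exists>C. \<forall>hs ls. length hs = m \<longrightarrow> length ls = n \<longrightarrow>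
      cmod (stimes T F hs ls) \<le> C * (prod_list (map norm hs) * prod_list (map norm ls))" for m n
  proof -
    obtain C where C: "\<And>ls. length ls = n \<Longrightarrow> cmod (T ls) \<le> C * prod_list (map norm ls)"
      using T unfolding grassmann_def bounded_tensor_def mem_Collect_eq by blast
    obtain D where D: "\<And>hs. length hs = m \<Longrightarrow> cmod (F hs) \<le> D * prod_list (map norm hs)"
      using F unfolding fock_def bounded_tensor_def mem_Collect_eq by blast
    have "cmod (stimes T F hs ls)
        \<le> (C * D) * (prod_list (map norm hs) * prod_list (map norm ls))"
      if "length hs = m" "length ls = n" for hs ls
    proof -
      have "cmod (T ls) * cmod (F hs)
          \<le> (C * prod_list (map norm ls)) * (D * prod_list (map norm hs))"
        by (rule mult_mono) (use C D that in \<open>auto intro: order_trans[OF norm_ge_zero]\<close>)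
      then show ?thesis by (simp add: stimes_def norm_mult mult_ac)
    qed
    then show ?thesis by blast
  qed
  moreover have "(\<lambda>(hs, ls). (cmod (stimes T F hs ls))\<^sup>2 / (fact (length ls))\<^sup>2)
      summable_on lists honb \<times> lists onb"
  proof -
    let ?f = "\<lambda>hs. (cmod (F hs))\<^sup>2" and ?g = "\<lambda>ls. (cmod (T ls))\<^sup>2 / (fact (length ls))\<^sup>2 :: real"
    have "?f summable_on lists honb" "?g summable_on lists onb"
      using T F by (auto simp: grassmann_def fock_def)
    then have "?f summable_on lists honb" and "(?g has_sum infsum ?g (lists onb)) (lists onb)"
      by simp_all
    then have "(\<lambda>(hs, ls). ?f hs * ?g ls) summable_on lists honb \<times> lists onb"
      by (intro summable_on_SigmaI[where g = "\<lambda>hs. ?f hs * infsum ?g (lists onb)"])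
        (simp_all only: prod.case has_sum_cmult_right summable_on_cmult_left, simp)
    then show ?thesis by (simp add: stimes_def norm_mult power_mult_distrib mult_ac)
  qed
  moreover have "multi_antilinear (\<lambda>hs. stimes T F hs ls)" "multi_antilinear (stimes T F hs)"
      for hs ls
    using T F by (auto simp: grassmann_def fock_def multi_antilinear_def stimes_def algebra_simps)
  moreover have "gsym (\<lambda>hs. stimes T F hs ls) = (\<lambda>hs. stimes T F hs ls)" for ls
    using F by (auto simp: fock_def stimes_def gsym_scale)
  moreover have "alt (stimes T F hs) = stimes T F hs" for hs
  proof
    have "stimes T F hs = (\<lambda>ls. F hs * T ls)" by (auto simp: stimes_def)
    moreover have "alt T = T" using T by (simp add: grassmann_def)
    ultimately show "alt (stimes T F hs) ls = stimes T F hs ls" for ls by (simp add: alt_scale)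
  qed
  ultimately show ?thesis unfolding sfock_def by blast
qed

lemma gmult_scale: "gmult (\<lambda>xs. S xs * c) (\<lambda>xs. T xs * d) xs = c * d * gmult S T xs"
  unfolding gmult_def alt_scale[symmetric] by (simp add: sum_distrib_left mult_ac)

lemma sprod_stimes: "sprod (stimes S F) (stimes T G) = stimes (gmult S T) (fmult F G)"
proof (intro ext)
  fix hs ls
  show "sprod (stimes S F) (stimes T G) hs ls = stimes (gmult S T) (fmult F G) hs ls"
    unfolding sprod_def stimes_def fmult_def gsym_scale[symmetric] gmult_scale
    by (simp add: sum_distrib_left mult_ac)
qed

lemma sstar_stimes: "sstar (stimes T F) = stimes (tstar T) (tstar F)"
  by (intro ext) (simp add: sstar_def stimes_def tstar_def)

lemma spair_stimes: "spair (stimes S F) (stimes T G) = (\<lambda>ls. gmult S T ls * fpair F G)"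
proof
  fix ls
  show "spair (stimes S F) (stimes T G) ls = gmult S T ls * fpair F G"
    unfolding spair_def fpair_def finner_def tstar_def stimes_def gmult_scale
    by (simp add: mult.commute[of _ "gmult S T ls"] infsum_cmult_right')
qed

end

theory Submission
  imports Defs "HOL-Computational_Algebra.Polynomial"
begin

text \<open>
  The values \<open>\<zeta> [h]\<close> of an element of degree one graded-commute in the Grassmann algebra in the same way
  as the arguments \<open>h\<close> do in the Fock space. Hence \<open>\<zeta>\<^sup>n\<close> has the value
  \<open>sqrt n! \<zeta> [h\<^sub>1] \<dots> \<zeta> [h\<^sub>n]\<close> at \<open>h\<^sub>1, \<dots>, h\<^sub>n\<close>, and all powers and exponentials become explicit.
  In \<open>\<langle>\<zeta>\<^sup>n | \<eta>\<^sup>n\<rangle>\<close> the factors pair up, from the inside out, to even and therefore central elements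
  \<open>\<zeta> [h\<^sup>*] \<eta> [h]\<close>, so that the sum over basis vectors is \<open>n! \<langle>\<zeta> | \<eta>\<rangle>\<^sup>n\<close>; this gives the kernel.

  The reproducing property is \<open>(exp \<eta> | \<Xi>) = \<langle>exp \<eta> | \<Xi>\<rangle>\<close>, once it is known that \<open>exp \<eta>\<close> has finite
  norm and that \<open>\<Xi>\<close> is determined by its function. If \<open>\<langle>exp \<zeta> | D\<rangle> = 0\<close> for all real \<open>\<zeta>\<close>, then by scaling
  and polarisation \<open>\<langle>\<zeta>\<^sub>1 \<dots> \<zeta>\<^sub>n | D\<rangle> = 0\<close>, first for real and then for all elements of degree one. For
  \<open>\<zeta>\<^sub>i = \<kappa>\<^sub>i \<otimes> b\<^sub>i\<close> with basis vectors \<open>b\<^sub>i\<close> this says that the products \<open>\<kappa>\<^sub>1 \<dots> \<kappa>\<^sub>n\<close> annihilate the coefficients of \<open>D\<close>,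
  which must vanish because there are infinitely many independent Grassmann generators.
\<close>

section \<open>Permutations of lists\<close>

text \<open>The form on functions goes through \<open>inv_into sfock phi\<close>, so every
  representative must lie in \<open>sfock\<close> and be recoverable from its function. That
  \<open>exp \<eta>\<close> has finite norm rests on the weights \<open>1 / (p!)^2\<close> of the
  Grassmann norm: with them the square norm of a product is at most 3 times the product of the
  square norms, and summing these bounds over all words of basis vectors gives
  \<open>exp (3 N)\<close>, where \<open>N\<close> is the square norm of \<open>\<eta>\<close>.

  An infinite sum that does not converge takes a default value, so summability has to come before
  any manipulation of a pairing. At fixed Grassmann arguments a product is a finite combination of
  products of values; all infinite sums thereby become sums of complex families indexed by words
  over the basis of the one-particle space. The norm, however, controls values at basis vectors
  only. Hilbert-Schmidt bounds extend this control to arbitrary Grassmann arguments, which is also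
  where a generator orthogonal to given arguments is used.\<close>

abbreviation adjacent :: "nat \<Rightarrow> nat \<Rightarrow> nat" where
  "adjacent i \<equiv> Transposition.transpose i (Suc i)"

text \<open>Reduces every sign computation to neighbouring arguments. Composition is required for
  arbitrary factors, so in applications \<open>P\<close> quantifies over all lists of the given
  length: the second permutation acts on an already permuted list.\<close>

lemma adjacent_transpositions_induct:
  assumes \<sigma>: "\<sigma> permutes {..<n}" and id: "P id"
    and adj: "\<And>i. Suc i < n \<Longrightarrow> P (adjacent i)"
    and comp: "\<And>\<sigma> \<tau>. \<sigma> permutes {..<n} \<Longrightarrow> \<tau> permutes {..<n} \<Longrightarrow> P \<sigma> \<Longrightarrow> P \<tau> \<Longrightarrow> P (\<sigma> \<circ> \<tau>)"
  shows "P \<sigma>"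
proof -
  have swp: "adjacent i permutes {..<n}" if "Suc i < n" for i
    using that by (intro permutes_swap_id) auto
  have seq: "apply_adj_transps xs permutes {..<n} \<and> P (apply_adj_transps xs)"
    if "\<forall>x\<in>set xs. Suc x < n" for xs
    using that
  proof (induction xs)
    case (Cons x xs)
    then show ?case
      unfolding apply_adj_transps_Cons Suc_eq_plus1[symmetric]
      using comp[OF swp[of x], of "apply_adj_transps xs"] adj[of x]
        permutes_compose[OF _ swp[of x], of "apply_adj_transps xs"] by (simp del: o_apply)
  qed (simp add: id permutes_id)
  have less: "P (Transposition.transpose a b)" if "a < b" "b < n" for a b
    using seq[of "adj_transp_seq a b"] that by (simp add: adj_transp_seq_correct set_adj_transp_seq)
  have tr: "P (Transposition.transpose a b)" if "a < n" "b < n" for a b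
    using less[of a b] less[of b a] that id
    by (cases a b rule: linorder_cases) (auto simp: transpose_commute)
  show ?thesis
    using \<sigma> finite_lessThan id
  proof (induction rule: permutes_induct)
    case (swap a b p)
    then show ?case using comp[OF permutes_swap_id[of a "{..<n}" b], of p] tr[of a b]
      by (simp del: o_apply)
  qed
qed

lemma permute_list_adjacent:
  "permute_list (adjacent (length xs)) (xs @ a # b # ys) = xs @ b # a # ys"
proof (rule nth_equalityI)
  fix i
  assume "i < length (permute_list (adjacent (length xs)) (xs @ a # b # ys))"
  then have i: "i < length xs + Suc (Suc (length ys))" by simp
  consider "i < length xs" | "i = length xs" | "i = Suc (length xs)"
    | j where "i = length xs + Suc (Suc j)"
  proof (cases "i \<le> Suc (length xs)")
    case False
    then have "i = length xs + Suc (Suc (i - Suc (Suc (length xs))))" by simp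
    then show ?thesis using that(4) by blast
  qed (use that(1-3) in linarith)
  then show "permute_list (adjacent (length xs)) (xs @ a # b # ys) ! i
      = (xs @ b # a # ys) ! i"
    using i by cases (simp_all add: permute_list_def Transposition.transpose_def nth_append del: upt_Suc)
qed simp

lemma split_adjacent:
  assumes "Suc i < length xs"
  obtains us a b vs where "xs = us @ a # b # vs" "length us = i"
proof
  show "xs = take i xs @ xs ! i # xs ! Suc i # drop (Suc (Suc i)) xs"
    using assms by (simp add: Cons_nth_drop_Suc)
  show "length (take i xs) = i" using assms by simp
qed


section \<open>The Grassmann algebra\<close>

subsection \<open>Alternating tensors\<close>

text \<open>Same as \<open>alt T = T\<close>, by \<open>alternating_alt\<close> and
  \<open>alt_alternating\<close>, but a local condition that fits list induction.\<close>

definition alternating :: "'a tensor \<Rightarrow> bool" where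
  "alternating T \<longleftrightarrow> (\<forall>xs a b ys. T (xs @ b # a # ys) = - T (xs @ a # b # ys))"

lemma alternatingD: "alternating T \<Longrightarrow> T (xs @ b # a # ys) = - T (xs @ a # b # ys)"
  unfolding alternating_def by blast

lemma alternating_permute:
  assumes T: "alternating T" and \<sigma>: "\<sigma> permutes {..<length xs}"
  shows "T (permute_list \<sigma> xs) = of_int (sign \<sigma>) * T xs"
proof -
  let ?n = "length xs"
  have "\<forall>xs. length xs = ?n \<longrightarrow> T (permute_list \<sigma> xs) = of_int (sign \<sigma>) * T xs"
    using \<sigma>
  proof (rule adjacent_transpositions_induct)
    fix i assume i: "Suc i < ?n"
    show "\<forall>xs. length xs = ?n \<longrightarrow> T (permute_list (adjacent i) xs)
        = of_int (sign (adjacent i)) * T xs"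
    proof (intro allI impI)
      fix xs :: "'a list" assume "length xs = ?n"
      then obtain us a b vs where "xs = us @ a # b # vs" "length us = i"
        using i split_adjacent[of i xs] by metis
      then show "T (permute_list (adjacent i) xs)
        = of_int (sign (adjacent i)) * T xs"
        using permute_list_adjacent[of us a b vs] alternatingD[OF T, of us b a vs]
        by (simp add: sign_swap_id)
    qed
  next
    fix \<sigma> \<tau> :: "nat \<Rightarrow> nat"
    assume "\<sigma> permutes {..<?n}" "\<tau> permutes {..<?n}"
    then show "\<forall>xs. length xs = ?n \<longrightarrow> T (permute_list \<sigma> xs) = of_int (sign \<sigma>) * T xs \<Longrightarrow>
      \<forall>xs. length xs = ?n \<longrightarrow> T (permute_list \<tau> xs) = of_int (sign \<tau>) * T xs \<Longrightarrow>
      \<forall>xs. length xs = ?n \<longrightarrow> T (permute_list (\<sigma> \<circ> \<tau>) xs) = of_int (sign (\<sigma> \<circ> \<tau>)) * T xs"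
      by (auto simp: permute_list_compose sign_compose permutes_imp_permutation[OF finite_lessThan])
  qed simp
  then show ?thesis by blast
qed

text \<open>Left composition with \<open>\<sigma>\<close> reindexes the sum; the sign it produces
  squares to 1 and so can be moved to the other side.\<close>

lemma alt_permute:
  assumes \<sigma>: "\<sigma> permutes {..<length xs}"
  shows "alt T (permute_list \<sigma> xs) = of_int (sign \<sigma>) * alt T xs"
proof -
  let ?S = "{\<tau>. \<tau> permutes {..<length xs}}"
  have "(\<Sum>\<tau>\<in>?S. of_int (sign \<tau>) * T (permute_list \<tau> xs))
      = (\<Sum>\<tau>\<in>?S. of_int (sign (\<sigma> \<circ> \<tau>)) * T (permute_list (\<sigma> \<circ> \<tau>) xs))"
    by (rule setum_permutations_compose_left[OF \<sigma>])
  also have "\<dots> = (\<Sum>\<tau>\<in>?S. of_int (sign \<sigma>) * (of_int (sign \<tau>) * T (permute_list \<tau> (permute_list \<sigma> xs))))"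
    using \<sigma> by (intro sum.cong)
      (auto simp: permute_list_compose sign_compose permutes_imp_permutation[OF finite_lessThan])
  finally have "of_int (sign \<sigma>) * (\<Sum>\<tau>\<in>?S. of_int (sign \<tau>) * T (permute_list \<tau> xs))
      = of_int (sign \<sigma> * sign \<sigma>) * (\<Sum>\<tau>\<in>?S. of_int (sign \<tau>) * T (permute_list \<tau> (permute_list \<sigma> xs)))"
    by (simp add: mult.assoc flip: sum_distrib_left of_int_mult)
  then show ?thesis by (simp add: alt_def)
qed

text \<open>The counterpart for a permutation inside the tensor, by right composition. Agreement is
  asked only at one length, because in applications \<open>\<tau>\<close> depends on the
  length.\<close>

lemma alt_permuted_arguments:
  assumes \<tau>: "\<tau> permutes {..<length xs}"
    and T': "\<And>ys. length ys = length xs \<Longrightarrow> T' ys = T (permute_list \<tau> ys)"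
  shows "alt T' xs = of_int (sign \<tau>) * alt T xs"
proof -
  let ?S = "{\<sigma>. \<sigma> permutes {..<length xs}}"
  have "(\<Sum>\<sigma>\<in>?S. of_int (sign \<sigma>) * T (permute_list \<sigma> xs))
      = (\<Sum>\<sigma>\<in>?S. of_int (sign (\<sigma> \<circ> \<tau>)) * T (permute_list (\<sigma> \<circ> \<tau>) xs))"
    by (rule sum_permutations_compose_right[OF \<tau>])
  also have "\<dots> = (\<Sum>\<sigma>\<in>?S. of_int (sign \<tau>) * (of_int (sign \<sigma>) * T' (permute_list \<sigma> xs)))"
    using \<tau> by (intro sum.cong)
      (auto simp: permute_list_compose sign_compose permutes_imp_permutation[OF finite_lessThan] T')
  finally have "of_int (sign \<tau>) * (\<Sum>\<sigma>\<in>?S. of_int (sign \<sigma>) * T (permute_list \<sigma> xs))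
      = of_int (sign \<tau> * sign \<tau>) * (\<Sum>\<sigma>\<in>?S. of_int (sign \<sigma>) * T' (permute_list \<sigma> xs))"
    by (simp add: mult.assoc flip: sum_distrib_left of_int_mult)
  then show ?thesis by (simp add: alt_def)
qed

lemma alternating_alt: "alternating (alt T)"
  unfolding alternating_def
proof (intro allI)
  fix xs ys and a b
  show "alt T (xs @ b # a # ys) = - alt T (xs @ a # b # ys)"
    using alt_permute[of "adjacent (length xs)" "xs @ a # b # ys" T]
    by (simp add: permute_list_adjacent permutes_swap_id sign_swap_id)
qed

lemma alt_alternating:
  assumes "alternating T"
  shows "alt T = T"
proof
  fix xs
  have "(\<Sum>\<sigma> | \<sigma> permutes {..<length xs}. of_int (sign \<sigma>) * T (permute_list \<sigma> xs))
      = (\<Sum>\<sigma> | \<sigma> permutes {..<length xs}. T xs)"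
    by (intro sum.cong refl)
      (simp add: alternating_permute[OF assms] flip: mult.assoc of_int_mult)
  then show "alt T xs = T xs"
    by (simp add: alt_def card_permutations[OF refl])
qed

lemma alt_cong: "(\<And>ys. length ys = length xs \<Longrightarrow> S ys = T ys) \<Longrightarrow> alt S xs = alt T xs"
  unfolding alt_def by (auto intro!: sum.cong arg_cong2[where f="(/)"])

lemma alt_add: "alt (\<lambda>xs. S xs + T xs) xs = alt S xs + alt T xs"
  by (simp add: alt_def sum.distrib add_divide_distrib algebra_simps)

lemma alt_sum: "alt (\<lambda>xs. \<Sum>i\<in>I. T i xs) xs = (\<Sum>i\<in>I. alt (T i) xs)"
  by (simp add: alt_def sum_distrib_left sum_divide_distrib sum.swap[of _ I])

section \<open>Reversals, rotations and exchanges of blocks\<close>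

lemma rev_eq_permute_list:
  obtains \<rho> where "\<rho> permutes {..<n}" "\<And>xs :: 'a list. length xs = n \<Longrightarrow> rev xs = permute_list \<rho> xs"
proof -
  define \<rho> where "\<rho> i = (if i < n then n - Suc i else i)" for i
  have "bij_betw \<rho> {..<n} {..<n}"
    by (rule bij_betw_byWitness[where f' = \<rho>]) (auto simp: \<rho>_def)
  then have "\<rho> permutes {..<n}"
    by (rule bij_imp_permutes) (simp add: \<rho>_def)
  then show thesis
    by (rule that) (auto simp: \<rho>_def permute_list_def rev_nth intro!: nth_equalityI)
qed

lemma rotate_eq_permute_list:
  obtains \<rho> where "\<rho> permutes {..<n}" "\<And>xs :: 'a list. length xs = n \<Longrightarrow> rotate k xs = permute_list \<rho> xs"
proof -
  define \<rho> where "\<rho> i = (if i < n then (k + i) mod n else i)" for i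
  have "inj_on \<rho> {..<n}"
  proof (rule linorder_inj_onI')
    fix i j assume ij: "i \<in> {..<n}" "j \<in> {..<n}" "i < j"
    have "\<not> n dvd j - i" using ij by (simp add: nat_dvd_not_less)
    then have "(k + j) mod n \<noteq> (k + i) mod n"
      using ij by (subst mod_eq_dvd_iff_nat) simp_all
    then show "\<rho> i \<noteq> \<rho> j" using ij by (simp add: \<rho>_def)
  qed
  moreover have "\<rho> ` {..<n} \<subseteq> {..<n}" by (auto simp: \<rho>_def)
  ultimately have "bij_betw \<rho> {..<n} {..<n}"
    by (simp add: bij_betw_def endo_inj_surj)
  then have "\<rho> permutes {..<n}"
    by (rule bij_imp_permutes) (simp add: \<rho>_def)
  then show thesis
    by (rule that) (auto simp: \<rho>_def permute_list_def nth_rotate intro!: nth_equalityI)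
qed

text \<open>Permuting inside the tensor and permuting the arguments cost the same sign, whatever the
  fixed permutation is; hence none remains.\<close>

lemma alt_rev: "alt (\<lambda>ys. T (rev ys)) xs = alt T (rev xs)"
proof -
  obtain \<rho> where \<rho>: "\<rho> permutes {..<length xs}"
    "\<And>ys :: 'a list. length ys = length xs \<Longrightarrow> rev ys = permute_list \<rho> ys"
    by (rule rev_eq_permute_list[of "length xs"]) blast
  show ?thesis
    using alt_permuted_arguments[OF \<rho>(1), of "\<lambda>ys. T (rev ys)" T] alt_permute[OF \<rho>(1), of T] \<rho>(2)
    by simp
qed

lemma alt_rotate: "alt (\<lambda>ys. T (rotate k ys)) xs = alt T (rotate k xs)"
proof -
  obtain \<rho> where \<rho>: "\<rho> permutes {..<length xs}"
    "\<And>ys :: 'a list. length ys = length xs \<Longrightarrow> rotate k ys = permute_list \<rho> ys"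
    by (rule rotate_eq_permute_list[of "length xs"]) blast
  show ?thesis
    using alt_permuted_arguments[OF \<rho>(1), of "\<lambda>ys. T (rotate k ys)" T] alt_permute[OF \<rho>(1), of T] \<rho>(2)
    by simp
qed

lemma alternating_move: "alternating T \<Longrightarrow> T (xs @ ys @ a # zs) = (-1) ^ length ys * T (xs @ a # ys @ zs)"
proof (induction ys arbitrary: xs)
  case (Cons y ys)
  have "T (xs @ (y # ys) @ a # zs) = T ((xs @ [y]) @ ys @ a # zs)" by simp
  also have "\<dots> = (-1) ^ length ys * T ((xs @ [y]) @ a # ys @ zs)" using Cons by blast
  also have "T ((xs @ [y]) @ a # ys @ zs) = - T (xs @ a # y # ys @ zs)"
    using alternatingD[OF Cons.prems, of xs y a "ys @ zs"] by simp
  finally show ?case by simp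
qed simp

lemma alternating_swap_blocks:
  "alternating T \<Longrightarrow> T (ys @ xs) = (-1) ^ (length xs * length ys) * T (xs @ ys)"
proof (induction xs arbitrary: ys)
  case (Cons x xs)
  have "T (ys @ x # xs) = T ((ys @ [x]) @ xs)" by simp
  also have "\<dots> = (-1) ^ (length xs * Suc (length ys)) * T (xs @ ys @ x # [])"
    using Cons by (metis length_append_singleton append.assoc)
  also have "T (xs @ ys @ x # []) = (-1) ^ length ys * T (xs @ x # ys @ [])"
    by (rule alternating_move[OF Cons.prems])
  also have "T (xs @ x # ys @ []) = (-1) ^ length xs * T ([] @ x # xs @ ys)"
    using alternating_move[OF Cons.prems, of "[]" xs x ys] by simp
  finally show ?case by (simp add: power_add mult_ac flip: power_mult_distrib)
qed simp

subsection \<open>The product\<close>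

definition ten :: "'a tensor \<Rightarrow> 'a tensor \<Rightarrow> 'a tensor" where
  "ten S T xs = (\<Sum>p\<le>length xs. S (take p xs) * T (drop p xs))"

text \<open>In this normalisation the binomial coefficients disappear from the product.\<close>

definition rescale :: "'a tensor \<Rightarrow> 'a tensor" where
  "rescale T xs = T xs / complex_of_real (sqrt (fact (length xs)))"

lemma ten_Nil [simp]: "ten S T [] = S [] * T []"
  by (simp add: ten_def)

text \<open>The first argument goes either to an empty left block or into the left factor. This
  recursion is what makes associativity an induction on the arguments.\<close>

lemma ten_Cons: "ten S T (x # xs) = S [] * T (x # xs) + ten (\<lambda>ys. S (x # ys)) T xs"
  by (simp add: ten_def sum.atMost_Suc_shift del: sum.atMost_Suc)

lemma ten_add_left: "ten (\<lambda>xs. R xs + S xs) T xs = ten R T xs + ten S T xs"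
  by (simp add: ten_def sum.distrib algebra_simps)

lemma ten_scale_left: "ten (\<lambda>xs. c * S xs) T xs = c * ten S T xs"
  by (simp add: ten_def sum_distrib_left mult_ac)

lemma ten_assoc: "ten (ten R S) T xs = ten R (ten S T) xs"
proof (induction xs arbitrary: R S)
  case (Cons x xs)
  have "ten (\<lambda>ys. ten R S (x # ys)) T xs
      = ten (\<lambda>ys. R [] * S (x # ys) + ten (\<lambda>ys. R (x # ys)) S ys) T xs"
    by (simp add: ten_Cons)
  then show ?case
    by (simp add: ten_Cons ten_add_left ten_scale_left Cons algebra_simps)
qed simp

lemma ten_rev: "ten S T (rev xs) = ten (\<lambda>ys. T (rev ys)) (\<lambda>ys. S (rev ys)) xs"
  unfolding ten_def length_rev
  by (rule sum.reindex_bij_witness[where i="\<lambda>p. length xs - p" and j="\<lambda>p. length xs - p"])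
    (auto simp: take_rev drop_rev)

text \<open>\<open>sqrt (n choose p)\<close> is \<open>sqrt (n!)\<close> divided by the normalising
  factors of the two blocks.\<close>

lemma rescale_gmult: "rescale (gmult S T) = alt (ten (rescale S) (rescale T))"
proof
  fix xs :: "'a list"
  have "of_real (sqrt (length ys choose p)) * (S (take p ys) * T (drop p ys))
      = complex_of_real (sqrt (fact (length xs))) * (rescale S (take p ys) * rescale T (drop p ys))"
    if "length ys = length xs" "p \<le> length ys" for ys p
    using that by (simp add: rescale_def binomial_fact real_sqrt_divide real_sqrt_mult min_def)
  then have "gmult S T xs = alt (\<lambda>ys. complex_of_real (sqrt (fact (length xs))) * ten (rescale S) (rescale T) ys) xs"
    unfolding gmult_def ten_def sum_distrib_left by (intro alt_cong sum.cong) simp_all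
  then show "rescale (gmult S T) xs = alt (ten (rescale S) (rescale T)) xs"
    by (simp add: rescale_def alt_scale)
qed

lemma rescale_inject: "rescale S = rescale T \<Longrightarrow> S = T"
proof
  fix xs assume "rescale S = rescale T"
  then have "rescale S xs = rescale T xs" by simp
  then show "S xs = T xs" by (simp add: rescale_def)
qed

lemma take_permute_list:
  assumes "\<tau> permutes {..<p}" "p \<le> length ys"
  shows "take p (permute_list \<tau> ys) = permute_list \<tau> (take p ys)"
    and "drop p (permute_list \<tau> ys) = drop p ys"
proof -
  have "\<tau> i < p" if "i < p" for i
    using permutes_in_image[OF assms(1), of i] that by simp
  then show "take p (permute_list \<tau> ys) = permute_list \<tau> (take p ys)"
    using assms(2) by (auto simp: permute_list_def intro!: nth_equalityI)
  show "drop p (permute_list \<tau> ys) = drop p ys"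
    using assms(2) permutes_not_in[OF assms(1)]
    by (auto simp: permute_list_def intro!: nth_equalityI)
qed

text \<open>Alternating the first \<open>p\<close> arguments averages over a subgroup of all
  permutations, and the outer alternation absorbs each of its elements with the matching
  sign.\<close>

lemma alt_ten_left: "alt (ten (alt S) T) = alt (ten S T)"
proof
  fix xs :: "'a list"
  let ?n = "length xs"
  have "alt (\<lambda>ys. alt S (take p ys) * T (drop p ys)) xs = alt (\<lambda>ys. S (take p ys) * T (drop p ys)) xs"
    if p: "p \<le> ?n" for p
  proof -
    let ?A = "alt (\<lambda>ys. S (take p ys) * T (drop p ys)) xs"
    have "alt (\<lambda>ys. alt S (take p ys) * T (drop p ys)) xs
        = alt (\<lambda>ys. inverse (fact p) * (\<Sum>\<tau> | \<tau> permutes {..<p}.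
            of_int (sign \<tau>) * (S (permute_list \<tau> (take p ys)) * T (drop p ys)))) xs"
      using p by (intro alt_cong)
        (simp add: alt_def min_def sum_distrib_left sum_distrib_right field_simps sum_divide_distrib)
    also have "\<dots> = inverse (fact p) * (\<Sum>\<tau> | \<tau> permutes {..<p}.
        of_int (sign \<tau>) * alt (\<lambda>ys. S (permute_list \<tau> (take p ys)) * T (drop p ys)) xs)"
      by (simp add: alt_scale alt_sum)
    also have "(\<Sum>\<tau> | \<tau> permutes {..<p}.
        of_int (sign \<tau>) * alt (\<lambda>ys. S (permute_list \<tau> (take p ys)) * T (drop p ys)) xs)
      = (\<Sum>\<tau> | \<tau> permutes {..<p}. ?A)"
    proof (rule sum.cong[OF refl])
      fix \<tau> assume "\<tau> \<in> {\<tau>. \<tau> permutes {..<p}}"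
      then have \<tau>: "\<tau> permutes {..<p}" by simp
      \<comment> \<open>A permutation of the first block is also one of all positions, fixing the
        second block.\<close>
      then have "\<tau> permutes {..<?n}" by (rule permutes_subset) (use p in auto)
      then have "alt (\<lambda>ys. S (permute_list \<tau> (take p ys)) * T (drop p ys)) xs = of_int (sign \<tau>) * ?A"
        by (rule alt_permuted_arguments) (use \<tau> p in \<open>simp add: take_permute_list\<close>)
      then show "of_int (sign \<tau>) * alt (\<lambda>ys. S (permute_list \<tau> (take p ys)) * T (drop p ys)) xs = ?A"
        by (simp flip: mult.assoc of_int_mult)
    qed
    also have "\<dots> = fact p * ?A" by (simp add: card_permutations[OF refl])
    finally show ?thesis by simp
  qed
  moreover have "alt (ten R T) xs = (\<Sum>p\<le>?n. alt (\<lambda>ys. R (take p ys) * T (drop p ys)) xs)" for R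
    unfolding alt_sum[symmetric] by (rule alt_cong) (simp add: ten_def)
  ultimately show "alt (ten (alt S) T) xs = alt (ten S T) xs" by simp
qed

text \<open>The mirror image of \<open>alt_ten_left\<close>: reversing the arguments exchanges the
  two factors.\<close>

lemma alt_ten_right: "alt (ten S (alt T)) = alt (ten S T)"
proof
  fix xs :: "'a list"
  have "alt (ten S (alt T)) (rev (rev xs)) = alt (ten (alt (\<lambda>ys. T (rev ys))) (\<lambda>ys. S (rev ys))) (rev xs)"
    unfolding alt_rev[symmetric, where xs="rev xs"] ten_rev alt_rev[abs_def] ..
  also have "\<dots> = alt (ten S T) (rev (rev xs))"
    unfolding alt_rev[symmetric, where xs="rev xs"] ten_rev alt_ten_left ..
  finally show "alt (ten S (alt T)) xs = alt (ten S T) xs" by simp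
qed

lemma gmult_assoc: "gmult (gmult R S) T = gmult R (gmult S T)"
  by (rule rescale_inject) (simp add: rescale_gmult alt_ten_left alt_ten_right ten_assoc[abs_def])

lemma alternating_gmult: "alternating (gmult S T)"
  unfolding gmult_def by (rule alternating_alt)

lemma gmult_add_left: "gmult (\<lambda>xs. R xs + S xs) T xs = gmult R T xs + gmult S T xs"
  by (simp add: gmult_def alt_add[symmetric] sum.distrib algebra_simps)

lemma gmult_add_right: "gmult R (\<lambda>xs. S xs + T xs) xs = gmult R S xs + gmult R T xs"
  by (simp add: gmult_def alt_add[symmetric] sum.distrib algebra_simps)

lemma gmult_scale_left: "gmult (\<lambda>xs. c * S xs) T xs = c * gmult S T xs"
  using gmult_scale[of S c T 1] by (simp add: mult.commute)

lemma gmult_scale_right: "gmult S (\<lambda>xs. c * T xs) xs = c * gmult S T xs"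
  using gmult_scale[of S 1 T c] by (simp add: mult.commute)

lemma gmult_zero_left [simp]: "gmult (\<lambda>_. 0) T xs = 0"
  using gmult_scale_left[of 0] by simp

lemma gmult_zero_right [simp]: "gmult T (\<lambda>_. 0) xs = 0"
  using gmult_scale_right[of _ 0] by simp

lemma gmult_gone_left: "gmult gone T = alt T"
proof -
  have "(\<Sum>p\<le>length ys. of_real (sqrt (length ys choose p)) * (gone (take p ys) * T (drop p ys)))
      = (\<Sum>p\<in>{0}. of_real (sqrt (length ys choose p)) * (gone (take p ys) * T (drop p ys)))"
    for ys :: "'a list"
    by (rule sum.mono_neutral_right) (auto simp: gone_def)
  then show ?thesis unfolding gmult_def by (simp add: gone_def)
qed

lemma gmult_gone_right: "gmult T gone = alt T"
proof -
  have "(\<Sum>p\<le>length ys. of_real (sqrt (length ys choose p)) * (T (take p ys) * gone (drop p ys)))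
      = (\<Sum>p\<in>{length ys}. of_real (sqrt (length ys choose p)) * (T (take p ys) * gone (drop p ys)))"
    for ys :: "'a list"
    by (rule sum.mono_neutral_right) (auto simp: gone_def)
  then show ?thesis unfolding gmult_def by (simp add: gone_def)
qed

text \<open>The sign is prescribed only for degrees in which both factors are nonzero. This covers
  an even factor against an arbitrary one as well as two factors of definite parity.\<close>

lemma gmult_graded_commute:
  assumes \<epsilon>: "\<And>ys zs. S ys \<noteq> 0 \<Longrightarrow> T zs \<noteq> 0 \<Longrightarrow> (-1) ^ (length ys * length zs) = \<epsilon>"
  shows "gmult S T = (\<lambda>xs. \<epsilon> * gmult T S xs)"
proof (rule rescale_inject, rule ext)
  fix xs :: "'a list"
  let ?n = "length xs" and ?S = "rescale S" and ?T = "rescale T"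
  have \<epsilon>': "(-1) ^ (length ys * length zs) = \<epsilon>" if "?S ys \<noteq> 0" "?T zs \<noteq> 0" for ys zs
    using \<epsilon>[of ys zs] that by (auto simp: rescale_def)
  have "alt (\<lambda>ys. ?S (take p ys) * ?T (drop p ys)) xs
      = \<epsilon> * alt (\<lambda>ys. ?T (take (?n - p) ys) * ?S (drop (?n - p) ys)) xs" if p: "p \<le> ?n" for p
  proof -
    define F where "F ys = ?T (take (?n - p) ys) * ?S (drop (?n - p) ys)" for ys
    \<comment> \<open>Rotating by \<open>p\<close> exchanges the two blocks, and an alternating
      tensor undoes the exchange at the cost of \<open>(-1) ^ (p * (n - p))\<close>.\<close>
    have rot: "rotate p ys = drop p ys @ take p ys" if "length ys = ?n" for ys :: "'a list"
      using rotate_append[of "take p ys" "drop p ys"] that p by (simp add: min_absorb2)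
    have "alt (\<lambda>ys. ?S (take p ys) * ?T (drop p ys)) xs = alt (\<lambda>ys. F (rotate p ys)) xs"
      by (rule alt_cong) (use p in \<open>simp add: F_def rot\<close>)
    also have "\<dots> = alt F (drop p xs @ take p xs)"
      unfolding alt_rotate by (simp add: rot)
    also have "\<dots> = (-1) ^ (p * (?n - p)) * alt F xs"
      using alternating_swap_blocks[OF alternating_alt, of F "drop p xs" "take p xs"] p
      by (simp add: min_def)
    also have "\<dots> = alt (\<lambda>ys. (-1) ^ (p * (?n - p)) * F ys) xs" by (simp add: alt_scale)
    \<comment> \<open>The two signs may differ where \<open>F\<close> vanishes; where it does not,
      the hypothesis applies to the two blocks.\<close>
    also have "\<dots> = alt (\<lambda>ys. \<epsilon> * F ys) xs"
    proof (rule alt_cong)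
      fix ys :: "'a list" assume ys: "length ys = ?n"
      show "(-1) ^ (p * (?n - p)) * F ys = \<epsilon> * F ys"
      proof (cases "F ys = 0")
        case False
        then show ?thesis
          using \<epsilon>'[of "drop (?n - p) ys" "take (?n - p) ys"] ys p by (simp add: F_def min_absorb2)
      qed simp
    qed
    also have "\<dots> = \<epsilon> * alt F xs" by (rule alt_scale)
    finally show ?thesis unfolding F_def .
  qed
  moreover have "alt (ten U V) xs = (\<Sum>p\<le>?n. alt (\<lambda>ys. U (take p ys) * V (drop p ys)) xs)"
    for U V :: "'a tensor"
    unfolding alt_sum[symmetric] by (rule alt_cong) (simp add: ten_def)
  ultimately have "alt (ten ?S ?T) xs
      = \<epsilon> * (\<Sum>p\<le>?n. alt (\<lambda>ys. ?T (take (?n - p) ys) * ?S (drop (?n - p) ys)) xs)"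
    by (simp add: sum_distrib_left)
  also have "(\<Sum>p\<le>?n. alt (\<lambda>ys. ?T (take (?n - p) ys) * ?S (drop (?n - p) ys)) xs)
      = (\<Sum>p\<le>?n. alt (\<lambda>ys. ?T (take p ys) * ?S (drop p ys)) xs)"
    by (rule sum.reindex_bij_witness[where i="\<lambda>p. ?n - p" and j="\<lambda>p. ?n - p"]) auto
  also have "\<dots> = alt (ten ?T ?S) xs"
    unfolding alt_sum[symmetric] by (rule alt_cong) (simp add: ten_def)
  finally have "rescale (gmult S T) xs = \<epsilon> * rescale (gmult T S) xs"
    by (simp add: rescale_gmult)
  then show "rescale (gmult S T) xs = rescale (\<lambda>xs. \<epsilon> * gmult T S xs) xs"
    by (simp add: rescale_def)
qed

section \<open>Reversal of products and the involution\<close>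

lemma gmult_rev: "gmult S T (rev xs) = gmult (\<lambda>ys. T (rev ys)) (\<lambda>ys. S (rev ys)) xs"
proof -
  have "rescale (\<lambda>xs. gmult S T (rev xs)) = rescale (gmult (\<lambda>ys. T (rev ys)) (\<lambda>ys. S (rev ys)))"
  proof
    fix xs :: "'a list"
    have "rescale (\<lambda>xs. gmult S T (rev xs)) xs = rescale (gmult S T) (rev xs)"
      by (simp add: rescale_def)
    also have "\<dots> = alt (ten (\<lambda>ys. rescale T (rev ys)) (\<lambda>ys. rescale S (rev ys))) xs"
      unfolding rescale_gmult alt_rev[symmetric] ten_rev ..
    also have "\<dots> = rescale (gmult (\<lambda>ys. T (rev ys)) (\<lambda>ys. S (rev ys))) xs"
      unfolding rescale_gmult by (simp add: rescale_def[abs_def])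
    finally show "rescale (\<lambda>xs. gmult S T (rev xs)) xs = \<dots>" .
  qed
  then show ?thesis using rescale_inject fun_cong by metis
qed

lemma alt_cnj_map: "alt (\<lambda>ys. cnj (T (map f ys))) xs = cnj (alt T (map f xs))"
  by (simp add: alt_def permute_list_map)

lemma gmult_cnj_map: "gmult (\<lambda>ys. cnj (S (map f ys))) (\<lambda>ys. cnj (T (map f ys))) xs
    = cnj (gmult S T (map f xs))"
  unfolding gmult_def alt_cnj_map[symmetric] by (simp add: take_map drop_map)

lemma tstar_gmult: "tstar (gmult S T) = gmult (tstar T) (tstar S)"
proof
  fix xs
  have "tstar (gmult S T) xs = cnj (gmult (\<lambda>ys. T (rev ys)) (\<lambda>ys. S (rev ys)) (map star xs))"
    by (simp add: tstar_def gmult_rev)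
  then show "tstar (gmult S T) xs = gmult (tstar T) (tstar S) xs"
    by (simp add: tstar_def[abs_def] flip: gmult_cnj_map)
qed

lemma tstar_gone: "tstar gone = gone"
  by (auto simp: tstar_def gone_def)


subsection \<open>Vectors as tensors\<close>

definition vtensor :: "'a::complex_inner \<Rightarrow> 'a tensor" where
  "vtensor x xs = (if length xs = 1 then cinner (hd xs) x else 0)"

lemma vtensor_singleton [simp]: "vtensor x [y] = cinner y x"
  by (simp add: vtensor_def)

lemma tstar_vtensor: "tstar (vtensor x) = vtensor (star x)"
proof
  fix xs :: "'a list"
  show "tstar (vtensor x) xs = vtensor (star x) xs"
  proof (cases "length xs = 1")
    case True
    then obtain y where "xs = [y]" by (auto simp: length_Suc_conv)
    then show ?thesis
      by (simp add: tstar_def) (metis cinner_commute cinner_star_star star_star)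
  qed (simp add: tstar_def vtensor_def)
qed

lemma alternating_vtensor: "alternating (vtensor x)"
  by (simp add: alternating_def vtensor_def)

text \<open>A permutation that moves the last position pairs \<open>\<theta>\<close> with some entry
  of \<open>xs\<close> and contributes nothing. The remaining \<open>n!\<close> permutations
  contribute equally, and \<open>sqrt (n + 1) * n! / (n + 1)!\<close> is
  \<open>1 / sqrt (n + 1)\<close>.\<close>

lemma gmult_vtensor_snoc:
  fixes T :: "'a::complex_inner tensor"
  assumes T: "alternating T" and orth: "\<And>y. y \<in> set xs \<Longrightarrow> cinner y \<theta> = 0"
  shows "gmult T (vtensor \<theta>) (xs @ [x]) = T xs * cinner x \<theta> / sqrt (Suc (length xs))"
proof -
  let ?n = "length xs" and ?xs = "xs @ [x]"
  define G where "G ys = T (take ?n ys) * cinner (ys ! ?n) \<theta>" for ys :: "'a list"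
  have "gmult T (vtensor \<theta>) ?xs = alt (\<lambda>ys. complex_of_real (sqrt (Suc ?n)) * G ys) ?xs"
    unfolding gmult_def
  proof (rule alt_cong)
    fix ys :: "'a list" assume "length ys = length ?xs"
    then have ys: "length ys = Suc ?n" by simp
    have "(\<Sum>p\<le>length ys. of_real (sqrt (length ys choose p)) * (T (take p ys) * vtensor \<theta> (drop p ys)))
      = (\<Sum>p\<in>{?n}. of_real (sqrt (length ys choose p)) * (T (take p ys) * vtensor \<theta> (drop p ys)))"
      by (rule sum.mono_neutral_right) (auto simp: vtensor_def ys)
    also have "drop ?n ys = [ys ! ?n]"
      using ys by (metis Cons_nth_drop_Suc drop_all lessI order_refl)
    ultimately show "(\<Sum>p\<le>length ys. of_real (sqrt (length ys choose p)) * (T (take p ys) * vtensor \<theta> (drop p ys)))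
      = complex_of_real (sqrt (Suc ?n)) * G ys"
      by (simp add: G_def ys)
  qed
  also have "\<dots> = complex_of_real (sqrt (Suc ?n)) * alt G ?xs" by (rule alt_scale)
  also have "alt G ?xs = (\<Sum>\<sigma> | \<sigma> permutes {..<Suc ?n}. of_int (sign \<sigma>) * G (permute_list \<sigma> ?xs)) / fact (Suc ?n)"
    by (simp add: alt_def)
  also have "(\<Sum>\<sigma> | \<sigma> permutes {..<Suc ?n}. of_int (sign \<sigma>) * G (permute_list \<sigma> ?xs))
      = (\<Sum>\<sigma> | \<sigma> permutes {..<?n}. of_int (sign \<sigma>) * G (permute_list \<sigma> ?xs))"
  proof (rule sum.mono_neutral_right)
    show "finite {\<sigma>. \<sigma> permutes {..<Suc ?n}}" by (rule finite_permutations) simp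
    show "{\<sigma>. \<sigma> permutes {..<?n}} \<subseteq> {\<sigma>. \<sigma> permutes {..<Suc ?n}}"
      by (auto intro: permutes_subset)
    show "\<forall>\<sigma>\<in>{\<sigma>. \<sigma> permutes {..<Suc ?n}} - {\<sigma>. \<sigma> permutes {..<?n}}.
        of_int (sign \<sigma>) * G (permute_list \<sigma> ?xs) = 0"
    proof
      fix \<sigma> assume "\<sigma> \<in> {\<sigma>. \<sigma> permutes {..<Suc ?n}} - {\<sigma>. \<sigma> permutes {..<?n}}"
      then have \<sigma>: "\<sigma> permutes {..<Suc ?n}" "\<not> \<sigma> permutes {..<?n}" by auto
      \<comment> \<open>If the last position were fixed, \<open>\<sigma>\<close> would already
        permute the first \<open>n\<close> positions.\<close>
      have "\<sigma> ?n \<noteq> ?n"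
        using permutes_superset[OF \<sigma>(1), of "{..<?n}"] \<sigma>(2) by (auto simp: lessThan_Suc)
      moreover have "\<sigma> ?n < Suc ?n" using permutes_in_image[OF \<sigma>(1), of ?n] by simp
      ultimately have "\<sigma> ?n < ?n" by simp
      then have "cinner (permute_list \<sigma> ?xs ! ?n) \<theta> = 0"
        using \<sigma> by (subst permute_list_nth) (auto simp: nth_append intro!: orth)
      then show "of_int (sign \<sigma>) * G (permute_list \<sigma> ?xs) = 0" by (simp add: G_def)
    qed
  qed
  also have "\<dots> = (\<Sum>\<sigma> | \<sigma> permutes {..<?n}. T xs * cinner x \<theta>)"
  proof (rule sum.cong[OF refl])
    fix \<sigma> assume "\<sigma> \<in> {\<sigma>. \<sigma> permutes {..<?n}}"
    then have \<sigma>: "\<sigma> permutes {..<?n}" by simp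
    then have "G (permute_list \<sigma> ?xs) = T (permute_list \<sigma> xs) * cinner x \<theta>"
      using permutes_not_in[OF \<sigma>, of ?n] permutes_subset[OF \<sigma>, of "{..<Suc ?n}"]
      by (simp add: G_def take_permute_list permute_list_nth)
    then show "of_int (sign \<sigma>) * G (permute_list \<sigma> ?xs) = T xs * cinner x \<theta>"
      by (simp add: alternating_permute[OF T \<sigma>] flip: mult.assoc of_int_mult)
  qed
  also have "\<dots> = fact ?n * (T xs * cinner x \<theta>)" by (simp add: card_permutations[OF refl])
  also have "complex_of_real (sqrt (Suc ?n)) * (fact ?n * (T xs * cinner x \<theta>) / fact (Suc ?n))
      = T xs * cinner x \<theta> * (complex_of_real (sqrt (Suc ?n)) / of_nat (Suc ?n))"
  proof -
    have "c * (f * b / (s * f)) = b * (c / s)" if "f \<noteq> 0" for b c f s :: complex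
      using that by simp
    then show ?thesis unfolding fact_Suc by simp
  qed
  also have "complex_of_real (sqrt (Suc ?n)) / of_nat (Suc ?n) = 1 / complex_of_real (sqrt (Suc ?n))"
    using arg_cong[OF sqrt_divide_self_eq[of "real (Suc ?n)"], of complex_of_real]
    by (simp del: of_nat_Suc add: inverse_eq_divide)
  finally show ?thesis by simp
qed

section \<open>Hilbert spaces\<close>

lemma cinner_add_left: "cinner (x + y) z = cinner x z + cinner y z"
  by (subst (1 2 3) cinner_commute) (simp add: cinner_add_right)

lemma cinner_scaleC_left: "cinner (c *\<^sub>C x) y = cnj c * cinner x y"
  by (subst (1 2) cinner_commute) (simp add: cinner_scaleC_right)

lemma cinner_minus_right: "cinner x (- y) = - cinner x y"
  using cinner_add_right[of x y "- y"] by (simp add: eq_neg_iff_add_eq_0 add.commute)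

lemma cinner_diff_right: "cinner x (y - z) = cinner x y - cinner x z"
  using cinner_add_right[of x y "- z"] by (simp add: cinner_minus_right)

lemma cinner_sum_right: "cinner x (\<Sum>i\<in>A. f i) = (\<Sum>i\<in>A. cinner x (f i))"
  by (induction A rule: infinite_finite_induct) (auto simp: cinner_add_right)

lemma cinner_sum_left: "cinner (\<Sum>i\<in>A. f i) x = (\<Sum>i\<in>A. cinner (f i) x)"
  by (induction A rule: infinite_finite_induct) (auto simp: cinner_add_left)

lemma scaleC_zero [simp]: "0 *\<^sub>C x = 0" "c *\<^sub>C 0 = 0"
  by (rule cvec.scale_zero_left cvec.scale_zero_right)+

lemma cinner_self: "cinner x x = complex_of_real ((norm x)\<^sup>2)"
proof -
  have "Im (cinner x x) = 0" by (metis cinner_commute cnj.simps(2) neg_equal_zero)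
  then show ?thesis
    by (simp add: complex_eq_iff power2_norm_eq_inner inner_eq_Re_cinner)
qed

lemma norm_scaleC: "norm (c *\<^sub>C x) = cmod c * norm x"
proof -
  have "cinner (c *\<^sub>C x) (c *\<^sub>C x) = (c * cnj c) * cinner x x"
    by (simp add: cinner_scaleC_left cinner_scaleC_right mult_ac)
  then have "complex_of_real ((norm (c *\<^sub>C x))\<^sup>2) = complex_of_real ((cmod c * norm x)\<^sup>2)"
    by (simp only: cinner_self complex_norm_square[symmetric] power_mult_distrib of_real_mult)
  then have "(norm (c *\<^sub>C x))\<^sup>2 = (cmod c * norm x)\<^sup>2" by (simp only: of_real_eq_iff)
  then show ?thesis by simp
qed

lemma cinner_Cauchy_Schwarz: "cmod (cinner x y) \<le> norm x * norm y"
proof (cases "cinner x y = 0")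
  case False
  \<comment> \<open>A phase that makes the inner product real and nonnegative, so that the real
    Cauchy-Schwarz inequality applies.\<close>
  define u where "u = cnj (cinner x y) / cmod (cinner x y)"
  have u: "cmod u = 1" using False by (simp add: u_def norm_divide)
  have "u * cinner x y = complex_of_real (cmod (cinner x y))"
    using False by (simp add: u_def complex_norm_square[symmetric] power2_eq_square mult.commute)
  then have "cmod (cinner x y) = Re (cinner x (u *\<^sub>C y))"
    by (simp add: cinner_scaleC_right)
  also have "\<dots> \<le> norm x * norm (u *\<^sub>C y)"
    unfolding inner_eq_Re_cinner[symmetric] by (rule norm_cauchy_schwarz)
  finally show ?thesis by (simp add: norm_scaleC u)
qed simp

section \<open>Orthonormal families and expansions\<close>

lemma cinner_orthonormal:
  "orthonormal B \<Longrightarrow> b \<in> B \<Longrightarrow> c \<in> B \<Longrightarrow> cinner b c = (if b = c then 1 else 0)"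
  by (auto simp: orthonormal_def pairwise_def cinner_self)

lemma orthonormal_subset: "orthonormal B \<Longrightarrow> A \<subseteq> B \<Longrightarrow> orthonormal A"
  by (auto simp: orthonormal_def intro: pairwise_subset)

lemma cinner_orthonormal_sum:
  assumes "orthonormal B" "finite B" "b \<in> B"
  shows "cinner b (\<Sum>c\<in>B. f c *\<^sub>C c) = f b"
proof -
  have "cinner b (\<Sum>c\<in>B. f c *\<^sub>C c) = (\<Sum>c\<in>B. if b = c then f c else 0)"
    unfolding cinner_sum_right
    by (intro sum.cong refl) (simp add: cinner_scaleC_right cinner_orthonormal[OF assms(1,3)])
  then show ?thesis using assms by simp
qed

lemma norm_orthonormal_sum:
  assumes "orthonormal B" "finite B"
  shows "(norm (\<Sum>b\<in>B. f b *\<^sub>C b))\<^sup>2 = (\<Sum>b\<in>B. (cmod (f b))\<^sup>2)"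
proof -
  have "complex_of_real ((norm (\<Sum>b\<in>B. f b *\<^sub>C b))\<^sup>2) = (\<Sum>b\<in>B. cnj (f b) * f b)"
    unfolding cinner_self[symmetric] cinner_sum_left
    by (simp add: cinner_scaleC_left cinner_orthonormal_sum[OF assms])
  also have "\<dots> = complex_of_real (\<Sum>b\<in>B. (cmod (f b))\<^sup>2)"
    unfolding of_real_sum by (intro sum.cong refl) (simp add: complex_norm_square mult.commute flip: of_real_power)
  finally show ?thesis by (simp only: of_real_eq_iff)
qed

lemma norm_orthonormal_residual:
  assumes "orthonormal B" "finite B"
  shows "(norm x)\<^sup>2 = (\<Sum>b\<in>B. (cmod (cinner b x))\<^sup>2) + (norm (x - (\<Sum>b\<in>B. cinner b x *\<^sub>C b)))\<^sup>2"
proof -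
  define y where "y = (\<Sum>b\<in>B. cinner b x *\<^sub>C b)"
  have "cinner y (x - y) = 0"
    by (simp add: y_def cinner_sum_left cinner_scaleC_left cinner_diff_right
        cinner_orthonormal_sum[OF assms])
  then have "inner y (x - y) = 0" by (simp add: inner_eq_Re_cinner)
  then have "orthogonal y (x - y)" by (simp add: orthogonal_def)
  then have "(norm (y + (x - y)))\<^sup>2 = (norm y)\<^sup>2 + (norm (x - y))\<^sup>2"
    by (rule norm_add_Pythagorean)
  then show ?thesis by (simp add: y_def norm_orthonormal_sum[OF assms])
qed

lemma Bessel:
  assumes "orthonormal B" "finite B"
  shows "(\<Sum>b\<in>B. (cmod (cinner b x))\<^sup>2) \<le> (norm x)\<^sup>2"
  using norm_orthonormal_residual[OF assms, of x] by simp

text \<open>\<open>is_onb\<close> demands only that no nonzero vector be orthogonal to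
  \<open>B\<close>. Bessel's inequality makes the partial sums a Cauchy net, completeness gives a
  limit \<open>y\<close>, and \<open>x - y\<close> is orthogonal to all of \<open>B\<close>.\<close>

lemma onb_expansion:
  fixes x :: "'a::chilbert_space"
  assumes B: "is_onb B"
  shows "((\<lambda>b. cinner b x *\<^sub>C b) has_sum x) B"
proof -
  have on: "orthonormal B" using B by (simp add: is_onb_def)
  let ?f = "\<lambda>b. (cmod (cinner b x))\<^sup>2" and ?g = "\<lambda>b. cinner b x *\<^sub>C b"
  have bound: "sum ?f F \<le> (norm x)\<^sup>2" if "finite F" "F \<subseteq> B" for F
    using that Bessel[of F x] orthonormal_subset[OF on] by blast
  have f: "?f summable_on B"
    by (rule nonneg_bdd_above_summable_on) (auto intro!: bdd_aboveI2[where M="(norm x)\<^sup>2"] bound)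
  have "cauchy_filter (filtermap (sum ?g) (finite_subsets_at_top B))"
    unfolding cauchy_filter_metric_filtermap
  proof (intro allI impI)
    fix e :: real assume "e > 0"
    define d where "d = (e / 2)\<^sup>2"
    have "d > 0" using \<open>e > 0\<close> by (simp add: d_def)
    \<comment> \<open>Beyond \<open>F\<close> the squares add up to at most \<open>d / 2\<close>, so
      every larger partial sum stays within \<open>e / 2\<close> of the one over
      \<open>F\<close>.\<close>
    then obtain F where F: "finite F" "F \<subseteq> B" "dist (sum ?f F) (infsum ?f B) \<le> d / 2"
      using infsum_finite_approximation[OF f, of "d / 2"] by auto
    define P where "P G \<longleftrightarrow> finite G \<and> F \<subseteq> G \<and> G \<subseteq> B" for G
    have close: "norm (sum ?g F - sum ?g G) < e / 2" if "P G" for G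
    proof -
      have G: "finite G" "F \<subseteq> G" "G \<subseteq> B" using that by (auto simp: P_def)
      have "(norm (sum ?g F - sum ?g G))\<^sup>2 = (norm (sum ?g (G - F)))\<^sup>2"
        using G by (simp add: sum_diff norm_minus_commute)
      also have "\<dots> = sum ?f (G - F)"
        by (rule norm_orthonormal_sum) (use G in \<open>auto intro!: orthonormal_subset[OF on]\<close>)
      also have "\<dots> = sum ?f G - sum ?f F" using G by (simp add: sum_diff)
      also have "\<dots> \<le> infsum ?f B - sum ?f F"
        using finite_sum_le_infsum[OF f G(1,3)] by simp
      also have "\<dots> \<le> d / 2" using F(3) by (simp only: dist_real_def abs_le_iff minus_diff_eq)
      finally have "(norm (sum ?g F - sum ?g G))\<^sup>2 < (e / 2)\<^sup>2"
        using \<open>d > 0\<close> unfolding d_def by linarith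
      then show ?thesis by (rule power2_less_imp_less) (use \<open>e > 0\<close> in simp_all)
    qed
    have "eventually P (finite_subsets_at_top B)"
      unfolding eventually_finite_subsets_at_top P_def using F by blast
    moreover have "dist (sum ?g G) (sum ?g G') < e" if "P G" "P G'" for G G'
      by (rule dist_triangle_half_r[of "sum ?g F"]) (use close that in \<open>simp_all add: dist_norm\<close>)
    ultimately show "\<exists>P. eventually P (finite_subsets_at_top B) \<and>
        (\<forall>G G'. P G \<and> P G' \<longrightarrow> dist (sum ?g G) (sum ?g G') < e)" by blast
  qed
  then obtain y where y: "(?g has_sum y) B"
    using cauchy_filter_convergent[of "filtermap (sum ?g) (finite_subsets_at_top B)"]
    by (auto simp: filterlim_def has_sum_def convergent_filter_iff)
  have "cinner b (x - y) = 0" if b: "b \<in> B" for b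
  proof -
    have bl: "bounded_linear (cinner b :: 'a \<Rightarrow> complex)"
    proof (rule bounded_linear_intro[where K="norm b"])
      show "cinner b (r *\<^sub>R z) = r *\<^sub>R cinner b z" for r z
        unfolding scaleC_of_real[symmetric] cinner_scaleC_right by (simp add: scaleR_conv_of_real)
      show "cmod (cinner b z) \<le> norm z * norm b" for z
        using cinner_Cauchy_Schwarz[of b z] by (simp add: mult.commute)
    qed (rule cinner_add_right)
    have "((\<lambda>c. cinner b (?g c)) has_sum cinner b y) B"
      using has_sum_bounded_linear[OF bl y] by (simp add: o_def)
    moreover have "((\<lambda>c. cinner b (?g c)) has_sum cinner b x) B"
    proof (rule has_sum_finite_neutralI[where B="{b}"])
    qed (use b in \<open>auto simp: cinner_scaleC_right cinner_orthonormal[OF on]\<close>)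
    ultimately show ?thesis by (simp add: cinner_diff_right has_sum_unique)
  qed
  then have "x - y = 0" using B unfolding is_onb_def by blast
  then show ?thesis using y by simp
qed

text \<open>Cauchy-Schwarz on finite partial sums of the expansion of \<open>x\<close>. Continuity
  of \<open>f\<close>, from the bound with \<open>C\<close>, passes to the limit; the resulting
  estimate is in terms of \<open>M\<close>.\<close>

lemma antilinear_le_onb:
  fixes f :: "'a::chilbert_space \<Rightarrow> complex"
  assumes B: "is_onb B" and add: "\<And>x y. f (x + y) = f x + f y" and scale: "\<And>c x. f (c *\<^sub>C x) = cnj c * f x"
    and bounded: "\<And>x. cmod (f x) \<le> C * norm x"
    and M: "\<And>F. finite F \<Longrightarrow> F \<subseteq> B \<Longrightarrow> (\<Sum>b\<in>F. (cmod (f b))\<^sup>2) \<le> M"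
  shows "(cmod (f x))\<^sup>2 \<le> (norm x)\<^sup>2 * M"
proof -
  have on: "orthonormal B" using B by (simp add: is_onb_def)
  have "0 \<le> M" using M[of "{}"] by simp
  have bl: "bounded_linear f"
  proof (rule bounded_linear_intro[where K=C])
    show "f (r *\<^sub>R z) = r *\<^sub>R f z" for r z
      unfolding scaleC_of_real[symmetric] scale by (simp add: scaleR_conv_of_real)
  qed (use add bounded in \<open>auto simp: mult.commute\<close>)
  let ?y = "\<lambda>F. \<Sum>b\<in>F. cinner b x *\<^sub>C b"
  have "(?y \<longlongrightarrow> x) (finite_subsets_at_top B)"
    using onb_expansion[OF B, of x] by (simp add: has_sum_def)
  then have "((\<lambda>F. (cmod (f (?y F)))\<^sup>2) \<longlongrightarrow> (cmod (f x))\<^sup>2) (finite_subsets_at_top B)"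
    by (intro tendsto_intros bounded_linear.tendsto[OF bl])
  moreover have "eventually (\<lambda>F. (cmod (f (?y F)))\<^sup>2 \<le> (norm x)\<^sup>2 * M) (finite_subsets_at_top B)"
  proof (rule eventually_finite_subsets_at_top_weakI)
    fix F assume F: "finite F" "F \<subseteq> B"
    have "f (?y F) = (\<Sum>b\<in>F. cnj (cinner b x) * f b)"
      by (simp add: linear_sum[OF bounded_linear.linear[OF bl]] scale)
    then have "cmod (f (?y F)) \<le> (\<Sum>b\<in>F. cmod (cinner b x) * cmod (f b))"
      by (simp add: sum_norm_le norm_mult)
    then have "(cmod (f (?y F)))\<^sup>2 \<le> (\<Sum>b\<in>F. cmod (cinner b x) * cmod (f b))\<^sup>2"
      by (simp add: power_mono)
    also have "\<dots> \<le> (\<Sum>b\<in>F. (cmod (cinner b x))\<^sup>2) * (\<Sum>b\<in>F. (cmod (f b))\<^sup>2)"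
      by (rule Cauchy_Schwarz_ineq_sum)
    also have "\<dots> \<le> (norm x)\<^sup>2 * M"
      using Bessel[of F x] F M orthonormal_subset[OF on] \<open>0 \<le> M\<close>
      by (intro mult_mono) (auto intro: sum_nonneg)
    finally show "(cmod (f (?y F)))\<^sup>2 \<le> (norm x)\<^sup>2 * M" .
  qed
  ultimately show ?thesis by (rule tendsto_upperbound) simp
qed

section \<open>Tensors controlled by their values on words of basis vectors\<close>

definition words :: "'a set \<Rightarrow> nat \<Rightarrow> 'a list set" where
  "words A n = {xs \<in> lists A. length xs = n}"

lemma words_0 [simp]: "words A 0 = {[]}"
  by (auto simp: words_def)

lemma words_Suc: "words A (Suc n) = (\<lambda>(x, xs). x # xs) ` (A \<times> words A n)"
  by (auto simp: words_def length_Suc_conv image_iff)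

lemma bij_betw_words_Suc: "bij_betw (\<lambda>(x, xs). x # xs) (A \<times> words A n) (words A (Suc n))"
  unfolding words_Suc by (rule bij_betw_imageI) (auto simp: inj_on_def)

lemma multi_antilinear_Cons: "multi_antilinear T \<Longrightarrow> multi_antilinear (\<lambda>xs. T (x # xs))"
  unfolding multi_antilinear_def by (metis append_Cons)

lemma multi_antilinear_zero: "multi_antilinear T \<Longrightarrow> 0 \<in> set xs \<Longrightarrow> T xs = 0"
proof -
  assume T: "multi_antilinear T" and "0 \<in> set xs"
  then obtain us vs where xs: "xs = us @ 0 # vs" by (auto dest: split_list)
  have "T (us @ (0 *\<^sub>C 0) # vs) = cnj 0 * T (us @ 0 # vs)"
    using T unfolding multi_antilinear_def by blast
  then show "T xs = 0" by (simp add: xs)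
qed

abbreviation prod_norm :: "'a::real_normed_vector list \<Rightarrow> real" where
  "prod_norm xs \<equiv> prod_list (map norm xs)"

text \<open>The Hilbert-Schmidt norm dominates the norm as a multilinear functional. Induction on
  the degree: fixing the first argument to a basis vector gives a slice of one degree less, and the
  squared norms of the slices add up to that of \<open>T\<close>.\<close>

lemma multi_antilinear_le_onb:
  fixes T :: "'a::chilbert_space tensor"
  assumes B: "is_onb B" and T: "multi_antilinear T"
    and bounded: "\<And>xs. length xs = n \<Longrightarrow> cmod (T xs) \<le> C * prod_norm xs"
    and summable: "(\<lambda>xs. (cmod (T xs))\<^sup>2) summable_on words B n"
    and xs: "length xs = n"
  shows "(cmod (T xs))\<^sup>2 \<le> (prod_norm xs)\<^sup>2 * (\<Sum>\<^sub>\<infinity>xs\<in>words B n. (cmod (T xs))\<^sup>2)"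
  using T bounded summable xs
proof (induction n arbitrary: T xs C)
  case (Suc n)
  obtain x ys where xs: "xs = x # ys" "length ys = n" using Suc.prems(4) by (auto simp: length_Suc_conv)
  let ?N = "\<lambda>b. \<Sum>\<^sub>\<infinity>zs\<in>words B n. (cmod (T (b # zs)))\<^sup>2"
  have "(\<lambda>p. (cmod (T (case p of (b, zs) \<Rightarrow> b # zs)))\<^sup>2) summable_on B \<times> words B n"
    using Suc.prems(3) by (subst summable_on_reindex_bij_betw[OF bij_betw_words_Suc])
  then have sum: "(\<lambda>(b, zs). (cmod (T (b # zs)))\<^sup>2) summable_on B \<times> words B n"
    by (simp add: case_prod_unfold)
  have N: "?N summable_on B" by (rule summable_on_Sigma_banach[OF sum])
  have "(\<Sum>\<^sub>\<infinity>xs\<in>words B (Suc n). (cmod (T xs))\<^sup>2)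
      = (\<Sum>\<^sub>\<infinity>(b, zs)\<in>B \<times> words B n. (cmod (T (b # zs)))\<^sup>2)"
    by (subst infsum_reindex_bij_betw[OF bij_betw_words_Suc, symmetric]) (simp add: case_prod_unfold)
  also have "\<dots> = infsum ?N B" by (rule infsum_Sigma'_banach[OF sum, symmetric])
  finally have total: "(\<Sum>\<^sub>\<infinity>xs\<in>words B (Suc n). (cmod (T xs))\<^sup>2) = infsum ?N B" .
  have IH: "(cmod (T (b # ys)))\<^sup>2 \<le> (prod_norm ys)\<^sup>2 * ?N b" if b: "b \<in> B" for b
  proof (rule Suc.IH)
    show "multi_antilinear (\<lambda>xs. T (b # xs))" by (rule multi_antilinear_Cons[OF Suc.prems(1)])
    show "cmod (T (b # zs)) \<le> (C * norm b) * prod_norm zs" if "length zs = n" for zs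
      using Suc.prems(2)[of "b # zs"] that by (simp add: mult_ac)
    show "(\<lambda>zs. (cmod (T (b # zs)))\<^sup>2) summable_on words B n"
      by (rule summable_on_SigmaD1[OF sum b])
  qed (rule xs)
  have "(cmod (T (x # ys)))\<^sup>2 \<le> (norm x)\<^sup>2 * ((prod_norm ys)\<^sup>2 * infsum ?N B)"
  proof (rule antilinear_le_onb[OF B])
    show "T ((x + y) # ys) = T (x # ys) + T (y # ys)" for x y
      using Suc.prems(1) unfolding multi_antilinear_def by (metis append_Nil)
    show "T ((c *\<^sub>C x) # ys) = cnj c * T (x # ys)" for c x
      using Suc.prems(1) unfolding multi_antilinear_def by (metis append_Nil)
    show "cmod (T (x # ys)) \<le> (C * prod_norm ys) * norm x" for x
      using Suc.prems(2)[of "x # ys"] xs by (simp add: mult_ac)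
    fix F assume F: "finite F" "F \<subseteq> B"
    have "(\<Sum>b\<in>F. (cmod (T (b # ys)))\<^sup>2) \<le> (\<Sum>b\<in>F. (prod_norm ys)\<^sup>2 * ?N b)"
      using F IH by (intro sum_mono) auto
    also have "\<dots> \<le> (prod_norm ys)\<^sup>2 * infsum ?N B"
      unfolding sum_distrib_left[symmetric]
      by (intro mult_left_mono finite_sum_le_infsum[OF N F]) (auto intro: infsum_nonneg)
    finally show "(\<Sum>b\<in>F. (cmod (T (b # ys)))\<^sup>2) \<le> (prod_norm ys)\<^sup>2 * infsum ?N B" .
  qed
  then show ?case unfolding total by (simp add: xs power_mult_distrib mult_ac)
qed simp

lemma multi_antilinear_eq_0_onb:
  fixes T :: "'a::chilbert_space tensor"
  assumes "is_onb B" "multi_antilinear T"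
    and "\<And>ys. length ys = length xs \<Longrightarrow> cmod (T ys) \<le> C * prod_norm ys"
    and 0: "\<And>ys. ys \<in> words B (length xs) \<Longrightarrow> T ys = 0"
  shows "T xs = 0"
proof -
  have "(\<Sum>\<^sub>\<infinity>ys\<in>words B (length xs). (cmod (T ys))\<^sup>2) = (\<Sum>\<^sub>\<infinity>ys\<in>words B (length xs). 0)"
    by (rule infsum_cong) (simp add: 0)
  moreover have "(\<lambda>ys. (cmod (T ys))\<^sup>2) summable_on words B (length xs)"
    by (subst summable_on_cong[where g="\<lambda>_. 0"]) (simp_all add: 0)
  moreover have "(cmod (T xs))\<^sup>2
      \<le> (prod_norm xs)\<^sup>2 * (\<Sum>\<^sub>\<infinity>ys\<in>words B (length xs). (cmod (T ys))\<^sup>2)"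
    if "(\<lambda>ys. (cmod (T ys))\<^sup>2) summable_on words B (length xs)"
    by (rule multi_antilinear_le_onb[OF assms(1-3) that refl])
  ultimately have "(cmod (T xs))\<^sup>2 \<le> 0" by simp
  then show ?thesis by simp
qed

text \<open>An orthonormal set that is total in the span of \<open>S\<close> is independent and
  therefore finite, so some vector is no combination of it. Removing the projection of that vector
  leaves a nonzero residue.\<close>

lemma exists_orthogonal:
  fixes S :: "'l::grassmann_generators set"
  assumes S: "finite S"
  obtains \<theta> where "\<theta> \<noteq> 0" "\<And>y. y \<in> S \<Longrightarrow> cinner y \<theta> = 0"
proof -
  obtain B where B: "B \<subseteq> cvec.span S" "orthonormal B"
    and total: "\<And>x. x \<in> cvec.span S \<Longrightarrow> (\<And>b. b \<in> B \<Longrightarrow> cinner b x = 0) \<Longrightarrow> x = 0"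
    using orthonormal_extension[OF cvec.subspace_span[of S]] by metis
  have "cvec.independent B"
    unfolding cvec.dependent_explicit
  proof safe
    fix F u b assume F: "finite F" "F \<subseteq> B" "(\<Sum>v\<in>F. u v *\<^sub>C v) = 0" and b: "b \<in> F" "u b \<noteq> 0"
    have "u b = cinner b (\<Sum>v\<in>F. u v *\<^sub>C v)"
      by (rule cinner_orthonormal_sum[symmetric]) (use F b orthonormal_subset[OF B(2)] in auto)
    then show False using F b by simp
  qed
  then have "finite B" using cvec.independent_span_bound[OF S] B(1) by blast
  obtain x where x: "\<And>c. x \<noteq> (\<Sum>b\<in>B. c b *\<^sub>C b)"
    using infinite_dimensional[OF \<open>finite B\<close>] by blast
  define \<theta> where "\<theta> = x - (\<Sum>b\<in>B. cinner b x *\<^sub>C b)"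
  have \<theta>: "cinner b \<theta> = 0" if "b \<in> B" for b
    by (simp add: \<theta>_def cinner_diff_right cinner_orthonormal_sum[OF B(2) \<open>finite B\<close> that])
  show thesis
  proof
    show "\<theta> \<noteq> 0" using x[of "\<lambda>b. cinner b x"] by (simp add: \<theta>_def)
    fix y assume "y \<in> S"
    \<comment> \<open>Totality within the span shows that \<open>y\<close> equals its own
      projection, so orthogonality to \<open>B\<close> suffices.\<close>
    have "y - (\<Sum>b\<in>B. cinner b y *\<^sub>C b) = 0"
    proof (rule total)
      show "y - (\<Sum>b\<in>B. cinner b y *\<^sub>C b) \<in> cvec.span S"
        by (intro cvec.span_diff cvec.span_sum cvec.span_scale)
          (use B(1) cvec.span_base[OF \<open>y \<in> S\<close>] in auto)
    qed (simp add: cinner_diff_right cinner_orthonormal_sum[OF B(2) \<open>finite B\<close>])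
    then have "y = (\<Sum>b\<in>B. cinner b y *\<^sub>C b)" by simp
    then have "cinner y \<theta> = cinner (\<Sum>b\<in>B. cinner b y *\<^sub>C b) \<theta>" by simp
    then show "cinner y \<theta> = 0" by (simp add: cinner_sum_left cinner_scaleC_left \<theta>)
  qed
qed

text \<open>By infinite dimension, a generator can be chosen orthogonal to any given arguments.\<close>

lemma gmult_vtensor_eq_0:
  fixes T :: "'l::grassmann_generators tensor"
  assumes T: "alternating T" and 0: "\<And>\<theta>. gmult (vtensor \<theta>) T = (\<lambda>_. 0)"
  shows "T = (\<lambda>_. 0)"
proof
  fix xs :: "'l list"
  obtain \<theta> :: 'l where \<theta>: "\<theta> \<noteq> 0" "\<And>y. y \<in> set xs \<Longrightarrow> cinner y \<theta> = 0"
    by (rule exists_orthogonal[OF finite_set[of xs]]) blast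
  \<comment> \<open>\<open>gmult_vtensor_snoc\<close> has the generator as the right factor;
    reversing the arguments carries it to the left.\<close>
  have "alternating (\<lambda>ys. T (rev ys))"
    unfolding alternating_def
  proof (intro allI)
    fix us vs and a b :: 'l
    show "T (rev (us @ b # a # vs)) = - T (rev (us @ a # b # vs))"
      using alternatingD[OF T, of "rev vs" a b "rev us"] by simp
  qed
  then have "gmult (\<lambda>ys. T (rev ys)) (vtensor \<theta>) (rev xs @ [\<theta>])
      = T xs * cinner \<theta> \<theta> / sqrt (Suc (length xs))"
    using gmult_vtensor_snoc[of "\<lambda>ys. T (rev ys)" "rev xs" \<theta> \<theta>] \<theta> by simp
  moreover have "(\<lambda>ys. vtensor \<theta> (rev ys)) = vtensor \<theta>"
  proof
    fix ys show "vtensor \<theta> (rev ys) = vtensor \<theta> ys"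
      by (cases "length ys = 1") (auto simp: vtensor_def length_Suc_conv)
  qed
  ultimately have "gmult (vtensor \<theta>) T (\<theta> # xs) = T xs * cinner \<theta> \<theta> / sqrt (Suc (length xs))"
    using gmult_rev[of "vtensor \<theta>" T "rev xs @ [\<theta>]"] by simp
  then show "T xs = 0" using \<theta>(1) by (auto simp: 0 cinner_self)
qed

section \<open>The graded symmetrisation\<close>

subsection \<open>The even and odd parts of the one-particle space\<close>

lemma hpart_zero: "0 \<in> hpart k"
proof -
  have "(0 :: 'a) = 0 + star 0" by simp
  then show ?thesis unfolding hpart_def using zero_in_E by blast
qed

lemma hpart_add: "x \<in> hpart k \<Longrightarrow> y \<in> hpart k \<Longrightarrow> x + y \<in> hpart k"
proof -
  assume "x \<in> hpart k" "y \<in> hpart k"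
  then obtain a b c d where "x = a + star b" "y = c + star d" "a \<in> E k" "b \<in> E k" "c \<in> E k" "d \<in> E k"
    by (auto simp: hpart_def)
  then have "x + y = (a + c) + star (b + d)" "a + c \<in> E k" "b + d \<in> E k"
    by (auto simp: star_add add_in_E)
  then show "x + y \<in> hpart k" unfolding hpart_def by blast
qed

lemma hpart_scaleC: "x \<in> hpart k \<Longrightarrow> c *\<^sub>C x \<in> hpart k"
proof -
  assume "x \<in> hpart k"
  then obtain a b where "x = a + star b" "a \<in> E k" "b \<in> E k" by (auto simp: hpart_def)
  then have "c *\<^sub>C x = c *\<^sub>C a + star (cnj c *\<^sub>C b)" "c *\<^sub>C a \<in> E k" "cnj c *\<^sub>C b \<in> E k"
    by (auto simp: star_scaleC scaleC_add_right scaleC_in_E)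
  then show "c *\<^sub>C x \<in> hpart k" unfolding hpart_def by blast
qed

lemma hpart_star: "x \<in> hpart k \<Longrightarrow> star x \<in> hpart k"
proof -
  assume "x \<in> hpart k"
  then obtain a b where "x = a + star b" "a \<in> E k" "b \<in> E k" by (auto simp: hpart_def)
  then have "star x = b + star a" "a \<in> E k" "b \<in> E k"
    by (auto simp: star_add star_star add.commute)
  then show "star x \<in> hpart k" unfolding hpart_def by blast
qed

lemma hpart_diff: "x \<in> hpart k \<Longrightarrow> y \<in> hpart k \<Longrightarrow> x - y \<in> hpart k"
  using hpart_add[of x k "(-1) *\<^sub>C y"] hpart_scaleC[of y k "-1"] scaleC_of_real[of "-1" y] by simp

lemma hpart_orthogonal:
  assumes "x \<in> hpart k" "y \<in> hpart (\<not> k)"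
  shows "cinner x y = 0"
proof -
  obtain a b c d where *: "x = a + star b" "y = c + star d" "a \<in> E k" "b \<in> E k" "c \<in> E (\<not> k)" "d \<in> E (\<not> k)"
    using assms by (auto simp: hpart_def)
  have "cinner (star b) c = 0"
    by (metis * cinner_commute complex_cnj_zero orthogonal_E_star)
  moreover have "cinner a c = 0" by (rule orthogonal_E_E[OF *(3,5)]) simp
  moreover have "cinner d b = 0" by (rule orthogonal_E_E[OF *(6,4)]) simp
  moreover have "cinner a (star d) = 0" by (rule orthogonal_E_star[OF *(3,6)])
  ultimately show ?thesis by (simp add: * cinner_add_left cinner_add_right cinner_star_star)
qed

text \<open>The difference of two candidates lies in both the even and the odd part and so is
  orthogonal to itself.\<close>

lemma hproj:
  fixes f :: "'h::super_chilbert_space"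
  shows "hproj k f \<in> hpart k" "f - hproj k f \<in> hpart (\<not> k)"
    and hproj_unique: "g \<in> hpart k \<Longrightarrow> f - g \<in> hpart (\<not> k) \<Longrightarrow> hproj k f = g"
proof -
  have unique: "g = g'" if "g \<in> hpart k" "f - g \<in> hpart (\<not> k)" "g' \<in> hpart k" "f - g' \<in> hpart (\<not> k)"
    for g g' :: 'h
  proof -
    have "(f - g') - (f - g) \<in> hpart (\<not> k)" by (rule hpart_diff[OF that(4,2)])
    then have "g - g' \<in> hpart (\<not> k)" by simp
    moreover have "g - g' \<in> hpart k" by (rule hpart_diff[OF that(1,3)])
    ultimately have "cinner (g - g') (g - g') = 0" by (rule hpart_orthogonal[rotated])
    then show ?thesis using cinner_self_eq_0[of "g - g'"] by simp
  qed
  have "\<exists>g. g \<in> hpart k \<and> f - g \<in> hpart (\<not> k)"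
  proof -
    obtain x y x' y' where *: "x \<in> E False" "y \<in> E False" "x' \<in> E True" "y' \<in> E True"
      "f = x + star y + (x' + star y')" using E_decomposition[of f] by blast
    then have "x + star y \<in> hpart False" "x' + star y' \<in> hpart True"
      by (auto simp: hpart_def)
    then show ?thesis
      using * by (cases k) (auto intro: exI[of _ "x + star y"] exI[of _ "x' + star y'"])
  qed
  then have ex1: "\<exists>!g. g \<in> hpart k \<and> f - g \<in> hpart (\<not> k)" using unique by blast
  show "hproj k f \<in> hpart k" "f - hproj k f \<in> hpart (\<not> k)"
    using theI'[OF ex1] by (auto simp: hproj_def)
  then show "hproj k f = g" if "g \<in> hpart k" "f - g \<in> hpart (\<not> k)"
    using unique that by blast
qed

lemma hproj_same: "f \<in> hpart k \<Longrightarrow> hproj k f = f"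
  by (rule hproj_unique) (auto simp: hpart_zero)

lemma hproj_other: "f \<in> hpart (\<not> k) \<Longrightarrow> hproj k f = 0"
  by (rule hproj_unique) (auto simp: hpart_zero)

lemma hproj_decomposition: "hproj False f + hproj True f = f"
proof -
  have "hproj True f = f - hproj False f"
    by (rule hproj_unique) (use hproj(1)[where k=False and f=f] hproj(2)[where k=False and f=f] in simp_all)
  then show ?thesis by simp
qed


subsection \<open>The sign of a permutation of graded vectors\<close>

text \<open>The condition \<open>(i < j) \<noteq> (\<sigma> i < \<sigma> j)\<close> is symmetric in
  two distinct positions, so the sign belongs to an unordered pair and survives a relabelling of the
  positions.\<close>

definition inversion_sign :: "(nat \<Rightarrow> nat) \<Rightarrow> bool list \<Rightarrow> nat \<Rightarrow> nat \<Rightarrow> complex" where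
  "inversion_sign \<sigma> ks i j = (if ks ! \<sigma> i \<and> ks ! \<sigma> j \<and> (i < j) \<noteq> (\<sigma> i < \<sigma> j) then -1 else 1)"

definition increasing_pairs :: "nat \<Rightarrow> (nat \<times> nat) set" where
  "increasing_pairs n = {(i, j). i < j \<and> j < n}"

lemma finite_increasing_pairs [simp]: "finite (increasing_pairs n)"
  by (rule finite_subset[of _ "{..<n} \<times> {..<n}"]) (auto simp: increasing_pairs_def)

lemma chi_eq_prod:
  assumes \<sigma>: "\<sigma> permutes {..<length ks}"
  shows "chi \<sigma> ks = (\<Prod>(i, j)\<in>increasing_pairs (length ks). inversion_sign \<sigma> ks i j)"
proof -
  let ?A = "increasing_pairs (length ks)"
    and ?B = "{(i, j). i < j \<and> j < length ks \<and> \<sigma> i > \<sigma> j \<and> ks ! \<sigma> i \<and> ks ! \<sigma> j}"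
  have B: "?B = ?A \<inter> {(i, j). ks ! \<sigma> i \<and> ks ! \<sigma> j \<and> (i < j) \<noteq> (\<sigma> i < \<sigma> j)}"
    using permutes_inj[OF \<sigma>] by (auto simp: increasing_pairs_def inj_eq linorder_not_less order.order_iff_strict)
  have "(\<Prod>p\<in>?A. inversion_sign \<sigma> ks (fst p) (snd p))
      = (\<Prod>p\<in>?A. if p \<in> {(i, j). ks ! \<sigma> i \<and> ks ! \<sigma> j \<and> (i < j) \<noteq> (\<sigma> i < \<sigma> j)} then -1 else 1)"
    by (rule prod.cong) (auto simp: inversion_sign_def)
  also have "\<dots> = (-1) ^ card ?B"
    unfolding B by (simp only: prod.inter_restrict[OF finite_increasing_pairs, symmetric] prod_constant)
  finally show ?thesis by (simp add: chi_def case_prod_unfold)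
qed

text \<open>A permutation of positions also permutes unordered pairs; \<open>srt\<close> brings the
  image of an ordered pair back into increasing order.\<close>

lemma prod_increasing_pairs_permute:
  fixes f :: "nat \<Rightarrow> nat \<Rightarrow> complex"
  assumes \<tau>: "\<tau> permutes {..<n}" and sym: "\<And>i j. i \<noteq> j \<Longrightarrow> f i j = f j i"
  shows "(\<Prod>(i, j)\<in>increasing_pairs n. f (\<tau> i) (\<tau> j)) = (\<Prod>(i, j)\<in>increasing_pairs n. f i j)"
proof -
  define srt :: "nat \<times> nat \<Rightarrow> nat \<times> nat" where "srt p = (min (fst p) (snd p), max (fst p) (snd p))" for p
  note inv = permutes_inverses[OF \<tau>]
  have lt: "\<tau> i < n \<longleftrightarrow> i < n" "inv \<tau> i < n \<longleftrightarrow> i < n" for i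
    using permutes_in_image[OF \<tau>, of i] permutes_in_image[OF permutes_inv[OF \<tau>], of i] by auto
  have neq: "\<tau> i = \<tau> j \<longleftrightarrow> i = j" "inv \<tau> i = inv \<tau> j \<longleftrightarrow> i = j" for i j
    by (metis inv)+
  have srt: "srt (a, b) = (if a < b then (a, b) else (b, a))" if "a \<noteq> b" for a b
    using that by (auto simp: srt_def)
  have dest: "\<exists>a b. p = (a, b) \<and> a < b \<and> b < n" if "p \<in> increasing_pairs n" for p
    using that by (auto simp: increasing_pairs_def)
  show ?thesis
  proof (rule prod.reindex_bij_witness[where i="\<lambda>p. srt (inv \<tau> (fst p), inv \<tau> (snd p))"
        and j="\<lambda>p. srt (\<tau> (fst p), \<tau> (snd p))"])
    fix p assume "p \<in> increasing_pairs n"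
    then obtain a b where p: "p = (a, b)" "a < b" "b < n" using dest by blast
    then have ne: "\<tau> a \<noteq> \<tau> b" "inv \<tau> a \<noteq> inv \<tau> b" by (simp_all add: neq)
    have "a < n" using p by simp
    show "srt (inv \<tau> (fst (srt (\<tau> (fst p), \<tau> (snd p)))), inv \<tau> (snd (srt (\<tau> (fst p), \<tau> (snd p))))) = p"
      using p by (simp add: srt[OF ne(1)] srt inv)
    show "srt (\<tau> (fst (srt (inv \<tau> (fst p), inv \<tau> (snd p)))), \<tau> (snd (srt (inv \<tau> (fst p), inv \<tau> (snd p))))) = p"
      using p by (simp add: srt[OF ne(2)] srt inv)
    show "srt (\<tau> (fst p), \<tau> (snd p)) \<in> increasing_pairs n"
      using p \<open>a < n\<close> ne(1) by (simp add: srt[OF ne(1)] increasing_pairs_def lt)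
    show "srt (inv \<tau> (fst p), inv \<tau> (snd p)) \<in> increasing_pairs n"
      using p \<open>a < n\<close> ne(2) by (simp add: srt[OF ne(2)] increasing_pairs_def lt)
    show "(case srt (\<tau> (fst p), \<tau> (snd p)) of (i, j) \<Rightarrow> f i j) = (case p of (i, j) \<Rightarrow> f (\<tau> i) (\<tau> j))"
      using p sym[OF ne(1)] by (simp add: srt[OF ne(1)])
  qed
qed

text \<open>A cocycle identity: the composition inverts a pair exactly if one of the two
  permutations does so and the other does not. The second permutation sees the parities in their
  permuted order.\<close>

lemma chi_compose:
  assumes \<sigma>: "\<sigma> permutes {..<length ks}" and \<tau>: "\<tau> permutes {..<length ks}"
  shows "chi (\<sigma> \<circ> \<tau>) ks = chi \<sigma> ks * chi \<tau> (permute_list \<sigma> ks)"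
proof -
  let ?A = "increasing_pairs (length ks)"
  have "inversion_sign (\<sigma> \<circ> \<tau>) ks i j = inversion_sign \<sigma> ks (\<tau> i) (\<tau> j) * inversion_sign \<tau> (permute_list \<sigma> ks) i j"
    if "(i, j) \<in> ?A" for i j
  proof -
    have "\<tau> i < length ks" "\<tau> j < length ks"
      using that permutes_in_image[OF \<tau>, of i] permutes_in_image[OF \<tau>, of j]
      by (auto simp: increasing_pairs_def)
    then show ?thesis by (auto simp: inversion_sign_def permute_list_nth[OF \<sigma>])
  qed
  then have "chi (\<sigma> \<circ> \<tau>) ks
      = (\<Prod>p\<in>?A. (case p of (i, j) \<Rightarrow> inversion_sign \<sigma> ks (\<tau> i) (\<tau> j)) *
          (case p of (i, j) \<Rightarrow> inversion_sign \<tau> (permute_list \<sigma> ks) i j))"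
    unfolding chi_eq_prod[OF permutes_compose[OF \<tau> \<sigma>]] by (intro prod.cong) auto
  also have "\<dots> = (\<Prod>(i, j)\<in>?A. inversion_sign \<sigma> ks (\<tau> i) (\<tau> j)) * chi \<tau> (permute_list \<sigma> ks)"
    using chi_eq_prod[of \<tau> "permute_list \<sigma> ks"] \<tau> by (simp add: prod.distrib)
  also have "(\<Prod>(i, j)\<in>?A. inversion_sign \<sigma> ks (\<tau> i) (\<tau> j)) = chi \<sigma> ks"
    unfolding chi_eq_prod[OF \<sigma>]
    by (rule prod_increasing_pairs_permute[OF \<tau>])
      (use permutes_inj[OF \<sigma>] in \<open>auto simp: inversion_sign_def inj_eq linorder_not_less order.order_iff_strict\<close>)
  finally show ?thesis .
qed

lemma chi_id [simp]: "chi id ks = 1"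
proof -
  have "{(i, j). i < j \<and> j < length ks \<and> id i > id j \<and> ks ! id i \<and> ks ! id j} = {}" by auto
  then show ?thesis unfolding chi_def by (simp only: card.empty power_0)
qed

lemma chi_square: "chi \<sigma> ks * chi \<sigma> ks = 1"
  by (simp add: chi_def flip: power_mult_distrib)

lemma chi_adjacent:
  assumes "Suc i < length ks"
  shows "chi (adjacent i) ks = (if ks ! i \<and> ks ! Suc i then -1 else 1)"
proof -
  let ?t = "adjacent i"
  have t: "?t permutes {..<length ks}" using assms by (intro permutes_swap_id) auto
  have "chi ?t ks = (\<Prod>(a, b)\<in>increasing_pairs (length ks). inversion_sign ?t ks a b)"
    by (rule chi_eq_prod[OF t])
  also have "\<dots> = (\<Prod>(a, b)\<in>{(i, Suc i)}. inversion_sign ?t ks a b)"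
  proof (rule prod.mono_neutral_right[OF finite_increasing_pairs])
    show "\<forall>p\<in>increasing_pairs (length ks) - {(i, Suc i)}. (case p of (a, b) \<Rightarrow> inversion_sign ?t ks a b) = 1"
      by (auto simp: increasing_pairs_def inversion_sign_def Transposition.transpose_def split: if_splits)
  qed (use assms in \<open>auto simp: increasing_pairs_def\<close>)
  finally show ?thesis by (auto simp: inversion_sign_def)
qed


subsection \<open>Graded symmetric tensors\<close>

definition homogeneous :: "bool list \<Rightarrow> 'h::super_chilbert_space list \<Rightarrow> bool" where
  "homogeneous ks hs \<longleftrightarrow> list_all2 (\<lambda>k h. h \<in> hpart k) ks hs"

text \<open>The counterpart of \<open>alternating\<close> for the Fock space. The sign depends on
  parities, so the condition speaks of arguments of definite parity only; \<open>sum_hproj\<close>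
  reaches all others.\<close>

definition graded_symmetric :: "'h::super_chilbert_space tensor \<Rightarrow> bool" where
  "graded_symmetric T \<longleftrightarrow> (\<forall>us a b vs k l. set us \<union> set vs \<subseteq> hpart False \<union> hpart True \<longrightarrow>
     a \<in> hpart k \<longrightarrow> b \<in> hpart l \<longrightarrow>
     T (us @ b # a # vs) = (if k \<and> l then -1 else 1) * T (us @ a # b # vs))"

lemma graded_symmetricD:
  "graded_symmetric T \<Longrightarrow> set us \<union> set vs \<subseteq> hpart False \<union> hpart True \<Longrightarrow> a \<in> hpart k \<Longrightarrow> b \<in> hpart l \<Longrightarrow>
    T (us @ b # a # vs) = (if k \<and> l then -1 else 1) * T (us @ a # b # vs)"
  unfolding graded_symmetric_def by blast

lemma homogeneous_length: "homogeneous ks hs \<Longrightarrow> length ks = length hs"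
  by (auto simp: homogeneous_def list_all2_lengthD)

lemma homogeneous_permute:
  "homogeneous ks hs \<Longrightarrow> \<sigma> permutes {..<length hs} \<Longrightarrow> homogeneous (permute_list \<sigma> ks) (permute_list \<sigma> hs)"
  using permutes_in_image[of \<sigma> "{..<length hs}"]
  by (auto simp: homogeneous_def list_all2_conv_all_nth permute_list_nth)

lemma homogeneous_set: "homogeneous ks hs \<Longrightarrow> set hs \<subseteq> hpart False \<union> hpart True"
proof -
  assume "homogeneous ks hs"
  then have "\<exists>k. h \<in> hpart k" if "h \<in> set hs" for h
    using that by (fastforce simp: homogeneous_def list_all2_conv_all_nth in_set_conv_nth)
  then show ?thesis by (metis (full_types) UnI1 UnI2 subsetI)
qed

text \<open>Neighbouring exchanges give the sign \<open>chi_adjacent\<close>, and the cocycle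
  identity composes the signs. The parities vary along with the arguments in the induction.\<close>

lemma graded_symmetric_permute:
  assumes T: "graded_symmetric T" and hs: "homogeneous ks hs" and \<sigma>: "\<sigma> permutes {..<length hs}"
  shows "T (permute_list \<sigma> hs) = chi \<sigma> ks * T hs"
proof -
  let ?n = "length hs"
  let ?P = "\<lambda>\<sigma>. \<forall>hs ks. length hs = ?n \<longrightarrow> homogeneous ks hs \<longrightarrow> T (permute_list \<sigma> hs) = chi \<sigma> ks * T hs"
  have "?P \<sigma>"
    using \<sigma>
  proof (rule adjacent_transpositions_induct)
    fix i assume i: "Suc i < ?n"
    show "?P (adjacent i)"
    proof (intro allI impI)
      fix gs :: "'a list" and ks assume gs: "length gs = ?n" "homogeneous ks gs"
      then obtain us a b vs where eq: "gs = us @ a # b # vs" "length us = i"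
        using i split_adjacent[of i gs] by metis
      have len: "length ks = ?n" using homogeneous_length[OF gs(2)] gs(1) by simp
      have "gs ! i \<in> hpart (ks ! i)" "gs ! Suc i \<in> hpart (ks ! Suc i)"
        using gs i len by (auto simp: homogeneous_def list_all2_conv_all_nth)
      then have "a \<in> hpart (ks ! i)" "b \<in> hpart (ks ! Suc i)"
        using eq by (auto simp: nth_append)
      moreover have "set us \<union> set vs \<subseteq> hpart False \<union> hpart True"
        using homogeneous_set[OF gs(2)] by (auto simp: eq)
      ultimately show "T (permute_list (adjacent i) gs)
          = chi (adjacent i) ks * T gs"
        using graded_symmetricD[OF T, of us vs a "ks ! i" b "ks ! Suc i"] permute_list_adjacent[of us a b vs]
          chi_adjacent[of i ks] i len eq by simp
    qed
  next
    fix \<sigma> \<tau> :: "nat \<Rightarrow> nat"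
    assume *: "\<sigma> permutes {..<?n}" "\<tau> permutes {..<?n}" "?P \<sigma>" "?P \<tau>"
    show "?P (\<sigma> \<circ> \<tau>)"
    proof (intro allI impI)
      fix gs :: "'a list" and ks assume gs: "length gs = ?n" "homogeneous ks gs"
      have len: "length ks = ?n" using homogeneous_length[OF gs(2)] gs(1) by simp
      have "T (permute_list (\<sigma> \<circ> \<tau>) gs) = T (permute_list \<tau> (permute_list \<sigma> gs))"
        using * gs by (simp add: permute_list_compose)
      also have "\<dots> = chi \<tau> (permute_list \<sigma> ks) * T (permute_list \<sigma> gs)"
        using *(1,4) gs homogeneous_permute[OF gs(2), of \<sigma>] by simp
      also have "T (permute_list \<sigma> gs) = chi \<sigma> ks * T gs" using *(3) gs by blast
      finally show "T (permute_list (\<sigma> \<circ> \<tau>) gs) = chi (\<sigma> \<circ> \<tau>) ks * T gs"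
        using *(1,2) len by (simp only: chi_compose mult.commute mult.left_commute)
    qed
  qed (simp only: permute_list_id chi_id mult_1_left, blast)
  then show ?thesis using hs by blast
qed

lemma sum_words_Suc: "(\<Sum>ks\<in>words UNIV (Suc n). f ks) = (\<Sum>k\<in>(UNIV :: bool set). \<Sum>ks\<in>words UNIV n. f (k # ks))"
proof -
  have "(\<Sum>ks\<in>words UNIV (Suc n). f ks) = (\<Sum>(k, ks)\<in>(UNIV :: bool set) \<times> words UNIV n. f (k # ks))"
    using sum.reindex_bij_betw[OF bij_betw_words_Suc, of f "UNIV :: bool set" n]
    by (simp add: case_prod_unfold)
  then show ?thesis by (simp add: sum.cartesian_product)
qed

lemma sum_hproj:
  "multi_antilinear T \<Longrightarrow> (\<Sum>ks\<in>words UNIV (length xs). T (map2 hproj ks xs)) = T xs"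
proof (induction xs arbitrary: T)
  case (Cons x xs)
  have "(\<Sum>ks\<in>words UNIV (length (x # xs)). T (map2 hproj ks (x # xs)))
      = (\<Sum>k\<in>UNIV. \<Sum>ks\<in>words UNIV (length xs). T (hproj k x # map2 hproj ks xs))"
    by (simp only: length_Cons sum_words_Suc list.map zip_Cons_Cons prod.case)
  also have "\<dots> = T (hproj False x # xs) + T (hproj True x # xs)"
    using Cons.IH[OF multi_antilinear_Cons[OF Cons.prems]] by (simp add: UNIV_bool)
  also have "\<dots> = T ((hproj False x + hproj True x) # xs)"
    using Cons.prems unfolding multi_antilinear_def by (metis append_Nil)
  finally show ?case by (simp add: hproj_decomposition)
qed simp

lemma gsym_eq: "gsym T xs = (\<Sum>ks\<in>words UNIV (length xs). \<Sum>\<sigma> | \<sigma> permutes {..<length xs}.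
     chi \<sigma> ks * T (permute_list \<sigma> (map2 hproj ks xs))) / fact (length xs)"
  by (simp add: gsym_def words_def)

lemma gsym_graded_symmetric:
  assumes T: "multi_antilinear T" "graded_symmetric T"
  shows "gsym T = T"
proof
  fix xs
  have "(\<Sum>\<sigma> | \<sigma> permutes {..<length xs}. chi \<sigma> ks * T (permute_list \<sigma> (map2 hproj ks xs)))
      = fact (length xs) * T (map2 hproj ks xs)" if ks: "ks \<in> words UNIV (length xs)" for ks
  proof -
    have hom: "homogeneous ks (map2 hproj ks xs)"
      using ks by (auto simp: homogeneous_def list_all2_conv_all_nth words_def hproj)
    have "(\<Sum>\<sigma> | \<sigma> permutes {..<length xs}. chi \<sigma> ks * T (permute_list \<sigma> (map2 hproj ks xs)))
        = (\<Sum>\<sigma> | \<sigma> permutes {..<length xs}. T (map2 hproj ks xs))"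
      by (intro sum.cong refl) (use ks in \<open>simp add: graded_symmetric_permute[OF T(2) hom] words_def
          chi_square flip: mult.assoc\<close>)
    then show ?thesis by (simp add: card_permutations[OF refl])
  qed
  then have "gsym T xs = (\<Sum>ks\<in>words UNIV (length xs). T (map2 hproj ks xs))"
    by (simp add: gsym_eq flip: sum_distrib_left)
  then show "gsym T xs = T xs" by (simp add: sum_hproj[OF T(1)])
qed

text \<open>Among the parity patterns in the definition of \<open>gsym\<close> only the pattern of
  the arguments survives: any other one projects some argument to 0.\<close>

lemma gsym_homogeneous:
  assumes T: "multi_antilinear T" and hs: "homogeneous ks hs"
  shows "gsym T hs = (\<Sum>\<sigma> | \<sigma> permutes {..<length hs}. chi \<sigma> ks * T (permute_list \<sigma> hs)) / fact (length hs)"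
proof -
  let ?f = "\<lambda>ks. \<Sum>\<sigma> | \<sigma> permutes {..<length hs}. chi \<sigma> ks * T (permute_list \<sigma> (map2 hproj ks hs))"
  have len: "length ks = length hs" by (rule homogeneous_length[OF hs])
  have "(\<Sum>ks\<in>words UNIV (length hs). ?f ks) = (\<Sum>ks\<in>{ks}. ?f ks)"
  proof (rule sum.mono_neutral_right)
    have "words (UNIV :: bool set) n = {xs. set xs \<subseteq> UNIV \<and> length xs = n}" for n by (auto simp: words_def)
    then show "finite (words (UNIV :: bool set) (length hs))"
      using finite_lists_length_eq[of "UNIV :: bool set"] by simp
    show "{ks} \<subseteq> words UNIV (length hs)" using len by (simp add: words_def)
    show "\<forall>ls\<in>words UNIV (length hs) - {ks}. ?f ls = 0"
    proof
      fix ls assume ls: "ls \<in> words UNIV (length hs) - {ks}"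
      then obtain i where i: "i < length hs" "ls ! i \<noteq> ks ! i"
        using len by (auto simp: words_def list_eq_iff_nth_eq)
      have "hs ! i \<in> hpart (\<not> ls ! i)"
        using hs i len by (auto simp: homogeneous_def list_all2_conv_all_nth)
      then have "map2 hproj ls hs ! i = 0" using i ls by (simp add: words_def hproj_other)
      moreover have "i < length (map2 hproj ls hs)" using i ls by (simp add: words_def)
      ultimately have "0 \<in> set (map2 hproj ls hs)" by (metis nth_mem)
      then have "T (permute_list \<sigma> (map2 hproj ls hs)) = 0" if "\<sigma> permutes {..<length hs}" for \<sigma>
        by (intro multi_antilinear_zero[OF T]) (subst set_permute_list; use that ls in \<open>simp add: words_def\<close>)
      then show "?f ls = 0" by simp
    qed
  qed
  moreover have "map2 hproj ks hs = hs"
    using hs len by (intro nth_equalityI) (auto simp: homogeneous_def list_all2_conv_all_nth hproj_same)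
  ultimately show ?thesis by (simp add: gsym_eq)
qed

lemma graded_symmetric_gsym:
  assumes T: "multi_antilinear T"
  shows "graded_symmetric (gsym T)"
  unfolding graded_symmetric_def
proof (intro allI impI)
  fix us vs :: "'a list" and a b :: 'a and k l
  assume uv: "set us \<union> set vs \<subseteq> hpart False \<union> hpart True" and ab: "a \<in> hpart k" "b \<in> hpart l"
  let ?hs = "us @ a # b # vs" and ?n = "length us + (2 + length vs)"
  \<comment> \<open>The vector 0 has both parities. The outer arguments may take either one and are
    counted as even when possible, but \<open>a\<close> and \<open>b\<close> must keep the given
    \<open>k\<close> and \<open>l\<close>.\<close>
  define ks where "ks = map (\<lambda>h. h \<notin> hpart False) us @ k # l # map (\<lambda>h. h \<notin> hpart False) vs"
  let ?\<tau> = "adjacent (length us)"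
  have "h \<in> hpart (h \<notin> hpart False)" if "h \<in> hpart False \<union> hpart True" for h :: 'a
    using that by (cases "h \<in> hpart False") auto
  then have hom_map: "homogeneous (map (\<lambda>h. h \<notin> hpart False) ws) ws"
    if "set ws \<subseteq> hpart False \<union> hpart True" for ws :: "'a list"
    using that by (induction ws) (auto simp: homogeneous_def)
  have hom: "homogeneous ks ?hs"
    using uv ab hom_map[of us] hom_map[of vs]
    by (auto simp: homogeneous_def ks_def intro!: list_all2_appendI)
  have len: "length ks = length ?hs" by (simp add: ks_def)
  have \<tau>: "?\<tau> permutes {..<length ?hs}" by (rule permutes_swap_id) auto
  let ?S = "{\<sigma>. \<sigma> permutes {..<length ?hs}}"
  have "(\<Sum>\<sigma>\<in>?S. chi \<sigma> ks * T (permute_list \<sigma> ?hs))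
      = (\<Sum>\<sigma>\<in>?S. chi (?\<tau> \<circ> \<sigma>) ks * T (permute_list (?\<tau> \<circ> \<sigma>) ?hs))"
    by (rule setum_permutations_compose_left[OF \<tau>])
  also have "\<dots> = chi ?\<tau> ks * (\<Sum>\<sigma>\<in>?S. chi \<sigma> (permute_list ?\<tau> ks) * T (permute_list \<sigma> (permute_list ?\<tau> ?hs)))"
    unfolding sum_distrib_left
    by (intro sum.cong refl) (use \<tau> len in \<open>simp add: chi_compose permute_list_compose mult.assoc\<close>)
  finally have "gsym T ?hs = chi ?\<tau> ks * gsym T (permute_list ?\<tau> ?hs)"
    using gsym_homogeneous[OF T hom] gsym_homogeneous[OF T homogeneous_permute[OF hom \<tau>]] by simp
  then have "chi ?\<tau> ks * gsym T ?hs = (chi ?\<tau> ks * chi ?\<tau> ks) * gsym T (us @ b # a # vs)"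
    by (simp add: permute_list_adjacent mult.assoc)
  moreover have "chi ?\<tau> ks = (if k \<and> l then -1 else 1)"
    by (subst chi_adjacent) (auto simp: ks_def nth_append)
  ultimately show "gsym T (us @ b # a # vs) = (if k \<and> l then -1 else 1) * gsym T ?hs"
    by (auto simp: chi_square split: if_splits)
qed

section \<open>Square-summable families\<close>

lemma summable_on_norm_square_add:
  fixes f g :: "'i \<Rightarrow> complex"
  assumes "(\<lambda>i. (cmod (f i))\<^sup>2) summable_on A" "(\<lambda>i. (cmod (g i))\<^sup>2) summable_on A"
  shows "(\<lambda>i. (cmod (f i + g i))\<^sup>2) summable_on A"
proof (rule summable_on_comparison_test)
  show "(\<lambda>i. 2 * (cmod (f i))\<^sup>2 + 2 * (cmod (g i))\<^sup>2) summable_on A"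
    by (intro summable_on_add summable_on_cmult_right assms)
  show "(cmod (f i + g i))\<^sup>2 \<le> 2 * (cmod (f i))\<^sup>2 + 2 * (cmod (g i))\<^sup>2" for i
  proof -
    have "(cmod (f i + g i))\<^sup>2 \<le> (cmod (f i) + cmod (g i))\<^sup>2"
      by (intro power_mono norm_triangle_ineq norm_ge_zero)
    also have "\<dots> \<le> 2 * (cmod (f i))\<^sup>2 + 2 * (cmod (g i))\<^sup>2"
      using sum_squares_bound[of "cmod (f i)" "cmod (g i)"] by (simp add: power2_sum)
    finally show ?thesis .
  qed
qed simp

lemma summable_on_norm_square_scale:
  fixes f :: "'i \<Rightarrow> complex"
  assumes "(\<lambda>i. (cmod (f i))\<^sup>2) summable_on A"
  shows "(\<lambda>i. (cmod (c * f i))\<^sup>2) summable_on A"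
  using summable_on_cmult_right[OF assms, of "(cmod c)\<^sup>2"] by (simp add: norm_mult power_mult_distrib)

lemma summable_on_norm_square_sum:
  fixes f :: "'j \<Rightarrow> 'i \<Rightarrow> complex"
  assumes "\<And>j. j \<in> J \<Longrightarrow> (\<lambda>i. (cmod (f j i))\<^sup>2) summable_on A"
  shows "(\<lambda>i. (cmod (\<Sum>j\<in>J. f j i))\<^sup>2) summable_on A"
  using assms by (induction J rule: infinite_finite_induct) (auto intro: summable_on_norm_square_add)

section \<open>Products of summable families\<close>

lemma summable_on_mult_nonneg:
  fixes f :: "'i \<Rightarrow> real" and g :: "'j \<Rightarrow> real"
  assumes "f summable_on A" "g summable_on B" "\<And>i. f i \<ge> 0" "\<And>j. g j \<ge> 0"
  shows "(\<lambda>(i, j). f i * g j) summable_on A \<times> B"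
proof (rule summable_on_SigmaI)
  show "((\<lambda>j. (\<lambda>(i, j). f i * g j) (i, j)) has_sum f i * infsum g B) B" for i
    using has_sum_cmult_right[OF has_sum_infsum[OF assms(2)]] by simp
  show "(\<lambda>i. f i * infsum g B) summable_on A" by (rule summable_on_cmult_left[OF assms(1)])
qed (use assms in auto)

lemma has_sum_mult_complex:
  fixes f :: "'i \<Rightarrow> complex" and g :: "'j \<Rightarrow> complex"
  assumes f: "(f has_sum a) A" and g: "(g has_sum b) B"
  shows "((\<lambda>(i, j). f i * g j) has_sum a * b) (A \<times> B)"
proof (rule has_sum_SigmaI)
  show "((\<lambda>j. (\<lambda>(i, j). f i * g j) (i, j)) has_sum f i * b) B" for i
    using has_sum_cmult_right[OF g] by simp
  show "((\<lambda>i. f i * b) has_sum a * b) A" by (rule has_sum_cmult_left[OF f])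
  \<comment> \<open>For complex families summability is absolute, which makes the double family
    summable.\<close>
  have "(\<lambda>i. cmod (f i)) summable_on A" "(\<lambda>j. cmod (g j)) summable_on B"
    using f g by (auto simp: summable_on_iff_abs_summable_on_complex[symmetric] has_sum_imp_summable)
  then have "(\<lambda>(i, j). cmod (f i) * cmod (g j)) summable_on A \<times> B"
    by (rule summable_on_mult_nonneg) auto
  then have "(\<lambda>p. cmod ((\<lambda>(i, j). f i * g j) p)) summable_on A \<times> B"
    by (simp add: case_prod_unfold norm_mult)
  then show "(\<lambda>(i, j). f i * g j) summable_on A \<times> B"
    by (rule abs_summable_summable)
qed

lemma has_sum_finite_sum:
  fixes f :: "'j \<Rightarrow> 'i \<Rightarrow> 'b::topological_comm_monoid_add"
  assumes "\<And>j. j \<in> J \<Longrightarrow> (f j has_sum s j) A"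
  shows "((\<lambda>i. \<Sum>j\<in>J. f j i) has_sum (\<Sum>j\<in>J. s j)) A"
  using assms by (induction J rule: infinite_finite_induct) (auto intro: has_sum_add)

lemma summable_on_mult_square:
  fixes f g :: "'i \<Rightarrow> complex"
  assumes "(\<lambda>i. (cmod (f i))\<^sup>2) summable_on A" "(\<lambda>i. (cmod (g i))\<^sup>2) summable_on A"
  shows "(\<lambda>i. f i * g i) summable_on A"
  by (rule abs_summable_summable, rule abs_summable_product)
    (use assms in \<open>simp_all add: norm_mult power2_eq_square\<close>)

text \<open>At fixed arguments the product is a finite combination of products of values, with
  indices, coefficients and arguments independent of the factors. Sums and limits of factors can
  therefore be handled termwise.\<close>

lemma gmult_expansion:
  obtains J :: "((nat \<Rightarrow> nat) \<times> nat) set" and c u v where "finite J"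
    "\<And>S T :: 'a tensor. gmult S T xs = (\<Sum>j\<in>J. c j * (S (u j) * T (v j)))"
    "\<And>j. j \<in> J \<Longrightarrow> length (u j) + length (v j) = length xs"
proof
  let ?J = "{\<sigma>. \<sigma> permutes {..<length xs}} \<times> {..length xs}"
  let ?c = "\<lambda>(\<sigma>, p). of_int (sign \<sigma>) * complex_of_real (sqrt (length xs choose p)) / fact (length xs)"
  let ?u = "\<lambda>(\<sigma>, p). take p (permute_list \<sigma> xs)" and ?v = "\<lambda>(\<sigma>, p). drop p (permute_list \<sigma> xs)"
  show "finite ?J" by (simp add: finite_permutations)
  show "gmult S T xs = (\<Sum>j\<in>?J. ?c j * (S (?u j) * T (?v j)))" for S T :: "'a tensor"
    by (simp add: gmult_def alt_def sum_distrib_left sum_divide_distrib sum.cartesian_product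
        case_prod_unfold mult_ac)
  show "length (?u j) + length (?v j) = length xs" if "j \<in> ?J" for j
    using that by (auto simp: min_def)
qed

text \<open>Summability is pointwise in the Grassmann arguments; uniformity is not asked for, since
  products are evaluated at fixed arguments.\<close>

definition square_summable :: "'i set \<Rightarrow> ('i \<Rightarrow> 'a tensor) \<Rightarrow> bool" where
  "square_summable A f \<longleftrightarrow> (\<forall>xs. (\<lambda>i. (cmod (f i xs))\<^sup>2) summable_on A)"

lemma square_summable_gmult:
  fixes f :: "'i \<Rightarrow> 'a tensor" and g :: "'j \<Rightarrow> 'a tensor"
  assumes "square_summable A f" "square_summable B g"
  shows "square_summable (A \<times> B) (\<lambda>(i, j). gmult (f i) (g j))"
  unfolding square_summable_def
proof
  fix xs :: "'a list"
  obtain J c u v where J: "finite (J :: ((nat \<Rightarrow> nat) \<times> nat) set)"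
    "\<And>S T. gmult S T xs = (\<Sum>j\<in>J. c j * (S (u j) * T (v j)))"
    by (rule gmult_expansion[of xs]) blast
  have "(\<lambda>p. (cmod (f (fst p) ys * g (snd p) zs))\<^sup>2) summable_on A \<times> B" for ys zs
    using summable_on_mult_nonneg[of "\<lambda>i. (cmod (f i ys))\<^sup>2" A "\<lambda>i. (cmod (g i zs))\<^sup>2" B] assms
    by (simp add: square_summable_def norm_mult power_mult_distrib case_prod_unfold)
  then show "(\<lambda>p. (cmod ((case p of (i, j) \<Rightarrow> gmult (f i) (g j)) xs))\<^sup>2) summable_on A \<times> B"
    by (auto simp: J case_prod_unfold intro!: summable_on_norm_square_sum summable_on_norm_square_scale)
qed

lemma summable_on_gmult:
  fixes f g :: "'i \<Rightarrow> 'a tensor"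
  assumes "square_summable A f" "square_summable A g"
  shows "(\<lambda>i. gmult (f i) (g i) xs) summable_on A"
proof -
  obtain J c u v where J: "finite (J :: ((nat \<Rightarrow> nat) \<times> nat) set)"
    "\<And>S T. gmult S T xs = (\<Sum>j\<in>J. c j * (S (u j) * T (v j)))"
    by (rule gmult_expansion[of xs]) blast
  have "(\<lambda>i. \<Sum>j\<in>J. c j * (f i (u j) * g i (v j))) summable_on A"
  proof (rule has_sum_imp_summable[OF has_sum_finite_sum], rule has_sum_infsum)
    show "(\<lambda>i. c j * (f i (u j) * g i (v j))) summable_on A" for j
      using assms by (intro summable_on_cmult_right summable_on_mult_square) (simp_all add: square_summable_def)
  qed
  then show ?thesis by (simp add: J)
qed

lemma has_sum_gmult:
  fixes f :: "'i \<Rightarrow> 'a tensor" and g :: "'j \<Rightarrow> 'a tensor"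
  assumes S: "\<And>xs. ((\<lambda>i. f i xs) has_sum S xs) A" and T: "\<And>xs. ((\<lambda>j. g j xs) has_sum T xs) B"
  shows "((\<lambda>(i, j). gmult (f i) (g j) xs) has_sum gmult S T xs) (A \<times> B)"
proof -
  obtain J c u v where J: "finite (J :: ((nat \<Rightarrow> nat) \<times> nat) set)"
    "\<And>S T. gmult S T xs = (\<Sum>j\<in>J. c j * (S (u j) * T (v j)))"
    by (rule gmult_expansion[of xs]) blast
  have "((\<lambda>p. \<Sum>j\<in>J. c j * (f (fst p) (u j) * g (snd p) (v j))) has_sum gmult S T xs) (A \<times> B)"
    unfolding J
  proof (rule has_sum_finite_sum)
    show "((\<lambda>p. c j * (f (fst p) (u j) * g (snd p) (v j))) has_sum c j * (S (u j) * T (v j))) (A \<times> B)" for j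
      using has_sum_mult_complex[OF S[of "u j"] T[of "v j"]]
      by (intro has_sum_cmult_right) (simp add: case_prod_unfold)
  qed
  then show ?thesis by (simp add: J case_prod_unfold)
qed

lemma square_summable_subset: "square_summable A f \<Longrightarrow> B \<subseteq> A \<Longrightarrow> square_summable B f"
  unfolding square_summable_def by (blast intro: summable_on_subset)

lemma square_summable_reindex:
  assumes "bij_betw h A B"
  shows "square_summable A (\<lambda>i. f (h i)) \<longleftrightarrow> square_summable B f"
  using summable_on_reindex_bij_betw[OF assms, of "\<lambda>i. (cmod (f i _))\<^sup>2"]
  by (simp add: square_summable_def)


section \<open>The Grassmann extension\<close>

lemma summable_onb_sfock:
  "\<Xi> \<in> sfock \<Longrightarrow> (\<lambda>(hs, ls). (cmod (\<Xi> hs ls))\<^sup>2 / (fact (length ls))\<^sup>2) summable_on lists honb \<times> lists onb"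
  by (simp add: sfock_def)

lemma sfock_bounded:
  assumes "\<Xi> \<in> sfock"
  obtains C where "\<And>hs ls. length hs = m \<Longrightarrow> length ls = n \<Longrightarrow>
    cmod (\<Xi> hs ls) \<le> C * (prod_norm hs * prod_norm ls)"
  using assms unfolding sfock_def by blast

lemma sfock_alternating: "\<Xi> \<in> sfock \<Longrightarrow> alternating (\<Xi> hs)"
proof -
  assume "\<Xi> \<in> sfock"
  then have "alt (\<Xi> hs) = \<Xi> hs" by (simp add: sfock_def)
  then show ?thesis by (metis alternating_alt)
qed

lemma sfock_graded_symmetric: "\<Xi> \<in> sfock \<Longrightarrow> graded_symmetric (\<lambda>hs. \<Xi> hs ls)"
proof -
  assume "\<Xi> \<in> sfock"
  then have "gsym (\<lambda>hs. \<Xi> hs ls) = (\<lambda>hs. \<Xi> hs ls)" "multi_antilinear (\<lambda>hs. \<Xi> hs ls)"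
    by (simp_all add: sfock_def)
  then show ?thesis by (metis graded_symmetric_gsym)
qed

text \<open>The norm gives summability at Grassmann basis words; the Hilbert-Schmidt bound in these
  arguments transfers it to an arbitrary list \<open>ls\<close>. The weight is constant once the
  length is fixed.\<close>

lemma sfock_square_summable:
  fixes \<Xi> :: "('h::super_chilbert_space, 'l::grassmann_generators) stensor"
  assumes \<Xi>: "\<Xi> \<in> sfock"
  shows "square_summable (lists honb) \<Xi>"
  unfolding square_summable_def
proof
  fix ls :: "'l list"
  let ?n = "length ls"
  let ?N = "\<lambda>hs. \<Sum>\<^sub>\<infinity>bs\<in>words onb ?n. (cmod (\<Xi> hs bs))\<^sup>2"
  have sub: "lists honb \<times> words onb ?n \<subseteq> lists honb \<times> lists onb" by (auto simp: words_def)
  have "(\<lambda>p. (fact ?n)\<^sup>2 * (case p of (hs, ls) \<Rightarrow> (cmod (\<Xi> hs ls))\<^sup>2 / (fact (length ls))\<^sup>2))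
      summable_on lists honb \<times> words onb ?n"
    by (intro summable_on_cmult_right summable_on_subset[OF summable_onb_sfock[OF \<Xi>] sub])
  also have "?this \<longleftrightarrow> (\<lambda>(hs, bs). (cmod (\<Xi> hs bs))\<^sup>2) summable_on lists honb \<times> words onb ?n"
    by (rule summable_on_cong) (auto simp: words_def)
  finally have sum: "(\<lambda>(hs, bs). (cmod (\<Xi> hs bs))\<^sup>2) summable_on lists honb \<times> words onb ?n" .
  show "(\<lambda>hs. (cmod (\<Xi> hs ls))\<^sup>2) summable_on lists honb"
  proof (rule summable_on_comparison_test)
    show "(\<lambda>hs. (prod_norm ls)\<^sup>2 * ?N hs) summable_on lists honb"
      by (intro summable_on_cmult_right summable_on_Sigma_banach[OF sum])
    fix hs :: "'h list" assume hs: "hs \<in> lists honb"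
    obtain C where C: "\<And>xs ys. length xs = length hs \<Longrightarrow> length ys = ?n \<Longrightarrow>
      cmod (\<Xi> xs ys) \<le> C * (prod_norm xs * prod_norm ys)"
      by (rule sfock_bounded[OF \<Xi>, of "length hs" ?n]) blast
    show "(cmod (\<Xi> hs ls))\<^sup>2 \<le> (prod_norm ls)\<^sup>2 * ?N hs"
    proof (rule multi_antilinear_le_onb[OF is_onb_onb])
      show "multi_antilinear (\<Xi> hs)" using \<Xi> by (simp add: sfock_def)
      show "cmod (\<Xi> hs ys) \<le> (C * prod_norm hs) * prod_norm ys"
        if "length ys = ?n" for ys
        using C[OF refl that] by (simp add: mult.assoc)
      show "(\<lambda>bs. (cmod (\<Xi> hs bs))\<^sup>2) summable_on words onb ?n"
        by (rule summable_on_SigmaD1[OF sum hs])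
    qed simp
  qed simp
qed

lemma sfock_eq_0:
  fixes \<Xi> :: "('h::super_chilbert_space, 'l::grassmann_generators) stensor"
  assumes \<Xi>: "\<Xi> \<in> sfock" and 0: "\<And>hs ls. hs \<in> lists honb \<Longrightarrow> \<Xi> hs ls = 0"
  shows "\<Xi> = (\<lambda>hs ls. 0)"
proof (intro ext)
  fix hs :: "'h list" and ls :: "'l list"
  obtain C where C: "\<And>xs ys. length xs = length hs \<Longrightarrow> length ys = length ls \<Longrightarrow>
    cmod (\<Xi> xs ys) \<le> C * (prod_norm xs * prod_norm ys)"
    by (rule sfock_bounded[OF \<Xi>, of "length hs" "length ls"]) blast
  show "\<Xi> hs ls = 0"
  proof (rule multi_antilinear_eq_0_onb[OF honb(1), where T="\<lambda>hs. \<Xi> hs ls"])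
    show "multi_antilinear (\<lambda>hs. \<Xi> hs ls)" using \<Xi> by (simp add: sfock_def)
    show "cmod (\<Xi> xs ls) \<le> (C * prod_norm ls) * prod_norm xs"
      if "length xs = length hs" for xs
      using C[OF that refl] by (simp add: mult_ac)
  qed (simp add: 0 words_def)
qed

lemma multi_antilinear_add:
  "multi_antilinear S \<Longrightarrow> multi_antilinear T \<Longrightarrow> multi_antilinear (\<lambda>xs. S xs + c * T xs)"
  by (simp add: multi_antilinear_def algebra_simps)

lemma gsym_add: "gsym (\<lambda>xs. S xs + T xs) xs = gsym S xs + gsym T xs"
  by (simp add: gsym_def sum.distrib add_divide_distrib algebra_simps)

text \<open>Sum and scalar multiple in one operation; the zero element, differences and real or
  imaginary parts are all obtained from it.\<close>

lemma sfock_add_scale: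
  assumes \<Xi>: "\<Xi> \<in> sfock" and \<Psi>: "\<Psi> \<in> sfock"
  shows "(\<lambda>hs ls. \<Xi> hs ls + c * \<Psi> hs ls) \<in> sfock"
proof -
  have "\<exists>C. \<forall>hs ls. length hs = m \<longrightarrow> length ls = n \<longrightarrow>
      cmod (\<Xi> hs ls + c * \<Psi> hs ls) \<le> C * (prod_norm hs * prod_norm ls)" for m n
  proof -
    obtain C where C: "\<And>hs ls. length hs = m \<Longrightarrow> length ls = n \<Longrightarrow>
      cmod (\<Xi> hs ls) \<le> C * (prod_norm hs * prod_norm ls)"
      by (rule sfock_bounded[OF \<Xi>, of m n]) blast
    obtain D where D: "\<And>hs ls. length hs = m \<Longrightarrow> length ls = n \<Longrightarrow>
      cmod (\<Psi> hs ls) \<le> D * (prod_norm hs * prod_norm ls)"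
      by (rule sfock_bounded[OF \<Psi>, of m n]) blast
    have "cmod (\<Xi> hs ls + c * \<Psi> hs ls)
        \<le> (C + cmod c * D) * (prod_norm hs * prod_norm ls)"
      if "length hs = m" "length ls = n" for hs ls
    proof -
      have "cmod (\<Xi> hs ls + c * \<Psi> hs ls) \<le> cmod (\<Xi> hs ls) + cmod c * cmod (\<Psi> hs ls)"
        by (metis norm_mult norm_triangle_ineq)
      also have "\<dots> \<le> C * (prod_norm hs * prod_norm ls)
          + cmod c * (D * (prod_norm hs * prod_norm ls))"
        by (intro add_mono mult_left_mono C D that) simp
      finally show ?thesis by (simp add: algebra_simps)
    qed
    then show ?thesis by blast
  qed
  moreover have "(\<lambda>(hs, ls). (cmod (\<Xi> hs ls + c * \<Psi> hs ls))\<^sup>2 / (fact (length ls))\<^sup>2)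
      summable_on lists honb \<times> lists onb"
  proof -
    \<comment> \<open>The weight is absorbed into the value, so that the closure of unweighted
      square-summable families applies.\<close>
    have eq: "(cmod z)\<^sup>2 / (fact n)\<^sup>2 = (cmod (z / fact n))\<^sup>2" for z :: complex and n
      by (simp add: norm_divide power_divide)
    show ?thesis
      using summable_on_norm_square_add[OF _ summable_on_norm_square_scale,
          of "\<lambda>p. \<Xi> (fst p) (snd p) / fact (length (snd p))" _
            "\<lambda>p. \<Psi> (fst p) (snd p) / fact (length (snd p))" c]
        summable_onb_sfock[OF \<Xi>] summable_onb_sfock[OF \<Psi>]
      by (simp add: eq case_prod_unfold add_divide_distrib)
  qed
  moreover have "gsym (\<lambda>hs. \<Xi> hs ls + c * \<Psi> hs ls) = (\<lambda>hs. \<Xi> hs ls + c * \<Psi> hs ls)" for ls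
    using \<Xi> \<Psi> by (auto simp: sfock_def gsym_add gsym_scale)
  moreover have "alt (\<lambda>ls. \<Xi> hs ls + c * \<Psi> hs ls) = (\<lambda>ls. \<Xi> hs ls + c * \<Psi> hs ls)" for hs
    using \<Xi> \<Psi> by (auto simp: sfock_def alt_add alt_scale)
  moreover have "multi_antilinear (\<lambda>ls. \<Xi> hs ls + c * \<Psi> hs ls)"
    "multi_antilinear (\<lambda>hs. \<Xi> hs ls + c * \<Psi> hs ls)" for hs ls
    using \<Xi> \<Psi> by (auto simp: sfock_def intro: multi_antilinear_add)
  ultimately show ?thesis unfolding sfock_def by blast
qed

text \<open>This is where the invariance of \<open>honb\<close> under \<open>star\<close>
  enters.\<close>

lemma bij_betw_rev_star: "bij_betw (\<lambda>hs. rev (map star hs)) (lists honb) (lists (honb :: 'h::super_chilbert_space set))"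
proof (rule bij_betw_byWitness[where f'="\<lambda>hs. rev (map star hs)"])
  have "star h \<in> honb" if "h \<in> honb" for h :: 'h
    using honb(3) that by blast
  then show "(\<lambda>hs. rev (map star hs)) ` lists honb \<subseteq> lists (honb :: 'h set)"
    "(\<lambda>hs. rev (map star hs)) ` lists honb \<subseteq> lists (honb :: 'h set)"
    by (auto simp: in_lists_conv_set)
qed (auto simp: rev_map comp_def star_star)

text \<open>By the Cauchy-Schwarz inequality the sum in \<open>spair\<close> converges, so that its
  value is a genuine sum and no default.\<close>

lemma spair_summable:
  assumes "\<Xi> \<in> sfock" "\<Psi> \<in> sfock"
  shows "(\<lambda>hs. gmult (\<Xi> (rev (map star hs))) (\<Psi> hs) ls) summable_on lists honb"
  using assms by (intro summable_on_gmult)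
    (auto simp: square_summable_reindex[OF bij_betw_rev_star] sfock_square_summable)

subsection \<open>Parity and products of several factors\<close>

text \<open>The zero tensor has both parities, just as the zero vector lies in both parts.\<close>

definition has_parity :: "bool \<Rightarrow> 'a tensor \<Rightarrow> bool" where
  "has_parity k T \<longleftrightarrow> (\<forall>xs. T xs \<noteq> 0 \<longrightarrow> odd (length xs) = k)"

lemma has_parityD: "has_parity k T \<Longrightarrow> T xs \<noteq> 0 \<Longrightarrow> odd (length xs) = k"
  by (simp add: has_parity_def)

lemma has_parity_gone: "has_parity False gone"
  by (simp add: has_parity_def gone_def)

lemma has_parity_gmult:
  fixes S T :: "'a tensor"
  assumes "has_parity k S" "has_parity l T"
  shows "has_parity (k \<noteq> l) (gmult S T)"
  unfolding has_parity_def
proof (intro allI impI)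
  fix xs :: "'a list" assume nz: "gmult S T xs \<noteq> 0"
  obtain J c u v where J: "finite (J :: ((nat \<Rightarrow> nat) \<times> nat) set)"
    "\<And>S T. gmult S T xs = (\<Sum>j\<in>J. c j * (S (u j) * T (v j)))"
    "\<And>j. j \<in> J \<Longrightarrow> length (u j) + length (v j) = length xs"
    by (rule gmult_expansion[of xs]) blast
  obtain j where j: "j \<in> J" "c j * (S (u j) * T (v j)) \<noteq> 0"
    using nz unfolding J(2) by (rule sum.not_neutral_contains_not_neutral)
  then have "odd (length (u j)) = k" "odd (length (v j)) = l"
    using has_parityD[OF assms(1), of "u j"] has_parityD[OF assms(2), of "v j"] by simp_all
  then show "odd (length xs) = (k \<noteq> l)"
    unfolding J(3)[OF j(1), symmetric] by auto
qed

lemma gmult_parity_commute: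
  "has_parity k S \<Longrightarrow> has_parity l T \<Longrightarrow>
    gmult S T = (\<lambda>xs. (if k \<and> l then -1 else 1) * gmult T S xs)"
  by (rule gmult_graded_commute) (auto dest!: has_parityD)

lemma gmult_even_commute:
  assumes "has_parity False S"
  shows "gmult S T = gmult T S"
proof -
  have "gmult S T = (\<lambda>xs. 1 * gmult T S xs)"
    by (rule gmult_graded_commute) (use assms in \<open>auto dest!: has_parityD\<close>)
  then show ?thesis by simp
qed

definition gprod :: "'a tensor list \<Rightarrow> 'a tensor" where
  "gprod Ts = foldr gmult Ts gone"

lemma gprod_Nil [simp]: "gprod [] = gone"
  by (simp add: gprod_def)

lemma gprod_Cons [simp]: "gprod (T # Ts) = gmult T (gprod Ts)"
  by (simp add: gprod_def)

lemma alternating_gone: "alternating gone"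
  by (simp add: alternating_def gone_def)

lemma alternating_gprod: "alternating (gprod Ts)"
  by (cases Ts) (simp_all add: alternating_gone alternating_gmult)

lemma gprod_append: "gprod (Ss @ Ts) = gmult (gprod Ss) (gprod Ts)"
  by (induction Ss) (simp_all add: gmult_gone_left alt_alternating[OF alternating_gprod] gmult_assoc)

lemma gprod_snoc: "gprod (Ts @ [T]) = gmult (gprod Ts) T"
proof -
  have "gprod (Ts @ [T]) = gmult (gmult (gprod Ts) T) gone"
    by (simp only: gprod_append gprod_Cons gprod_Nil gmult_assoc)
  then show ?thesis by (simp only: gmult_gone_right alt_alternating[OF alternating_gmult])
qed

lemma tstar_gprod: "tstar (gprod Ts) = gprod (rev (map tstar Ts))"
  by (induction Ts) (simp_all add: tstar_gone tstar_gmult gprod_snoc)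

text \<open>The sign is the one in \<open>graded_symmetric\<close>; this makes products of values
  graded symmetric in the one-particle arguments.\<close>

lemma gprod_swap:
  assumes "has_parity k S" "has_parity l T"
  shows "gprod (Us @ T # S # Vs) xs = (if k \<and> l then -1 else 1) * gprod (Us @ S # T # Vs) xs"
proof -
  let ?\<epsilon> = "if k \<and> l then -1 else 1 :: complex"
  have *: "gprod (Us @ A # B # Vs) = gmult (gprod Us) (gmult (gmult A B) (gprod Vs))" for A B
    by (simp add: gprod_append gmult_assoc)
  have "gmult T S = (\<lambda>xs. ?\<epsilon> * gmult S T xs)"
    using gmult_parity_commute[OF assms(2,1)] by (simp add: conj_commute)
  then have "gprod (Us @ T # S # Vs)
      = gmult (gprod Us) (gmult (\<lambda>xs. ?\<epsilon> * gmult S T xs) (gprod Vs))"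
    by (simp only: *)
  also have "\<dots> = (\<lambda>xs. ?\<epsilon> * gmult (gprod Us) (gmult (gmult S T) (gprod Vs)) xs)"
    by (simp only: gmult_scale_left[abs_def] gmult_scale_right[abs_def])
  finally show ?thesis by (simp only: *)
qed


subsection \<open>Multilinearity and boundedness of the product\<close>

text \<open>The argument at position \<open>length xs\<close> lands at a place that does not depend
  on its value, which is what linearity of \<open>alt\<close> in each argument requires.\<close>

lemma permute_list_insert:
  assumes \<sigma>: "\<sigma> permutes {..<Suc (length xs + length zs)}"
  obtains us vs where "\<And>x. permute_list \<sigma> (xs @ x # zs) = us @ x # vs"
proof
  \<comment> \<open>The position that receives the distinguished argument. The list with
    \<open>undefined\<close> in its place serves to name the other entries.\<close>
  let ?i = "inv \<sigma> (length xs)" and ?ys = "\<lambda>x. permute_list \<sigma> (xs @ x # zs)"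
  let ?n = "Suc (length xs + length zs)"
  have i: "?i < ?n" "\<sigma> ?i = length xs"
    using permutes_in_image[OF permutes_inv[OF \<sigma>], of "length xs"] permutes_inverses[OF \<sigma>] by auto
  have nth: "?ys x ! j = ?ys undefined ! j" if "j < ?n" "j \<noteq> ?i" for x j
  proof -
    have "\<sigma> j \<noteq> length xs" using that(2) permutes_inverses(2)[OF \<sigma>, of j] by auto
    then show ?thesis
      using that(1) \<sigma> by (simp add: permute_list_nth nth_append nth_Cons')
  qed
  show "?ys x = take ?i (?ys undefined) @ x # drop (Suc ?i) (?ys undefined)" for x
  proof -
    have "?ys x = take ?i (?ys x) @ ?ys x ! ?i # drop (Suc ?i) (?ys x)"
      by (rule id_take_nth_drop) (use i in simp)
    moreover have "?ys x ! ?i = x"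
      using i \<sigma> by (simp add: permute_list_nth)
    moreover have "take ?i (?ys x) = take ?i (?ys undefined)"
      by (rule nth_equalityI) (use i nth[of _ x] in auto)
    moreover have "drop (Suc ?i) (?ys x) = drop (Suc ?i) (?ys undefined)"
      by (rule nth_equalityI) (use i nth[of _ x] in auto)
    ultimately show ?thesis by simp
  qed
qed

lemma multi_antilinearD:
  "multi_antilinear T \<Longrightarrow> T (xs @ (x + y) # zs) = T (xs @ x # zs) + T (xs @ y # zs)"
  "multi_antilinear T \<Longrightarrow> T (xs @ (c *\<^sub>C x) # zs) = cnj c * T (xs @ x # zs)"
  by (simp_all add: multi_antilinear_def)

lemma multi_antilinear_scale: "multi_antilinear T \<Longrightarrow> multi_antilinear (\<lambda>xs. c (length xs) * T xs)"
  by (simp add: multi_antilinear_def algebra_simps)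

lemma multi_antilinear_alt:
  assumes T: "multi_antilinear T"
  shows "multi_antilinear (alt T)"
proof -
  have "T (permute_list \<sigma> (xs @ (x + y) # zs))
      = T (permute_list \<sigma> (xs @ x # zs)) + T (permute_list \<sigma> (xs @ y # zs)) \<and>
    T (permute_list \<sigma> (xs @ (c *\<^sub>C x) # zs)) = cnj c * T (permute_list \<sigma> (xs @ x # zs))"
    if \<sigma>: "\<sigma> permutes {..<Suc (length xs + length zs)}" for \<sigma> xs zs x y c
  proof -
    obtain us vs where "\<And>x. permute_list \<sigma> (xs @ x # zs) = us @ x # vs"
      by (rule permute_list_insert[OF \<sigma>]) blast
    then show ?thesis by (simp add: multi_antilinearD[OF T])
  qed
  then show ?thesis
    unfolding multi_antilinear_def
    by (simp add: alt_def sum.distrib sum_distrib_left add_divide_distrib algebra_simps)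
qed

lemma multi_antilinear_ten:
  assumes S: "multi_antilinear S" and T: "multi_antilinear T"
  shows "multi_antilinear (\<lambda>xs. S (take p xs) * T (drop p xs))"
  unfolding multi_antilinear_def
proof (intro conjI allI)
  fix xs zs :: "'a list" and x y :: 'a and c
  consider "p \<le> length xs" | "length xs < p" by linarith
  then show "S (take p (xs @ (x + y) # zs)) * T (drop p (xs @ (x + y) # zs))
      = S (take p (xs @ x # zs)) * T (drop p (xs @ x # zs)) + S (take p (xs @ y # zs)) * T (drop p (xs @ y # zs))"
    by cases (simp_all add: take_Cons' drop_Cons' multi_antilinearD[OF S] multi_antilinearD[OF T] algebra_simps)
  consider "p \<le> length xs" | "length xs < p" by linarith
  then show "S (take p (xs @ (c *\<^sub>C x) # zs)) * T (drop p (xs @ (c *\<^sub>C x) # zs))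
      = cnj c * (S (take p (xs @ x # zs)) * T (drop p (xs @ x # zs)))"
    by cases (simp_all add: take_Cons' drop_Cons' multi_antilinearD[OF S] multi_antilinearD[OF T] algebra_simps)
qed

lemma multi_antilinear_gmult:
  assumes S: "multi_antilinear S" and T: "multi_antilinear T"
  shows "multi_antilinear (gmult S T)"
proof -
  have "multi_antilinear (\<lambda>xs. \<Sum>p\<le>length xs. of_real (sqrt (length xs choose p)) * (S (take p xs) * T (drop p xs)))"
    using multi_antilinear_ten[OF S T]
    by (simp add: multi_antilinear_def sum.distrib sum_distrib_left algebra_simps)
  then show ?thesis unfolding gmult_def by (rule multi_antilinear_alt)
qed

lemma multi_antilinear_gone: "multi_antilinear gone"
  by (simp add: multi_antilinear_def gone_def)

lemma prod_list_norm_nonneg: "0 \<le> prod_norm xs"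
  by (induction xs) auto

lemma norm_alt_le:
  assumes "\<And>\<sigma>. \<sigma> permutes {..<length xs} \<Longrightarrow> cmod (T (permute_list \<sigma> xs)) \<le> M"
  shows "cmod (alt T xs) \<le> M"
proof -
  have "cmod (\<Sum>\<sigma> | \<sigma> permutes {..<length xs}. of_int (sign \<sigma>) * T (permute_list \<sigma> xs))
      \<le> (\<Sum>\<sigma> | \<sigma> permutes {..<length xs}. M)"
    by (rule sum_norm_le) (use assms in \<open>simp add: norm_mult flip: of_int_abs\<close>)
  also have "\<dots> = fact (length xs) * M" by (simp add: card_permutations[OF refl])
  finally show ?thesis by (simp add: alt_def norm_divide field_simps)
qed

lemma prod_list_permute:
  "\<sigma> permutes {..<length xs} \<Longrightarrow> prod_list (map f (permute_list \<sigma> xs)) = prod_list (map (f :: _ \<Rightarrow> real) xs)"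
  using mset_permute_list[of \<sigma> xs] by (metis mset_map prod_mset_prod_list)

text \<open>The bounds are split into a constant depending on the Grassmann degree and a factor
  \<open>a\<close> or \<open>b\<close> that does not. The latter carries the norms of the
  one-particle arguments through an induction over the factors.\<close>

lemma norm_gmult_le:
  fixes S T :: "'a::complex_inner tensor"
  assumes S: "\<And>xs. cmod (S xs) \<le> C (length xs) * a * prod_norm xs"
    and T: "\<And>xs. cmod (T xs) \<le> D (length xs) * b * prod_norm xs"
  shows "cmod (gmult S T xs)
    \<le> (\<Sum>p\<le>length xs. sqrt (length xs choose p) * (C p * D (length xs - p))) * (a * b) * prod_norm xs"
  unfolding gmult_def
proof (rule norm_alt_le)
  fix \<sigma> assume \<sigma>: "\<sigma> permutes {..<length xs}"
  define ys where "ys = permute_list \<sigma> xs"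
  have ys: "length ys = length xs" "prod_norm ys = prod_norm xs"
    using \<sigma> by (simp_all add: ys_def prod_list_permute)
  have "cmod (S (take p ys) * T (drop p ys)) \<le> (C p * D (length xs - p)) * (a * b) * prod_norm xs"
    if p: "p \<le> length xs" for p
  proof -
    have "cmod (S (take p ys)) * cmod (T (drop p ys))
        \<le> (C p * a * prod_norm (take p ys)) * (D (length xs - p) * b * prod_norm (drop p ys))"
      using S[of "take p ys"] T[of "drop p ys"] p ys(1)
      by (intro mult_mono) (auto simp: min_absorb2 intro: order_trans[OF norm_ge_zero])
    also have "\<dots> = (C p * D (length xs - p)) * (a * b)
        * (prod_norm (take p ys) * prod_norm (drop p ys))"
      by (simp only: mult_ac)
    also have "prod_norm (take p ys) * prod_norm (drop p ys) = prod_norm xs"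
      unfolding ys(2)[symmetric] prod_list.append[symmetric] map_append[symmetric] by simp
    finally show ?thesis by (simp add: norm_mult)
  qed
  then have "cmod (\<Sum>p\<le>length ys. of_real (sqrt (length ys choose p)) * (S (take p ys) * T (drop p ys)))
      \<le> (\<Sum>p\<le>length xs. sqrt (length xs choose p) * ((C p * D (length xs - p)) * (a * b) * prod_norm xs))"
    unfolding ys(1) by (intro sum_norm_le) (simp add: norm_mult mult_left_mono)
  then show "cmod (\<Sum>p\<le>length (permute_list \<sigma> xs). complex_of_real (sqrt (length (permute_list \<sigma> xs) choose p)) *
        (S (take p (permute_list \<sigma> xs)) * T (drop p (permute_list \<sigma> xs))))
      \<le> (\<Sum>p\<le>length xs. sqrt (length xs choose p) * (C p * D (length xs - p))) * (a * b) * prod_norm xs"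
    by (simp add: ys_def sum_distrib_right mult.assoc)
qed


subsection \<open>The exponential of an element of degree one\<close>

lemma HL_sfock:
  assumes "\<zeta> \<in> HL"
  shows "\<zeta> \<in> sfock"
proof -
  obtain \<zeta>0 \<zeta>1 where \<zeta>: "\<zeta> = (\<lambda>hs ls. \<zeta>0 hs ls + \<zeta>1 hs ls)" "\<zeta>0 \<in> HL_part False" "\<zeta>1 \<in> HL_part True"
    using assms by (auto simp: HL_def)
  then have "\<zeta>0 \<in> sfock" "\<zeta>1 \<in> sfock" by (auto simp: HL_part_def)
  then show ?thesis using sfock_add_scale[of \<zeta>0 \<zeta>1 1] by (simp add: \<zeta>(1))
qed

lemma HL_length:
  assumes "\<zeta> \<in> HL" "length hs \<noteq> 1"
  shows "\<zeta> hs = (\<lambda>_. 0)"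
proof
  fix ls
  obtain \<zeta>0 \<zeta>1 where \<zeta>: "\<zeta> = (\<lambda>hs ls. \<zeta>0 hs ls + \<zeta>1 hs ls)" "\<zeta>0 \<in> HL_part False" "\<zeta>1 \<in> HL_part True"
    using assms(1) by (auto simp: HL_def)
  then have "\<zeta>0 hs ls = 0" "\<zeta>1 hs ls = 0"
    using assms(2) unfolding HL_part_def by blast+
  then show "\<zeta> hs ls = 0" by (simp add: \<zeta>(1))
qed

text \<open>Each of the two components of \<open>\<zeta>\<close> vanishes on vectors of the other
  parity and has Grassmann degrees of its own parity only.\<close>

lemma HL_parity:
  assumes "\<zeta> \<in> HL" and h: "h \<in> hpart k"
  shows "has_parity k (\<zeta> [h])"
proof -
  obtain \<zeta>0 \<zeta>1 where \<zeta>: "\<zeta> = (\<lambda>hs ls. \<zeta>0 hs ls + \<zeta>1 hs ls)" "\<zeta>0 \<in> HL_part False" "\<zeta>1 \<in> HL_part True"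
    using assms(1) by (auto simp: HL_def)
  have p: "odd (length ls) = False" if "\<zeta>0 [h] ls \<noteq> 0" for ls using \<zeta>(2) that by (auto simp: HL_part_def)
  have q: "odd (length ls) = True" if "\<zeta>1 [h] ls \<noteq> 0" for ls using \<zeta>(3) that by (auto simp: HL_part_def)
  have "\<zeta>0 [h] ls = 0" if k for ls using \<zeta>(2) h that by (auto simp: HL_part_def)
  moreover have "\<zeta>1 [h] ls = 0" if "\<not> k" for ls using \<zeta>(3) h that by (auto simp: HL_part_def)
  ultimately show ?thesis using p q by (cases k) (auto simp: has_parity_def \<zeta>(1))
qed

definition zprod :: "('h, 'l) stensor \<Rightarrow> ('h, 'l) stensor" where
  "zprod \<zeta> hs = gprod (map (\<lambda>h. \<zeta> [h]) hs)"

lemma zprod_Nil [simp]: "zprod \<zeta> [] = gone"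
  by (simp add: zprod_def)

lemma zprod_Cons [simp]: "zprod \<zeta> (h # hs) = gmult (\<zeta> [h]) (zprod \<zeta> hs)"
  by (simp add: zprod_def)

lemma zprod_append: "zprod \<zeta> (hs @ gs) = gmult (zprod \<zeta> hs) (zprod \<zeta> gs)"
  by (simp add: zprod_def gprod_append)

lemma zprod_scale: "zprod (\<lambda>hs ls. c * \<zeta> hs ls) hs ls = c ^ length hs * zprod \<zeta> hs ls"
proof (induction hs arbitrary: ls)
  case (Cons h hs)
  have "zprod (\<lambda>hs ls. c * \<zeta> hs ls) (h # hs) ls
      = gmult (\<lambda>ls. c * \<zeta> [h] ls) (\<lambda>ls. c ^ length hs * zprod \<zeta> hs ls) ls"
    unfolding zprod_Cons Cons.IH[abs_def] ..
  then show ?case by (simp add: gmult_scale_left gmult_scale_right)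
qed simp

lemma graded_symmetric_zprod:
  assumes \<zeta>: "\<zeta> \<in> HL"
  shows "graded_symmetric (\<lambda>hs. zprod \<zeta> hs ls)"
  unfolding graded_symmetric_def zprod_def map_append list.map
  by (intro allI impI gprod_swap HL_parity[OF \<zeta>])

lemma multi_antilinear_zprod:
  fixes \<zeta> :: "('h::super_chilbert_space, 'l::grassmann_generators) stensor"
  assumes \<zeta>: "\<zeta> \<in> sfock"
  shows "multi_antilinear (\<lambda>hs. zprod \<zeta> hs ls)" "multi_antilinear (zprod \<zeta> hs)"
proof -
  have \<zeta>1: "multi_antilinear (\<lambda>hs. \<zeta> hs ls)" for ls using \<zeta> by (simp add: sfock_def)
  have "\<zeta> [x + y] = (\<lambda>ls. \<zeta> [x] ls + \<zeta> [y] ls)" "\<zeta> [c *\<^sub>C x] = (\<lambda>ls. cnj c * \<zeta> [x] ls)" for x y c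
    using multi_antilinearD[OF \<zeta>1, where xs="[]" and zs="[]"] by (auto simp: fun_eq_iff)
  then show "multi_antilinear (\<lambda>hs. zprod \<zeta> hs ls)"
    by (simp add: multi_antilinear_def zprod_append gmult_add_left[abs_def] gmult_add_right
        gmult_scale_left[abs_def] gmult_scale_right)
  show "multi_antilinear (zprod \<zeta> hs)"
    using \<zeta> by (induction hs) (auto simp: multi_antilinear_gone sfock_def intro!: multi_antilinear_gmult)
qed

lemma zprod_bounded:
  fixes \<zeta> :: "('h::super_chilbert_space, 'l::grassmann_generators) stensor"
  assumes \<zeta>: "\<zeta> \<in> sfock"
  shows "\<exists>K. \<forall>hs ls. length hs = m \<longrightarrow>
    cmod (zprod \<zeta> hs ls) \<le> K (length ls) * prod_norm hs * prod_norm ls"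
proof (induction m)
  case 0
  have "cmod (gone ls) \<le> 1 * prod_norm ls" for ls :: "'l list"
    by (simp add: gone_def prod_list_norm_nonneg)
  then show ?case by (intro exI[of _ "\<lambda>_. 1"]) simp
next
  case (Suc m)
  then obtain K where K: "\<And>hs ls. length hs = m \<Longrightarrow>
    cmod (zprod \<zeta> hs ls) \<le> K (length ls) * prod_norm hs * prod_norm ls" by blast
  have "\<exists>C. \<forall>hs ls. length hs = 1 \<longrightarrow> length ls = n \<longrightarrow>
    cmod (\<zeta> hs ls) \<le> C * (prod_norm hs * prod_norm ls)" for n
    using sfock_bounded[OF \<zeta>, of 1 n] by metis
  then obtain C where C: "\<And>hs ls. length hs = 1 \<Longrightarrow>
    cmod (\<zeta> hs ls) \<le> C (length ls) * (prod_norm hs * prod_norm ls)"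
    by metis
  show ?case
  proof (intro exI allI impI)
    fix hs :: "'h list" and ls :: "'l list"
    assume "length hs = Suc m"
    then obtain h gs where hs: "hs = h # gs" "length gs = m" by (auto simp: length_Suc_conv)
    show "cmod (zprod \<zeta> hs ls)
        \<le> (\<Sum>p\<le>length ls. sqrt (length ls choose p) * (C p * K (length ls - p))) * prod_norm hs * prod_norm ls"
      unfolding hs zprod_Cons list.map prod_list.Cons
    proof (rule norm_gmult_le)
      show "cmod (\<zeta> [h] xs) \<le> C (length xs) * norm h * prod_norm xs" for xs
        using C[of "[h]" xs] by (simp add: mult.assoc)
    qed (rule K[OF hs(2)])
  qed
qed

text \<open>The product of the values is already graded symmetric, so \<open>gsym\<close> acts trivially in each step.\<close>

lemma spow_eq:
  fixes \<zeta> :: "('h::super_chilbert_space, 'l::grassmann_generators) stensor"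
  assumes \<zeta>: "\<zeta> \<in> HL"
  shows "spow \<zeta> n = (\<lambda>hs ls. if length hs = n then complex_of_real (sqrt (fact n)) * zprod \<zeta> hs ls else 0)"
proof (induction n)
  case 0
  show ?case by (auto simp: sone_def stimes_def fun_eq_iff)
next
  case (Suc n)
  let ?R = "\<lambda>n hs ls. if length hs = n then complex_of_real (sqrt (fact n)) * zprod \<zeta> hs ls else 0"
  have inner: "(\<Sum>p\<le>length xs. of_real (sqrt (length xs choose p)) * gmult (\<zeta> (take p xs)) (spow \<zeta> n (drop p xs)) ls)
      = ?R (Suc n) xs ls" for xs ls
  proof (cases xs)
    case Nil
    then show ?thesis by (simp add: HL_length[OF \<zeta>])
  next
    case (Cons x ys)
    have "(\<Sum>p\<le>length xs. of_real (sqrt (length xs choose p)) * gmult (\<zeta> (take p xs)) (spow \<zeta> n (drop p xs)) ls)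
      = (\<Sum>p\<in>{1}. of_real (sqrt (length xs choose p)) * gmult (\<zeta> (take p xs)) (spow \<zeta> n (drop p xs)) ls)"
      \<comment> \<open>Since \<open>\<zeta>\<close> takes exactly one argument, only the splitting
        after the first position contributes.\<close>
      by (rule sum.mono_neutral_right) (auto simp: Cons HL_length[OF \<zeta>])
    also have "\<dots> = complex_of_real (sqrt (Suc (length ys))) * gmult (\<zeta> [x]) (?R n ys) ls"
      by (simp add: Cons Suc.IH)
    also have "\<dots> = ?R (Suc n) xs ls"
      by (simp add: Cons gmult_scale_right real_sqrt_mult)
    finally show ?thesis .
  qed
  show ?case
  proof (intro ext)
    fix hs :: "'h list" and ls :: "'l list"
    \<comment> \<open>The restriction to length \<open>n + 1\<close> is written as a coefficient
      depending on the length, which preserves antilinearity.\<close>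
    have "multi_antilinear (\<lambda>hs. ?R (Suc n) hs ls)"
      using multi_antilinear_scale[OF multi_antilinear_zprod(1)[OF HL_sfock[OF \<zeta>], of ls],
          where c="\<lambda>m. if m = Suc n then complex_of_real (sqrt (fact (Suc n))) else 0"]
      by (simp only: if_distribR mult_zero_left if_distrib[of "\<lambda>c. c * _"])
    moreover have "graded_symmetric (\<lambda>hs. ?R (Suc n) hs ls)"
      unfolding graded_symmetric_def
    proof (intro allI impI)
      fix us vs :: "'h list" and a b :: 'h and k l
      assume "set us \<union> set vs \<subseteq> hpart False \<union> hpart True" "a \<in> hpart k" "b \<in> hpart l"
      from graded_symmetricD[OF graded_symmetric_zprod[OF \<zeta>, of ls] this]
      show "?R (Suc n) (us @ b # a # vs) ls = (if k \<and> l then -1 else 1) * ?R (Suc n) (us @ a # b # vs) ls"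
        by simp
    qed
    ultimately have "gsym (\<lambda>hs. ?R (Suc n) hs ls) = (\<lambda>hs. ?R (Suc n) hs ls)"
      by (rule gsym_graded_symmetric)
    from fun_cong[OF this] have "gsym (\<lambda>hs. ?R (Suc n) hs ls) hs = ?R (Suc n) hs ls" .
    then show "spow \<zeta> (Suc n) hs ls = ?R (Suc n) hs ls"
      unfolding spow.simps sprod_def inner .
  qed
qed

text \<open>At fixed arguments a single term of the series is nonzero, with coefficient
  \<open>sqrt (n!) / n!\<close>.\<close>

lemma sexp_eq:
  assumes \<zeta>: "\<zeta> \<in> HL"
  shows "sexp \<zeta> hs ls = zprod \<zeta> hs ls / complex_of_real (sqrt (fact (length hs)))"
proof -
  let ?n = "length hs"
  have "(\<lambda>n. spow \<zeta> n hs ls / fact n) sums (spow \<zeta> ?n hs ls / fact ?n)"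
    using sums_single[of ?n "\<lambda>n. spow \<zeta> n hs ls / fact n"]
    by (rule sums_cong[THEN iffD1, rotated]) (simp add: spow_eq[OF \<zeta>])
  then have "sexp \<zeta> hs ls = spow \<zeta> ?n hs ls / fact ?n"
    by (simp add: sexp_def sums_unique[symmetric])
  also have "\<dots> = zprod \<zeta> hs ls * complex_of_real (sqrt (fact ?n) / fact ?n)"
    by (simp add: spow_eq[OF \<zeta>])
  also have "sqrt (fact ?n) / fact ?n = inverse (sqrt (fact ?n))"
    by (rule sqrt_divide_self_eq) simp
  finally show ?thesis by (simp add: field_simps)
qed

lemma HLD_HL: "\<zeta> \<in> HLD \<Longrightarrow> \<zeta> \<in> HL"
  by (simp add: HLD_def)

lemma tstar_HLD: "\<zeta> \<in> HLD \<Longrightarrow> tstar (\<zeta> [star h]) = \<zeta> [h]"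
proof -
  assume "\<zeta> \<in> HLD"
  then have "sstar \<zeta> [h] = \<zeta> [h]" by (simp add: HLD_def)
  then show ?thesis by (simp add: sstar_def)
qed

text \<open>The involution reverses the product and also the list of arguments; the order is
  restored and each factor is fixed because \<open>\<zeta>\<close> is real.\<close>

lemma sstar_sexp:
  assumes \<zeta>: "\<zeta> \<in> HLD"
  shows "sstar (sexp \<zeta>) = sexp \<zeta>"
proof (intro ext)
  fix hs ls
  have "tstar (zprod \<zeta> (rev (map star hs))) = zprod \<zeta> hs"
    by (simp add: zprod_def tstar_gprod rev_map comp_def tstar_HLD[OF \<zeta>])
  then have "tstar (zprod \<zeta> (rev (map star hs))) ls = zprod \<zeta> hs ls" by simp
  then show "sstar (sexp \<zeta>) hs ls = sexp \<zeta> hs ls"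
    by (simp add: sstar_def tstar_def sexp_eq[OF HLD_HL[OF \<zeta>]])
qed

subsection \<open>Norm estimates\<close>

lemma binomial_ge_top: "0 < p \<Longrightarrow> p < n \<Longrightarrow> n \<le> n choose p"
proof (induction n arbitrary: p)
  case (Suc n)
  obtain q where p: "p = Suc q" using Suc.prems by (cases p) auto
  show ?case
  proof (cases "p = n")
    case True
    then show ?thesis using binomial_symmetric[of n "Suc n"] by simp
  next
    case False
    then have "n \<le> n choose p" using Suc by simp
    moreover have "0 < n choose q" using Suc.prems p by simp
    ultimately show ?thesis unfolding p binomial_Suc_Suc by linarith
  qed
qed simp

text \<open>The two ends contribute 1 each; each of the \<open>n - 1\<close> terms between them is
  at most \<open>1 / n\<close>.\<close>

lemma sum_inverse_binomial_le: "(\<Sum>p\<le>n. 1 / real (n choose p)) \<le> 3"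
proof (cases "n < 2")
  case True
  then have "n = 0 \<or> n = 1" by linarith
  then show ?thesis by auto
next
  case False
  then have n: "{..n} = insert 0 (insert n {1..<n})" by auto
  have "(\<Sum>p\<in>{1..<n}. 1 / real (n choose p)) \<le> (\<Sum>p\<in>{1..<n}. 1 / real n)"
    using binomial_ge_top[of _ n] False by (intro sum_mono divide_left_mono) (auto simp: Suc_le_eq)
  also have "\<dots> \<le> 1" using False by (simp add: field_simps)
  finally show ?thesis using False by (simp add: n)
qed

definition weight :: "'a tensor \<Rightarrow> 'a list \<Rightarrow> real" where
  "weight T xs = (cmod (T xs))\<^sup>2 / (fact (length xs))\<^sup>2"

lemma weight_nonneg [simp]: "0 \<le> weight T xs"
  by (simp add: weight_def)

lemma finite_words: "finite A \<Longrightarrow> finite (words A n)"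
  by (simp add: words_def lists_eq_set finite_lists_length_eq)

lemma bij_betw_words_append: "p \<le> n \<Longrightarrow> bij_betw (\<lambda>(xs, ys). xs @ ys) (words A p \<times> words A (n - p)) (words A n)"
  by (rule bij_betw_byWitness[where f'="\<lambda>xs. (take p xs, drop p xs)"])
    (auto simp: words_def min_def dest: in_set_takeD in_set_dropD)

lemma bij_betw_words_permute:
  assumes \<sigma>: "\<sigma> permutes {..<n}"
  shows "bij_betw (permute_list \<sigma>) (words A n) (words A n)"
proof (rule bij_betw_byWitness[where f'="permute_list (inv \<sigma>)"])
  note \<sigma>' = permutes_inv[OF \<sigma>]
  show "\<forall>xs\<in>words A n. permute_list (inv \<sigma>) (permute_list \<sigma> xs) = xs"
    using \<sigma>' permutes_inv_o(1)[OF \<sigma>]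
    by (auto simp: words_def permute_list_compose[symmetric])
  show "\<forall>xs\<in>words A n. permute_list \<sigma> (permute_list (inv \<sigma>) xs) = xs"
    using \<sigma> permutes_inv_o(2)[OF \<sigma>]
    by (auto simp: words_def permute_list_compose[symmetric])
  show "permute_list \<sigma> ` words A n \<subseteq> words A n" "permute_list (inv \<sigma>) ` words A n \<subseteq> words A n"
    using \<sigma> \<sigma>' by (auto simp: words_def in_lists_conv_set)
qed

text \<open>
  The weights of the norm turn the factors \<open>sqrt (n choose p)\<close> of the product into their inverses, the
  squares of which have a bounded sum.
\<close>

lemma weight_gmult_le:
  fixes S T :: "'a tensor"
  shows "weight (gmult S T) xs \<le> (\<Sum>\<sigma> | \<sigma> permutes {..<length xs}.
    3 * (\<Sum>p\<le>length xs. weight S (take p (permute_list \<sigma> xs)) * weight T (drop p (permute_list \<sigma> xs)))) / fact (length xs)"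
proof -
  let ?n = "length xs"
  let ?U = "\<lambda>ys. \<Sum>p\<le>length ys. of_real (sqrt (length ys choose p)) * (S (take p ys) * T (drop p ys))"
  let ?H = "\<lambda>ys. 3 * (\<Sum>p\<le>?n. weight S (take p ys) * weight T (drop p ys))"
  have U: "(cmod (?U ys))\<^sup>2 \<le> (fact ?n)\<^sup>2 * ?H ys" if ys: "length ys = ?n" for ys :: "'a list"
  proof -
    let ?b = "\<lambda>p. real (?n choose p)" and ?s = "\<lambda>p. cmod (S (take p ys))" and ?t = "\<lambda>p. cmod (T (drop p ys))"
    have pos: "0 < ?b p" if "p \<in> {..?n}" for p using that by simp
    have "cmod (?U ys) \<le> (\<Sum>p\<le>?n. sqrt (?b p) * (?s p * ?t p))"
      unfolding ys by (rule sum_norm_le) (simp add: norm_mult)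
    \<comment> \<open>The factor \<open>sqrt b\<close> is written as
      \<open>(1 / sqrt b) * b\<close>: Cauchy-Schwarz then separates a sum of inverse binomials from
      the squares, whose factor \<open>b^2\<close> is exactly what converts the weights of the
      blocks into the weight of the whole.\<close>
    also have "\<dots> = (\<Sum>p\<le>?n. (1 / sqrt (?b p)) * (?b p * (?s p * ?t p)))"
    proof (rule sum.cong[OF refl])
      fix p assume "p \<in> {..?n}"
      then have "sqrt (?b p) = ?b p / sqrt (?b p)" by (simp add: real_div_sqrt)
      from arg_cong[OF this, of "\<lambda>r. r * (?s p * ?t p)"]
      show "sqrt (?b p) * (?s p * ?t p) = (1 / sqrt (?b p)) * (?b p * (?s p * ?t p))" by simp
    qed
    finally have "(cmod (?U ys))\<^sup>2 \<le> (\<Sum>p\<le>?n. (1 / sqrt (?b p)) * (?b p * (?s p * ?t p)))\<^sup>2"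
      by (simp add: power_mono)
    also have "\<dots> \<le> (\<Sum>p\<le>?n. (1 / sqrt (?b p))\<^sup>2) * (\<Sum>p\<le>?n. (?b p * (?s p * ?t p))\<^sup>2)"
      by (rule Cauchy_Schwarz_ineq_sum)
    also have "\<dots> \<le> 3 * (\<Sum>p\<le>?n. (?b p * (?s p * ?t p))\<^sup>2)"
      using sum_inverse_binomial_le[of ?n] by (intro mult_right_mono sum_nonneg) (simp_all add: power_divide)
    also have "(\<Sum>p\<le>?n. (?b p * (?s p * ?t p))\<^sup>2)
        = (\<Sum>p\<le>?n. (fact ?n)\<^sup>2 * (weight S (take p ys) * weight T (drop p ys)))"
    proof (rule sum.cong[OF refl])
      fix p assume p: "p \<in> {..?n}"
      then have "?b p = fact ?n / (fact p * fact (?n - p))" by (simp add: binomial_fact)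
      then show "(?b p * (?s p * ?t p))\<^sup>2 = (fact ?n)\<^sup>2 * (weight S (take p ys) * weight T (drop p ys))"
        using p ys by (simp add: weight_def min_absorb2 power_mult_distrib power_divide)
    qed
    finally show ?thesis by (simp add: sum_distrib_left mult_ac)
  qed
  have "cmod (\<Sum>\<sigma> | \<sigma> permutes {..<?n}. of_int (sign \<sigma>) * ?U (permute_list \<sigma> xs))
      \<le> (\<Sum>\<sigma> | \<sigma> permutes {..<?n}. 1 * cmod (?U (permute_list \<sigma> xs)))"
    by (rule sum_norm_le) (simp add: norm_mult flip: of_int_abs)
  then have "(cmod (\<Sum>\<sigma> | \<sigma> permutes {..<?n}. of_int (sign \<sigma>) * ?U (permute_list \<sigma> xs)))\<^sup>2
      \<le> (\<Sum>\<sigma> | \<sigma> permutes {..<?n}. 1 * cmod (?U (permute_list \<sigma> xs)))\<^sup>2"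
    by (intro power_mono) simp_all
  \<comment> \<open>The square of an average is at most the average of the squares, here over all
    permutations.\<close>
  also have "\<dots> \<le> (\<Sum>\<sigma> | \<sigma> permutes {..<?n}. 1\<^sup>2) * (\<Sum>\<sigma> | \<sigma> permutes {..<?n}. (cmod (?U (permute_list \<sigma> xs)))\<^sup>2)"
    by (rule Cauchy_Schwarz_ineq_sum)
  also have "\<dots> \<le> fact ?n * (\<Sum>\<sigma> | \<sigma> permutes {..<?n}. (fact ?n)\<^sup>2 * ?H (permute_list \<sigma> xs))"
    using U by (simp add: card_permutations[OF refl] sum_mono)
  also have "\<dots> = (fact ?n)\<^sup>2 * (fact ?n)\<^sup>2 * ((\<Sum>\<sigma> | \<sigma> permutes {..<?n}. ?H (permute_list \<sigma> xs)) / fact ?n)"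
    by (simp add: sum_distrib_left[symmetric] power2_eq_square)
  finally have "(cmod (\<Sum>\<sigma> | \<sigma> permutes {..<?n}. of_int (sign \<sigma>) * ?U (permute_list \<sigma> xs)))\<^sup>2
      / ((fact ?n)\<^sup>2 * (fact ?n)\<^sup>2) \<le> (\<Sum>\<sigma> | \<sigma> permutes {..<?n}. ?H (permute_list \<sigma> xs)) / fact ?n"
    by (subst pos_divide_le_eq) (simp_all add: mult.commute)
  then show ?thesis
    by (simp add: weight_def gmult_def alt_def norm_divide power_divide)
qed

text \<open>Summed over all words the average over permutations disappears, since each permutation
  maps the words of length \<open>n\<close> bijectively to themselves. Splitting the words after
  \<open>p\<close> letters then factorises the sum.\<close>

lemma sum_words_weight_gmult_le:
  assumes A: "finite A"
  shows "(\<Sum>xs\<in>words A n. weight (gmult S T) xs)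
    \<le> 3 * (\<Sum>p\<le>n. (\<Sum>xs\<in>words A p. weight S xs) * (\<Sum>xs\<in>words A (n - p). weight T xs))"
proof -
  let ?H = "\<lambda>ys. 3 * (\<Sum>p\<le>n. weight S (take p ys) * weight T (drop p ys))"
  have "(\<Sum>xs\<in>words A n. weight (gmult S T) xs)
      \<le> (\<Sum>xs\<in>words A n. (\<Sum>\<sigma> | \<sigma> permutes {..<n}. ?H (permute_list \<sigma> xs)) / fact n)"
    by (rule sum_mono) (use weight_gmult_le[of S T] in \<open>auto simp: words_def\<close>)
  also have "\<dots> = (\<Sum>\<sigma> | \<sigma> permutes {..<n}. \<Sum>xs\<in>words A n. ?H (permute_list \<sigma> xs)) / fact n"
    unfolding sum_divide_distrib[symmetric] by (subst sum.swap) simp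
  also have "(\<Sum>\<sigma> | \<sigma> permutes {..<n}. \<Sum>xs\<in>words A n. ?H (permute_list \<sigma> xs))
      = (\<Sum>\<sigma> | \<sigma> permutes {..<n}. \<Sum>xs\<in>words A n. ?H xs)"
    by (rule sum.cong[OF refl]) (rule sum.reindex_bij_betw[OF bij_betw_words_permute], simp)
  also have "\<dots> = fact n * (\<Sum>xs\<in>words A n. ?H xs)"
    by (simp add: card_permutations[OF refl])
  also have "fact n * (\<Sum>xs\<in>words A n. ?H xs) / fact n = (\<Sum>xs\<in>words A n. ?H xs)" by simp
  also have "\<dots> = 3 * (\<Sum>p\<le>n. \<Sum>xs\<in>words A n. weight S (take p xs) * weight T (drop p xs))"
    by (subst sum.swap) (simp add: sum_distrib_left)
  also have "(\<Sum>p\<le>n. \<Sum>xs\<in>words A n. weight S (take p xs) * weight T (drop p xs))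
      = (\<Sum>p\<le>n. (\<Sum>xs\<in>words A p. weight S xs) * (\<Sum>xs\<in>words A (n - p). weight T xs))"
  proof (rule sum.cong[OF refl])
    fix p assume "p \<in> {..n}"
    then have "(\<Sum>xs\<in>words A n. weight S (take p xs) * weight T (drop p xs))
        = (\<Sum>q\<in>words A p \<times> words A (n - p). weight S (take p (fst q @ snd q)) * weight T (drop p (fst q @ snd q)))"
      by (subst sum.reindex_bij_betw[OF bij_betw_words_append[of p n A], symmetric])
        (simp_all add: case_prod_unfold)
    also have "\<dots> = (\<Sum>q\<in>words A p \<times> words A (n - p). weight S (fst q) * weight T (snd q))"
      by (rule sum.cong) (auto simp: words_def)
    finally show "(\<Sum>xs\<in>words A n. weight S (take p xs) * weight T (drop p xs))
        = (\<Sum>xs\<in>words A p. weight S xs) * (\<Sum>xs\<in>words A (n - p). weight T xs)"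
      by (simp add: sum_product sum.cartesian_product case_prod_unfold)
  qed
  finally show ?thesis .
qed

section \<open>Summation over words of all lengths\<close>

lemma finite_lists_cover:
  assumes F: "finite F" "F \<subseteq> lists A"
  obtains A0 N where "finite A0" "A0 \<subseteq> A" "F \<subseteq> (\<Union>n\<le>N. words A0 n)"
proof
  show "finite (\<Union>(set ` F))" using F by auto
  show "\<Union>(set ` F) \<subseteq> A" using F by auto
  show "F \<subseteq> (\<Union>n\<le>Max (insert 0 (length ` F)). words (\<Union>(set ` F)) n)"
    using F by (auto simp: words_def in_lists_conv_set)
qed

lemma sum_lists_le:
  fixes f :: "'a list \<Rightarrow> real"
  assumes "F \<subseteq> (\<Union>n\<le>N. words A0 n)" "finite A0" "\<And>xs. 0 \<le> f xs"
  shows "sum f F \<le> (\<Sum>n\<le>N. \<Sum>xs\<in>words A0 n. f xs)"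
proof -
  have "sum f F \<le> sum f (\<Union>n\<le>N. words A0 n)"
    using assms by (intro sum_mono2) (auto simp: finite_words)
  also have "\<dots> = (\<Sum>n\<le>N. \<Sum>xs\<in>words A0 n. f xs)"
    using assms by (intro sum.UNION_disjoint) (auto simp: finite_words, auto simp: words_def)
  finally show ?thesis .
qed

lemma sum_words_le_infsum:
  fixes f :: "'a list \<Rightarrow> real"
  assumes f: "f summable_on lists A" "\<And>xs. 0 \<le> f xs" and A0: "finite A0" "A0 \<subseteq> A"
  shows "(\<Sum>n\<le>N. \<Sum>xs\<in>words A0 n. f xs) \<le> infsum f (lists A)"
proof -
  have "(\<Sum>n\<le>N. \<Sum>xs\<in>words A0 n. f xs) = sum f (\<Union>n\<le>N. words A0 n)"
    using A0 by (intro sum.UNION_disjoint[symmetric]) (auto simp: finite_words, auto simp: words_def)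
  also have "\<dots> \<le> infsum f (lists A)"
    using f A0 by (intro finite_sum_le_infsum) (auto simp: finite_words, auto simp: words_def)
  finally show ?thesis .
qed

text \<open>The Grassmann product is bounded in the weighted norm, with the constant 3 of the
  inverse binomial sum for the squares of the norms.\<close>

lemma summable_weight_gmult:
  assumes S: "weight S summable_on lists A" and T: "weight T summable_on lists A"
  shows "weight (gmult S T) summable_on lists A"
    and "infsum (weight (gmult S T)) (lists A) \<le> 3 * infsum (weight S) (lists A) * infsum (weight T) (lists A)"
proof -
  let ?M = "3 * infsum (weight S) (lists A) * infsum (weight T) (lists A)"
  have le: "sum (weight (gmult S T)) F \<le> ?M" if F: "finite F" "F \<subseteq> lists A" for F
  proof -
    obtain A0 N where A0: "finite A0" "A0 \<subseteq> A" "F \<subseteq> (\<Union>n\<le>N. words A0 n)"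
      by (rule finite_lists_cover[OF F])
    let ?a = "\<lambda>p. \<Sum>xs\<in>words A0 p. weight S xs" and ?b = "\<lambda>p. \<Sum>xs\<in>words A0 p. weight T xs"
    have nn: "0 \<le> ?a p" "0 \<le> ?b p" for p by (simp_all add: sum_nonneg)
    have "sum (weight (gmult S T)) F \<le> (\<Sum>n\<le>N. \<Sum>xs\<in>words A0 n. weight (gmult S T) xs)"
      by (rule sum_lists_le[OF A0(3,1)]) simp
    also have "\<dots> \<le> (\<Sum>n\<le>N. 3 * (\<Sum>p\<le>n. ?a p * ?b (n - p)))"
      by (intro sum_mono sum_words_weight_gmult_le A0)
    also have "\<dots> = 3 * (\<Sum>(p, q)\<in>{(p, q). p + q \<le> N}. ?a p * ?b q)"
      by (simp add: sum.triangle_reindex_eq sum_distrib_left)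
    \<comment> \<open>The triangle of degrees is enlarged to a square, on which the sum is a
      product.\<close>
    also have "(\<Sum>(p, q)\<in>{(p, q). p + q \<le> N}. ?a p * ?b q) \<le> (\<Sum>(p, q)\<in>{..N} \<times> {..N}. ?a p * ?b q)"
      using nn by (intro sum_mono2) auto
    also have "(\<Sum>(p, q)\<in>{..N} \<times> {..N}. ?a p * ?b q) = (\<Sum>p\<le>N. ?a p) * (\<Sum>q\<le>N. ?b q)"
      by (simp add: sum_product sum.cartesian_product)
    also have "\<dots> \<le> infsum (weight S) (lists A) * infsum (weight T) (lists A)"
      using nn A0 S T by (intro mult_mono sum_words_le_infsum sum_nonneg infsum_nonneg) auto
    finally show ?thesis by simp
  qed
  show "weight (gmult S T) summable_on lists A"
    by (rule nonneg_bdd_above_summable_on) (auto intro!: bdd_aboveI2[where M="?M"] le)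
  then show "infsum (weight (gmult S T)) (lists A) \<le> ?M"
    by (rule infsum_le_finite_sums) (rule le)
qed

lemma sum_words_prod_list:
  fixes c :: "'a \<Rightarrow> real"
  shows "(\<Sum>xs\<in>words A n. prod_list (map c xs)) = (\<Sum>a\<in>A. c a) ^ n"
proof (induction n)
  case (Suc n)
  have "(\<Sum>xs\<in>words A (Suc n). prod_list (map c xs)) = (\<Sum>(a, xs)\<in>A \<times> words A n. c a * prod_list (map c xs))"
    by (subst sum.reindex_bij_betw[OF bij_betw_words_Suc, symmetric]) (simp add: case_prod_unfold)
  also have "\<dots> = (\<Sum>a\<in>A. c a) * (\<Sum>xs\<in>words A n. prod_list (map c xs))"
    by (simp add: sum_product sum.cartesian_product)
  finally show ?case by (simp add: Suc)
qed simp

text \<open>Words of length \<open>n\<close> contribute the \<open>n\<close>-th term of the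
  exponential series of the sum of \<open>c\<close>.\<close>

lemma summable_on_lists_exp:
  fixes c :: "'a \<Rightarrow> real"
  assumes c: "c summable_on A" "\<And>a. 0 \<le> c a"
  shows "(\<lambda>xs. prod_list (map c xs) / fact (length xs)) summable_on lists A"
proof -
  let ?f = "\<lambda>xs. prod_list (map c xs) / fact (length xs)"
  have nn: "0 \<le> prod_list (map c xs)" for xs using c(2) by (induction xs) auto
  have "sum ?f F \<le> exp (infsum c A)" if F: "finite F" "F \<subseteq> lists A" for F
  proof -
    obtain A0 N where A0: "finite A0" "A0 \<subseteq> A" "F \<subseteq> (\<Union>n\<le>N. words A0 n)"
      by (rule finite_lists_cover[OF F])
    have "sum ?f F \<le> (\<Sum>n\<le>N. \<Sum>xs\<in>words A0 n. ?f xs)"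
      by (rule sum_lists_le[OF A0(3,1)]) (simp add: nn)
    also have "\<dots> = (\<Sum>n\<le>N. (\<Sum>a\<in>A0. c a) ^ n /\<^sub>R fact n)"
    proof (rule sum.cong[OF refl])
      fix n
      have "(\<Sum>xs\<in>words A0 n. ?f xs) = (\<Sum>xs\<in>words A0 n. prod_list (map c xs)) / fact n"
        unfolding sum_divide_distrib by (rule sum.cong) (auto simp: words_def)
      then show "(\<Sum>xs\<in>words A0 n. ?f xs) = (\<Sum>a\<in>A0. c a) ^ n /\<^sub>R fact n"
        by (simp add: sum_words_prod_list divide_inverse mult.commute)
    qed
    also have "\<dots> \<le> exp (\<Sum>a\<in>A0. c a)"
      unfolding exp_def using c(2)
      by (intro sum_le_suminf summable_exp_generic) (auto intro!: sum_nonneg mult_nonneg_nonneg zero_le_power)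
    also have "\<dots> \<le> exp (infsum c A)" using finite_sum_le_infsum[OF c(1) A0(1,2)] c(2) by simp
    finally show ?thesis .
  qed
  then show ?thesis
    using nn by (intro nonneg_bdd_above_summable_on) (auto intro!: bdd_aboveI2[where M="exp (infsum c A)"])
qed

text \<open>One factor 3 for each product formed, including the last one with the unit, which has
  norm 1.\<close>

lemma weight_zprod:
  fixes \<zeta> :: "('h::super_chilbert_space, 'l::grassmann_generators) stensor"
  assumes \<zeta>: "\<And>h. h \<in> set hs \<Longrightarrow> weight (\<zeta> [h]) summable_on lists B"
  shows "weight (zprod \<zeta> hs) summable_on lists B \<and>
    infsum (weight (zprod \<zeta> hs)) (lists B) \<le> prod_list (map (\<lambda>h. 3 * infsum (weight (\<zeta> [h])) (lists B)) hs)"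
  using \<zeta>
proof (induction hs)
  case Nil
  have "(weight (gone :: 'l tensor) has_sum (\<Sum>xs\<in>{[]}. weight (gone :: 'l tensor) xs)) (lists B)"
    by (rule has_sum_finite_neutralI[where B="{[]}"]) (auto simp: weight_def gone_def)
  then have "(weight (gone :: 'l tensor) has_sum 1) (lists B)" by (simp add: weight_def gone_def)
  then show ?case by (auto simp: infsumI intro: has_sum_imp_summable)
next
  case (Cons h hs)
  let ?c = "\<lambda>h. infsum (weight (\<zeta> [h])) (lists B)"
  have IH: "weight (zprod \<zeta> hs) summable_on lists B"
    "infsum (weight (zprod \<zeta> hs)) (lists B) \<le> prod_list (map (\<lambda>h. 3 * ?c h) hs)" using Cons by auto
  have h: "weight (\<zeta> [h]) summable_on lists B" using Cons.prems by simp
  have "infsum (weight (zprod \<zeta> (h # hs))) (lists B) \<le> 3 * ?c h * infsum (weight (zprod \<zeta> hs)) (lists B)"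
    using summable_weight_gmult(2)[OF h IH(1)] by simp
  also have "\<dots> \<le> 3 * ?c h * prod_list (map (\<lambda>h. 3 * ?c h) hs)"
    by (intro mult_left_mono IH(2)) (simp add: infsum_nonneg)
  finally show ?case using summable_weight_gmult(1)[OF h IH(1)] by simp
qed

lemma sexp_sfock:
  fixes \<zeta> :: "('h::super_chilbert_space, 'l::grassmann_generators) stensor"
  assumes "\<zeta> \<in> HL"
  shows "sexp \<zeta> \<in> sfock"
proof -
  have \<zeta>: "\<zeta> \<in> sfock" by (rule HL_sfock[OF assms])
  have eq: "sexp \<zeta> = (\<lambda>hs ls. inverse (complex_of_real (sqrt (fact (length hs)))) * zprod \<zeta> hs ls)"
    by (intro ext) (simp add: sexp_eq[OF assms] field_simps)
  have ma: "multi_antilinear (\<lambda>hs. sexp \<zeta> hs ls)" for ls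
    unfolding eq using multi_antilinear_scale[OF multi_antilinear_zprod(1)[OF \<zeta>, of ls],
        of "\<lambda>n. inverse (complex_of_real (sqrt (fact n)))"] .
  moreover have "multi_antilinear (sexp \<zeta> hs)" for hs
    unfolding eq using multi_antilinear_scale[OF multi_antilinear_zprod(2)[OF \<zeta>, of hs]] .
  moreover have "\<exists>C. \<forall>hs ls. length hs = m \<longrightarrow> length ls = n \<longrightarrow>
      cmod (sexp \<zeta> hs ls) \<le> C * (prod_norm hs * prod_norm ls)" for m n
  proof -
    obtain K where K: "\<And>hs ls. length hs = m \<Longrightarrow>
      cmod (zprod \<zeta> hs ls) \<le> K (length ls) * prod_norm hs * prod_norm ls"
      using zprod_bounded[OF \<zeta>, of m] by blast
    have "cmod (sexp \<zeta> hs ls) \<le> (inverse (sqrt (fact m)) * K n) * (prod_norm hs * prod_norm ls)"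
      if "length hs = m" "length ls = n" for hs ls
      using mult_left_mono[OF K[OF that(1), of ls], of "inverse (sqrt (fact m))"] that
      by (simp add: eq norm_mult norm_inverse mult.assoc)
    then show ?thesis by blast
  qed
  moreover have "gsym (\<lambda>hs. sexp \<zeta> hs ls) = (\<lambda>hs. sexp \<zeta> hs ls)" for ls
  proof (rule gsym_graded_symmetric[OF ma])
    show "graded_symmetric (\<lambda>hs. sexp \<zeta> hs ls)"
      unfolding graded_symmetric_def
    proof (intro allI impI)
      fix us vs :: "'h list" and a b :: 'h and k l
      assume "set us \<union> set vs \<subseteq> hpart False \<union> hpart True" "a \<in> hpart k" "b \<in> hpart l"
      from graded_symmetricD[OF graded_symmetric_zprod[OF assms, of ls] this]
      show "sexp \<zeta> (us @ b # a # vs) ls = (if k \<and> l then -1 else 1) * sexp \<zeta> (us @ a # b # vs) ls"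
        by (simp add: eq)
    qed
  qed
  moreover have "alt (sexp \<zeta> hs) = sexp \<zeta> hs" for hs
  proof
    fix ls
    have "alt (zprod \<zeta> hs) = zprod \<zeta> hs"
      unfolding zprod_def by (rule alt_alternating[OF alternating_gprod])
    then show "alt (sexp \<zeta> hs) ls = sexp \<zeta> hs ls" unfolding eq alt_scale by simp
  qed
  moreover have "(\<lambda>(hs, ls). (cmod (sexp \<zeta> hs ls))\<^sup>2 / (fact (length ls))\<^sup>2) summable_on lists honb \<times> lists onb"
  proof -
    \<comment> \<open>The squared norm of the component of \<open>\<zeta>\<close> along
      \<open>h\<close>. These sum to the squared norm of \<open>\<zeta>\<close>, and the squared
      norm of the exponential is bounded by the exponential series in
      \<open>3 * ?c h\<close>.\<close>
    let ?c = "\<lambda>h. infsum (weight (\<zeta> [h])) (lists onb)"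
    have sum: "(\<lambda>(hs, ls). weight (\<zeta> hs) ls) summable_on lists honb \<times> lists onb"
      using summable_onb_sfock[OF \<zeta>] by (simp add: weight_def)
    have w: "weight (\<zeta> [h]) summable_on lists onb" if "h \<in> honb" for h
      using summable_on_SigmaD1[OF sum, of "[h]"] that by simp
    have "(\<lambda>hs. infsum (weight (\<zeta> hs)) (lists onb)) summable_on lists honb"
      by (rule summable_on_Sigma_banach[OF sum])
    then have "(\<lambda>hs. infsum (weight (\<zeta> hs)) (lists onb)) summable_on (\<lambda>h. [h]) ` honb"
      \<comment> \<open>Restriction to one-letter words yields a family indexed by the basis
        itself.\<close>
      by (rule summable_on_subset) auto
    then have "?c summable_on honb"
      by (subst (asm) summable_on_reindex) (auto simp: comp_def inj_on_def)
    then have "(\<lambda>h. 3 * ?c h) summable_on honb" by (rule summable_on_cmult_right)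
    then have exp: "(\<lambda>hs. prod_list (map (\<lambda>h. 3 * ?c h) hs) / fact (length hs)) summable_on lists honb"
      by (rule summable_on_lists_exp) (simp add: infsum_nonneg)
    have zp: "weight (zprod \<zeta> hs) summable_on lists onb"
      "infsum (weight (zprod \<zeta> hs)) (lists onb) \<le> prod_list (map (\<lambda>h. 3 * ?c h) hs)"
      if "hs \<in> lists honb" for hs
      using weight_zprod[of hs \<zeta> onb] w that by (auto simp: in_lists_conv_set)
    have "(cmod (sexp \<zeta> hs ls))\<^sup>2 / (fact (length ls))\<^sup>2 = inverse (fact (length hs)) * weight (zprod \<zeta> hs) ls" for hs ls
      by (simp add: eq weight_def norm_mult norm_inverse power_mult_distrib power_inverse)
    then have "((\<lambda>ls. (\<lambda>(hs, ls). (cmod (sexp \<zeta> hs ls))\<^sup>2 / (fact (length ls))\<^sup>2) (hs, ls))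
        has_sum inverse (fact (length hs)) * infsum (weight (zprod \<zeta> hs)) (lists onb)) (lists onb)"
      if "hs \<in> lists honb" for hs
      using has_sum_cmult_right[OF has_sum_infsum[OF zp(1)[OF that]]] by simp
    then show ?thesis
    proof (rule summable_on_SigmaI)
      show "(\<lambda>hs. inverse (fact (length hs)) * infsum (weight (zprod \<zeta> hs)) (lists onb)) summable_on lists honb"
      proof (rule summable_on_comparison_test[OF exp])
        show "inverse (fact (length hs)) * infsum (weight (zprod \<zeta> hs)) (lists onb)
            \<le> prod_list (map (\<lambda>h. 3 * ?c h) hs) / fact (length hs)" if "hs \<in> lists honb" for hs
          using zp(2)[OF that] by (simp add: divide_inverse mult.commute)
      qed (simp add: infsum_nonneg)
    qed auto
  qed
  ultimately show ?thesis unfolding sfock_def by blast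
qed

section \<open>The reproducing kernel\<close>

text \<open>Turns an unconditional sum over words into an ordinary series over degrees, the form in
  which exponentials and power series are stated.\<close>

lemma has_sum_lists_by_length:
  fixes f :: "'a list \<Rightarrow> 'b::{topological_comm_monoid_add, t3_space}"
  assumes f: "(f has_sum s) (lists A)" and g: "\<And>n. (f has_sum g n) (words A n)"
  shows "g sums s"
proof -
  have "bij_betw snd (SIGMA n:UNIV. words A n) (lists A)"
    by (rule bij_betw_byWitness[where f'="\<lambda>xs. (length xs, xs)"]) (auto simp: words_def)
  then have "((\<lambda>p. f (snd p)) has_sum s) (SIGMA n:UNIV. words A n)"
    using f by (simp add: has_sum_reindex_bij_betw)
  then have "(g has_sum s) UNIV"
    by (rule has_sum_SigmaD) (simp add: g)
  then show ?thesis by (rule has_sum_imp_sums)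
qed

lemma honb_homogeneous: "h \<in> honb \<Longrightarrow> \<exists>k. h \<in> hpart k"
  using honb(2) by blast

lemma has_parity_pair:
  assumes "\<zeta> \<in> HL" "\<eta> \<in> HL" "h \<in> honb"
  shows "has_parity False (gmult (\<zeta> [star h]) (\<eta> [h]))"
proof -
  obtain k where "h \<in> hpart k" using honb_homogeneous[OF assms(3)] by blast
  then show ?thesis
    using has_parity_gmult[OF HL_parity[OF assms(1) hpart_star] HL_parity[OF assms(2)], of h k h k] by simp
qed

text \<open>The factors with the same argument are contracted from the inside out: each pair is even, hence central.\<close>

lemma gmult_zprod_zprod:
  assumes \<zeta>: "\<zeta> \<in> HL" "\<eta> \<in> HL" and hs: "hs \<in> lists honb"
  shows "gmult (zprod \<zeta> (rev (map star hs))) (zprod \<eta> hs) = gprod (map (\<lambda>h. gmult (\<zeta> [star h]) (\<eta> [h])) hs)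
    \<and> has_parity False (gprod (map (\<lambda>h. gmult (\<zeta> [star h]) (\<eta> [h])) hs))"
  using hs
proof (induction hs rule: rev_induct)
  case Nil
  then show ?case
    by (simp add: gmult_gone_left alt_alternating[OF alternating_gone] has_parity_gone)
next
  case (snoc h hs)
  let ?A = "gprod (map (\<lambda>h. gmult (\<zeta> [star h]) (\<eta> [h])) hs)"
  have IH: "gmult (zprod \<zeta> (rev (map star hs))) (zprod \<eta> hs) = ?A" "has_parity False ?A"
    using snoc by auto
  have "gmult (zprod \<zeta> (rev (map star (hs @ [h])))) (zprod \<eta> (hs @ [h]))
      = gmult (gmult (\<zeta> [star h]) (zprod \<zeta> (rev (map star hs)))) (gmult (zprod \<eta> hs) (\<eta> [h]))"
    by (simp add: zprod_def gprod_snoc)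
  also have "\<dots> = gmult (\<zeta> [star h]) (gmult ?A (\<eta> [h]))"
    by (simp only: gmult_assoc flip: IH(1))
  also have "\<dots> = gmult (gmult ?A (\<zeta> [star h])) (\<eta> [h])"
    by (simp only: gmult_assoc[symmetric] gmult_even_commute[OF IH(2), of "\<zeta> [star h]"])
  also have "\<dots> = gprod (map (\<lambda>h. gmult (\<zeta> [star h]) (\<eta> [h])) (hs @ [h]))"
    by (simp add: gprod_snoc gmult_assoc)
  finally show ?case
    using has_parity_gmult[OF IH(2) has_parity_pair[OF \<zeta>, of h]] snoc.prems by (simp add: gprod_snoc)
qed

lemma has_sum_spair_degree_one:
  fixes \<zeta> \<eta> :: "('h::super_chilbert_space, 'l::grassmann_generators) stensor"
  assumes \<zeta>: "\<zeta> \<in> HL" and \<eta>: "\<eta> \<in> HL"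
  shows "((\<lambda>h. gmult (\<zeta> [star h]) (\<eta> [h]) ls) has_sum spair \<zeta> \<eta> ls) honb"
proof -
  have "((\<lambda>hs. gmult (\<zeta> (rev (map star hs))) (\<eta> hs) ls) has_sum spair \<zeta> \<eta> ls) (lists honb)"
    unfolding spair_def by (rule has_sum_infsum[OF spair_summable[OF HL_sfock[OF \<zeta>] HL_sfock[OF \<eta>]]])
  also have "?this \<longleftrightarrow> ((\<lambda>hs. gmult (\<zeta> (rev (map star hs))) (\<eta> hs) ls) has_sum spair \<zeta> \<eta> ls) ((\<lambda>h. [h]) ` honb)"
  proof (rule has_sum_cong_neutral)
    fix hs :: "'h list" assume "hs \<in> lists honb - (\<lambda>h. [h]) ` honb"
    then have "length hs \<noteq> 1" by (auto simp: length_Suc_conv)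
    then show "gmult (\<zeta> (rev (map star hs))) (\<eta> hs) ls = 0" by (simp add: HL_length[OF \<eta>])
  qed auto
  finally show ?thesis by (subst (asm) has_sum_reindex) (auto simp: inj_on_def comp_def)
qed

text \<open>The \<open>n\<close>-th power of a sum is the sum over words of length \<open>n\<close>
  of the ordered products of the terms.\<close>

lemma has_sum_gprod_words:
  assumes "\<And>ls. ((\<lambda>h. B h ls) has_sum T ls) A"
  shows "((\<lambda>hs. gprod (map B hs) ls) has_sum gpow T n ls) (words A n)"
proof (induction n arbitrary: ls)
  case 0
  show ?case by (simp add: has_sum_finiteI)
next
  case (Suc n)
  have "((\<lambda>(h, hs). gmult (B h) (gprod (map B hs)) ls) has_sum gmult T (gpow T n) ls) (A \<times> words A n)"
    by (rule has_sum_gmult[OF assms Suc.IH])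
  then show ?case
    by (subst has_sum_reindex_bij_betw[OF bij_betw_words_Suc, symmetric]) (simp add: case_prod_unfold)
qed

lemma spair_sexp_sexp:
  fixes \<zeta> \<eta> :: "('h::super_chilbert_space, 'l::grassmann_generators) stensor"
  assumes \<zeta>: "\<zeta> \<in> HL" and \<eta>: "\<eta> \<in> HL"
  shows "spair (sexp \<zeta>) (sexp \<eta>) = gexp (spair \<zeta> \<eta>)"
proof
  fix ls
  let ?B = "\<lambda>h. gmult (\<zeta> [star h]) (\<eta> [h])"
  have eq: "gmult (sexp \<zeta> (rev (map star hs))) (sexp \<eta> hs) ls = gprod (map ?B hs) ls / fact (length hs)"
    if hs: "hs \<in> lists honb" for hs
  proof -
    \<comment> \<open>Each exponential carries \<open>1 / sqrt (n!)\<close>; the two together give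
      the \<open>1 / n!\<close> of the exponential series.\<close>
    let ?c = "inverse (complex_of_real (sqrt (fact (length hs))))"
    have "sexp \<zeta> (rev (map star hs)) = (\<lambda>ls. ?c * zprod \<zeta> (rev (map star hs)) ls)"
      "sexp \<eta> hs = (\<lambda>ls. ?c * zprod \<eta> hs ls)"
      using sexp_eq[OF \<zeta>] sexp_eq[OF \<eta>] by (auto simp: divide_inverse mult.commute)
    then have "gmult (sexp \<zeta> (rev (map star hs))) (sexp \<eta> hs) ls
        = (?c * ?c) * gprod (map ?B hs) ls"
      using gmult_zprod_zprod[OF \<zeta> \<eta> hs] by (simp add: gmult_scale_left gmult_scale_right)
    also have "?c * ?c = inverse (complex_of_real (sqrt (fact (length hs)) * sqrt (fact (length hs))))"
      unfolding of_real_mult by simp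
    also have "\<dots> = 1 / fact (length hs)" by (simp add: divide_inverse)
    finally show ?thesis by simp
  qed
  have "((\<lambda>hs. gmult (sexp \<zeta> (rev (map star hs))) (sexp \<eta> hs) ls) has_sum spair (sexp \<zeta>) (sexp \<eta>) ls) (lists honb)"
    unfolding spair_def by (rule has_sum_infsum[OF spair_summable[OF sexp_sfock[OF \<zeta>] sexp_sfock[OF \<eta>]]])
  moreover have "((\<lambda>hs. gmult (sexp \<zeta> (rev (map star hs))) (sexp \<eta> hs) ls)
      has_sum gpow (spair \<zeta> \<eta>) n ls / fact n) (words honb n)" for n
  proof -
    have "((\<lambda>hs. gprod (map ?B hs) ls * inverse (fact n)) has_sum gpow (spair \<zeta> \<eta>) n ls * inverse (fact n)) (words honb n)"
      by (rule has_sum_cmult_left[OF has_sum_gprod_words[OF has_sum_spair_degree_one[OF \<zeta> \<eta>]]])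
    also have "?this \<longleftrightarrow> ?thesis"
      unfolding divide_inverse by (rule has_sum_cong) (auto simp: words_def eq divide_inverse)
    finally show ?thesis .
  qed
  ultimately have "(\<lambda>n. gpow (spair \<zeta> \<eta>) n ls / fact n) sums spair (sexp \<zeta>) (sexp \<eta>) ls"
    by (rule has_sum_lists_by_length)
  then show "spair (sexp \<zeta>) (sexp \<eta>) ls = gexp (spair \<zeta> \<eta>) ls"
    by (simp add: gexp_def sums_unique)
qed

lemma sform_eq_spair: "\<zeta> \<in> HLD \<Longrightarrow> sform \<zeta> \<eta> = spair \<zeta> \<eta>"
  by (simp add: sform_def HLD_def)

lemma rep_kernel_eq_spair: "\<zeta> \<in> HLD \<Longrightarrow> rep_kernel \<zeta> \<eta> = spair (sexp \<zeta>) (sexp \<eta>)"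
  by (simp add: rep_kernel_def sform_def sstar_sexp)

lemma rep_kernel_eq_gexp: "\<zeta> \<in> HLD \<Longrightarrow> \<eta> \<in> HLD \<Longrightarrow> rep_kernel \<zeta> \<eta> = gexp (spair \<zeta> \<eta>)"
  by (simp add: rep_kernel_eq_spair spair_sexp_sexp HLD_HL)

section \<open>Injectivity of the function representation\<close>

subsection \<open>Polarisation\<close>

text \<open>\<open>lin x y t\<close> stands for \<open>x + t y\<close>, so that no vector space
  structure on the type is required. On copies of \<open>x + t y\<close> the form is a polynomial in
  \<open>t\<close>. If it vanishes for all real \<open>t\<close>, so does its linear coefficient,
  which is a multiple of the value with one copy of \<open>x\<close> replaced by
  \<open>y\<close>.\<close>

lemma polarisation:
  fixes g :: "'v list \<Rightarrow> complex" and lin :: "'v \<Rightarrow> 'v \<Rightarrow> real \<Rightarrow> 'v"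
  assumes closed: "\<And>x y t. x \<in> V \<Longrightarrow> y \<in> V \<Longrightarrow> lin x y t \<in> V"
    and linear: "\<And>us vs x y t. set us \<union> set vs \<subseteq> V \<Longrightarrow> x \<in> V \<Longrightarrow> y \<in> V \<Longrightarrow>
      g (us @ lin x y t # vs) = g (us @ x # vs) + of_real t * g (us @ y # vs)"
    and symmetric: "\<And>us vs x y. set us \<union> set vs \<subseteq> V \<Longrightarrow> x \<in> V \<Longrightarrow> y \<in> V \<Longrightarrow>
      g (us @ y # x # vs) = g (us @ x # y # vs)"
    and diagonal: "\<And>n x. set (replicate n x) \<subseteq> V \<Longrightarrow> g (replicate n x) = 0"
    and xs: "set xs \<subseteq> V"
  shows "g xs = 0"
proof -
  have poly: "\<exists>p. (\<forall>t. g (replicate m (lin x y t) @ zs) = poly p (of_real t)) \<and>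
      coeff p 0 = g (replicate m x @ zs) \<and> coeff p 1 = of_nat m * g (replicate (m - 1) x @ y # zs)"
    if x: "x \<in> V" and y: "y \<in> V" and zs: "set zs \<subseteq> V" for m x y zs
    using zs
  proof (induction m arbitrary: zs)
    case 0
    show ?case by (intro exI[of _ "[:g zs:]"]) simp
  next
    case (Suc m)
    obtain p where p: "\<And>t. g (replicate m (lin x y t) @ x # zs) = poly p (of_real t)"
      "coeff p 0 = g (replicate m x @ x # zs)" "coeff p 1 = of_nat m * g (replicate (m - 1) x @ y # x # zs)"
      using Suc.IH[of "x # zs"] Suc.prems x by auto
    obtain q where q: "\<And>t. g (replicate m (lin x y t) @ y # zs) = poly q (of_real t)"
      "coeff q 0 = g (replicate m x @ y # zs)"
      using Suc.IH[of "y # zs"] Suc.prems y by auto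
    have rep: "replicate (Suc m) z @ zs = replicate m z @ z # zs" for z
      by (simp add: replicate_app_Cons_same)
    \<comment> \<open>Two terms contribute to the linear coefficient; symmetry moves
      \<open>y\<close> past \<open>x\<close> so that they combine to the factor
      \<open>m + 1\<close>.\<close>
    have swap: "of_nat m * g (replicate (m - 1) x @ y # x # zs) = of_nat m * g (replicate m x @ y # zs)"
    proof (cases m)
      case (Suc k)
      have "g (replicate k x @ y # x # zs) = g (replicate k x @ x # y # zs)"
        by (rule symmetric) (use x y Suc.prems in auto)
      then show ?thesis by (simp add: Suc replicate_app_Cons_same)
    qed simp
    show ?case
    proof (intro exI[of _ "p + pCons 0 q"] conjI allI)
      fix t
      have "g (replicate (Suc m) (lin x y t) @ zs)
          = g (replicate m (lin x y t) @ x # zs) + of_real t * g (replicate m (lin x y t) @ y # zs)"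
        unfolding rep by (rule linear) (use closed x y Suc.prems in auto)
      then show "g (replicate (Suc m) (lin x y t) @ zs) = poly (p + pCons 0 q) (of_real t)"
        by (simp add: p q)
    next
      show "coeff (p + pCons 0 q) 0 = g (replicate (Suc m) x @ zs)"
        unfolding rep by (simp add: p)
      show "coeff (p + pCons 0 q) 1 = of_nat (Suc m) * g (replicate (Suc m - 1) x @ y # zs)"
        using p(3) swap by (simp add: q algebra_simps)
    qed
  qed
  have "g (replicate m x @ ys) = 0" if "x \<in> V" "set ys \<subseteq> V" for m x ys
    using that
  proof (induction ys arbitrary: m x)
    case Nil
    then show ?case by (simp add: diagonal set_replicate_conv_if)
  next
    case (Cons y zs)
    \<comment> \<open>One copy more than in the claim, since a copy is used up for \<open>y\<close>;
      the coefficient \<open>m + 1\<close> is nonzero.\<close>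
    obtain p where p: "\<And>t. g (replicate (Suc m) (lin x y t) @ zs) = poly p (of_real t)"
      "coeff p 1 = of_nat (Suc m) * g (replicate m x @ y # zs)"
      using poly[of x y zs "Suc m"] Cons.prems by auto
    have "poly p (of_real t) = 0" for t :: real
      unfolding p(1)[symmetric] by (rule Cons.IH) (use Cons.prems closed in auto)
    then have "range of_real \<subseteq> {z. poly p z = 0}" by auto
    moreover have "infinite (range (of_real :: real \<Rightarrow> complex))"
      by (simp add: range_inj_infinite inj_of_real infinite_UNIV_char_0 finite_image_iff)
    ultimately have "p = 0" using poly_roots_finite[of p] finite_subset by blast
    then show ?case using p(2) by (simp del: of_nat_Suc)
  qed
  from this[of "hd xs" "tl xs" 1] show ?thesis
    using xs diagonal[of 0] by (cases xs) auto
qed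

text \<open>Once the lower coefficients vanish, division by \<open>x ^ n\<close> leaves a series
  with sum 0 away from the origin, whose limit at 0 is the next coefficient.\<close>

lemma power_series_eq_0:
  fixes a :: "nat \<Rightarrow> real"
  assumes sums: "\<And>x. (\<lambda>n. a n * x ^ n) sums 0"
  shows "a n = 0"
proof (induction n rule: less_induct)
  case (less n)
  have "(\<lambda>k. a (k + n) * x ^ k) sums 0" if "x \<noteq> 0" for x
  proof -
    have "(\<lambda>k. a (k + n) * x ^ (k + n)) sums (0 - (\<Sum>k<n. a k * x ^ k))"
      by (rule sums_split_initial_segment[OF sums])
    moreover have "(\<Sum>k<n. a k * x ^ k) = 0" by (rule sum.neutral) (simp add: less)
    ultimately have "(\<lambda>k. inverse (x ^ n) * (a (k + n) * x ^ (k + n))) sums (inverse (x ^ n) * 0)"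
      by (intro sums_mult) simp
    also have "(\<lambda>k. inverse (x ^ n) * (a (k + n) * x ^ (k + n))) = (\<lambda>k. a (k + n) * x ^ k)"
      using that by (auto simp: power_add field_simps)
    finally show ?thesis by simp
  qed
  then have "((\<lambda>_. 0) \<longlongrightarrow> a (0 + n)) (at (0 :: real))"
    by (intro powser_limit_0_strong[of 1]) auto
  then show ?case by (simp add: tendsto_const_iff)
qed


subsection \<open>Real elements of degree one\<close>

lemma HL_part_add_scale:
  assumes "\<zeta> \<in> HL_part k" "\<eta> \<in> HL_part k"
  shows "(\<lambda>hs ls. \<zeta> hs ls + c * \<eta> hs ls) \<in> HL_part k"
proof -
  have \<zeta>: "\<zeta> \<in> sfock" "\<And>h ls. h \<in> hpart (\<not> k) \<Longrightarrow> \<zeta> [h] ls = 0"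
    "\<And>hs ls. \<zeta> hs ls \<noteq> 0 \<Longrightarrow> length hs = 1 \<and> odd (length ls) = k"
    using assms(1) unfolding HL_part_def by blast+
  have \<eta>: "\<eta> \<in> sfock" "\<And>h ls. h \<in> hpart (\<not> k) \<Longrightarrow> \<eta> [h] ls = 0"
    "\<And>hs ls. \<eta> hs ls \<noteq> 0 \<Longrightarrow> length hs = 1 \<and> odd (length ls) = k"
    using assms(2) unfolding HL_part_def by blast+
  have "length hs = 1 \<and> odd (length ls) = k" if "\<zeta> hs ls + c * \<eta> hs ls \<noteq> 0" for hs ls
    using \<zeta>(3)[of hs ls] \<eta>(3)[of hs ls] that by (cases "\<zeta> hs ls = 0") simp_all
  then show ?thesis
    unfolding HL_part_def using sfock_add_scale[OF \<zeta>(1) \<eta>(1), of c] by (simp add: \<zeta>(2) \<eta>(2))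
qed

lemma HL_add_scale:
  assumes "\<zeta> \<in> HL" "\<eta> \<in> HL"
  shows "(\<lambda>hs ls. \<zeta> hs ls + c * \<eta> hs ls) \<in> HL"
proof -
  obtain \<zeta>0 \<zeta>1 where \<zeta>: "\<zeta> = (\<lambda>hs ls. \<zeta>0 hs ls + \<zeta>1 hs ls)" "\<zeta>0 \<in> HL_part False" "\<zeta>1 \<in> HL_part True"
    using assms(1) by (auto simp: HL_def)
  obtain \<eta>0 \<eta>1 where \<eta>: "\<eta> = (\<lambda>hs ls. \<eta>0 hs ls + \<eta>1 hs ls)" "\<eta>0 \<in> HL_part False" "\<eta>1 \<in> HL_part True"
    using assms(2) by (auto simp: HL_def)
  have eq: "(\<lambda>hs ls. \<zeta> hs ls + c * \<eta> hs ls)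
      = (\<lambda>hs ls. (\<zeta>0 hs ls + c * \<eta>0 hs ls) + (\<zeta>1 hs ls + c * \<eta>1 hs ls))"
    by (simp add: \<zeta>(1) \<eta>(1) algebra_simps)
  show ?thesis
    unfolding HL_def
    by (rule CollectI, intro exI conjI, rule eq)
      (rule HL_part_add_scale[OF \<zeta>(2) \<eta>(2)] HL_part_add_scale[OF \<zeta>(3) \<eta>(3)])+
qed

lemma sstar_add_scale:
  "sstar (\<lambda>hs ls. \<Xi> hs ls + c * \<Psi> hs ls) = (\<lambda>hs ls. sstar \<Xi> hs ls + cnj c * sstar \<Psi> hs ls)"
  by (simp add: sstar_def tstar_def fun_eq_iff)

lemma HLD_add_scale:
  assumes "\<zeta> \<in> HLD" "\<eta> \<in> HLD"
  shows "(\<lambda>hs ls. \<zeta> hs ls + of_real t * \<eta> hs ls) \<in> HLD"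
  using assms by (simp add: HLD_def HL_add_scale sstar_add_scale)

lemma HLD_scale:
  assumes "\<zeta> \<in> HLD"
  shows "(\<lambda>hs ls. of_real t * \<zeta> hs ls) \<in> HLD"
  using HLD_add_scale[OF assms assms, of "t - 1"] by (simp add: algebra_simps)

section \<open>Elementary tensors in degree one\<close>

lemma multi_antilinear_vtensor: "multi_antilinear (vtensor x)"
proof -
  have "vtensor x (us @ y # vs) = (if us = [] \<and> vs = [] then cinner y x else 0)" for us vs y
    by (auto simp: vtensor_def)
  then show ?thesis by (simp add: multi_antilinear_def cinner_add_left cinner_scaleC_left)
qed

lemma bounded_vtensor: "bounded_tensor (vtensor x)"
  unfolding bounded_tensor_def
proof
  fix n
  have "cmod (vtensor x xs) \<le> norm x * prod_norm xs" for xs :: "'a list"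
  proof (cases "length xs = 1")
    case True
    then obtain y where "xs = [y]" by (auto simp: length_Suc_conv)
    then show ?thesis using cinner_Cauchy_Schwarz[of y x] by (simp add: mult.commute)
  qed (simp add: vtensor_def prod_list_norm_nonneg)
  then show "\<exists>C. \<forall>xs. length xs = n \<longrightarrow> cmod (vtensor x xs) \<le> C * prod_norm xs" by blast
qed

lemma summable_vtensor:
  assumes B: "orthonormal B"
  shows "(\<lambda>xs. (cmod (vtensor x xs))\<^sup>2) summable_on lists B"
proof -
  have "(\<lambda>b. (cmod (cinner b x))\<^sup>2) summable_on B"
    using Bessel[of _ x] orthonormal_subset[OF B]
    by (intro nonneg_bdd_above_summable_on) (auto intro!: bdd_aboveI2[where M="(norm x)\<^sup>2"])
  then have "(\<lambda>xs. (cmod (vtensor x xs))\<^sup>2) summable_on (\<lambda>b. [b]) ` B"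
    by (subst summable_on_reindex) (auto simp: inj_on_def comp_def)
  also have "?this \<longleftrightarrow> ?thesis"
  proof (rule summable_on_cong_neutral)
    fix xs assume "xs \<in> lists B - (\<lambda>b. [b]) ` B"
    then have "length xs \<noteq> 1" by (auto simp: length_Suc_conv)
    then show "(cmod (vtensor x xs))\<^sup>2 = 0" by (simp add: vtensor_def)
  qed auto
  finally show ?thesis .
qed

lemma vtensor_grassmann: "vtensor \<theta> \<in> grassmann"
proof -
  have on: "orthonormal (onb :: 'a set)" using is_onb_onb unfolding is_onb_def by blast
  have "(\<lambda>xs. (cmod (vtensor \<theta> xs))\<^sup>2) summable_on lists onb" by (rule summable_vtensor[OF on])
  moreover have "(cmod (vtensor \<theta> xs))\<^sup>2 / (fact (length xs))\<^sup>2 = (cmod (vtensor \<theta> xs))\<^sup>2" for xs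
    by (simp add: vtensor_def)
  ultimately show ?thesis
    by (simp add: grassmann_def multi_antilinear_vtensor bounded_vtensor alt_alternating[OF alternating_vtensor])
qed

lemma gone_grassmann: "gone \<in> grassmann"
proof -
  have "bounded_tensor gone"
    unfolding bounded_tensor_def
    by (intro allI exI[of _ 1]) (simp add: gone_def prod_list_norm_nonneg)
  moreover have "(\<lambda>xs. (cmod (gone xs))\<^sup>2 / (fact (length xs))\<^sup>2) summable_on lists onb"
  proof (rule has_sum_imp_summable, rule has_sum_finite_neutralI[where B="{[]}"])
  qed (auto simp: gone_def)
  ultimately show ?thesis
    by (simp add: grassmann_def multi_antilinear_gone alt_alternating[OF alternating_gone])
qed

lemma vtensor_fock: "vtensor b \<in> fock"
proof -
  have on: "orthonormal (honb :: 'a set)" using honb(1) unfolding is_onb_def by blast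
  have "graded_symmetric (vtensor b)" by (simp add: graded_symmetric_def vtensor_def)
  then have "gsym (vtensor b) = vtensor b"
    by (rule gsym_graded_symmetric[OF multi_antilinear_vtensor])
  then show ?thesis
    by (simp add: fock_def multi_antilinear_vtensor bounded_vtensor summable_vtensor[OF on])
qed

lemma tstar_tstar: "tstar (tstar T) = T"
  by (rule ext) (simp add: tstar_def rev_map comp_def star_star)

text \<open>Enough test factors to detect a Grassmann element: for an even vector the unit alone,
  for an odd one the generators, so that the tensor with a vector of that parity belongs to
  \<open>HL\<close>.\<close>

definition elementary :: "bool \<Rightarrow> 'l::grassmann_generators tensor set" where
  "elementary k = (if k then range vtensor else {gone})"

lemma elementary_grassmann: "\<kappa> \<in> elementary k \<Longrightarrow> \<kappa> \<in> grassmann"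
  by (auto simp: elementary_def vtensor_grassmann gone_grassmann split: if_splits)

lemma has_parity_elementary: "\<kappa> \<in> elementary k \<Longrightarrow> has_parity k \<kappa>"
  by (auto simp: elementary_def has_parity_def gone_def vtensor_def split: if_splits)

lemma tstar_elementary: "\<kappa> \<in> elementary k \<Longrightarrow> tstar \<kappa> \<in> elementary k"
  by (auto simp: elementary_def tstar_gone tstar_vtensor split: if_splits)

lemma stimes_HL:
  fixes b :: "'h::super_chilbert_space" and \<kappa> :: "'l::grassmann_generators tensor"
  assumes b: "b \<in> hpart k" and \<kappa>: "\<kappa> \<in> elementary k"
  shows "stimes \<kappa> (vtensor b) \<in> HL"
proof -
  let ?\<zeta> = "stimes \<kappa> (vtensor b)"
  have sf: "?\<zeta> \<in> sfock"
    by (rule stimes_in_sfock[OF elementary_grassmann[OF \<kappa>] vtensor_fock])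
  have "cinner h b = 0" if "h \<in> hpart (\<not> k)" for h
    using hpart_orthogonal[of h "\<not> k" b] b that by simp
  then have part: "?\<zeta> \<in> HL_part k"
    using sf has_parityD[OF has_parity_elementary[OF \<kappa>]] by (auto simp: HL_part_def stimes_def vtensor_def)
  \<comment> \<open>The zero element, written as a difference, serves as the component of the other
    parity.\<close>
  have "(\<lambda>hs ls. ?\<zeta> hs ls + (-1) * ?\<zeta> hs ls) \<in> sfock" by (rule sfock_add_scale[OF sf sf])
  then have 0: "(\<lambda>hs ls. 0) \<in> (HL_part j :: ('h, 'l) stensor set)" for j
    by (simp add: HL_part_def)
  show ?thesis
  proof (cases k)
    case True
    have eq: "?\<zeta> = (\<lambda>hs ls. (\<lambda>hs ls. 0) hs ls + ?\<zeta> hs ls)" by simp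
    show ?thesis
      unfolding HL_def
      by (rule CollectI, intro exI conjI, rule eq) (use part 0[of False] True in simp_all)
  next
    case False
    have eq: "?\<zeta> = (\<lambda>hs ls. ?\<zeta> hs ls + (\<lambda>hs ls. 0) hs ls)" by simp
    show ?thesis
      unfolding HL_def
      by (rule CollectI, intro exI conjI, rule eq) (use part 0[of True] False in simp_all)
  qed
qed

lemma stimes_complexification:
  fixes b :: "'h::super_chilbert_space" and \<kappa> :: "'l::grassmann_generators tensor"
  assumes b: "b \<in> hpart k" and \<kappa>: "\<kappa> \<in> elementary k"
  obtains \<zeta> \<eta> where "\<zeta> \<in> HLD" "\<eta> \<in> HLD" "stimes \<kappa> (vtensor b) = (\<lambda>hs ls. \<zeta> hs ls + \<i> * \<eta> hs ls)"
proof
  let ?\<xi> = "stimes \<kappa> (vtensor b)" and ?\<xi>s = "stimes (tstar \<kappa>) (vtensor (star b))"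
  \<comment> \<open>With \<open>\<xi>\<close> the tensor and \<open>\<xi>s\<close> its star, these
    are \<open>(\<xi> + \<xi>s) / 2\<close> and \<open>(\<xi> - \<xi>s) / (2 \<i>)\<close>, written
    by means of \<open>x + c y\<close> alone so that \<open>HL_add_scale\<close> applies.\<close>
  define \<zeta> where "\<zeta> = (\<lambda>hs ls. (\<lambda>hs ls. ?\<xi> hs ls + (-1/2) * ?\<xi> hs ls) hs ls + (1/2) * ?\<xi>s hs ls)"
  define \<eta> where "\<eta> = (\<lambda>hs ls. (\<lambda>hs ls. ?\<xi> hs ls + (-1 - \<i>/2) * ?\<xi> hs ls) hs ls + (\<i>/2) * ?\<xi>s hs ls)"
  have \<xi>: "?\<xi> \<in> HL" "?\<xi>s \<in> HL"
    using stimes_HL[OF b \<kappa>] stimes_HL[OF hpart_star[OF b] tstar_elementary[OF \<kappa>]] by auto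
  have star: "sstar ?\<xi> = ?\<xi>s" "sstar ?\<xi>s = ?\<xi>"
    by (simp_all add: sstar_stimes tstar_vtensor star_star tstar_tstar)
  show "\<zeta> \<in> HLD"
    unfolding HLD_def mem_Collect_eq
  proof
    show "\<zeta> \<in> HL" unfolding \<zeta>_def by (intro HL_add_scale \<xi>)
    show "sstar \<zeta> = \<zeta>" unfolding \<zeta>_def sstar_add_scale star by (simp add: fun_eq_iff field_simps)
  qed
  show "\<eta> \<in> HLD"
    unfolding HLD_def mem_Collect_eq
  proof
    show "\<eta> \<in> HL" unfolding \<eta>_def by (intro HL_add_scale \<xi>)
    show "sstar \<eta> = \<eta>" unfolding \<eta>_def sstar_add_scale star by (simp add: fun_eq_iff field_simps)
  qed
  show "?\<xi> = (\<lambda>hs ls. \<zeta> hs ls + \<i> * \<eta> hs ls)"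
    by (simp add: \<zeta>_def \<eta>_def fun_eq_iff field_simps)
qed

subsection \<open>Mixed pairings\<close>

definition zmix :: "('h, 'l) stensor list \<Rightarrow> ('h, 'l) stensor" where
  "zmix \<zeta>s hs = gprod (map2 (\<lambda>\<zeta> h. \<zeta> [h]) \<zeta>s hs)"

lemma zmix_append:
  "length us = length gs \<Longrightarrow> zmix (us @ vs) (gs @ hs) = gmult (zmix us gs) (zmix vs hs)"
  by (simp add: zmix_def gprod_append)

lemma zmix_Nil [simp]: "zmix [] hs = gone"
  by (simp add: zmix_def)

lemma zmix_Cons [simp]: "zmix (\<zeta> # \<zeta>s) (h # hs) = gmult (\<zeta> [h]) (zmix \<zeta>s hs)"
  by (simp add: zmix_def)

lemma zmix_replicate: "length hs = n \<Longrightarrow> zmix (replicate n \<zeta>) hs = zprod \<zeta> hs"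
  by (induction hs arbitrary: n) auto

lemma square_summable_zmix:
  fixes \<zeta>s :: "('h::super_chilbert_space, 'l::grassmann_generators) stensor list"
  assumes "set \<zeta>s \<subseteq> sfock"
  shows "square_summable (words honb (length \<zeta>s)) (zmix \<zeta>s)"
  using assms
proof (induction \<zeta>s)
  case Nil
  show ?case by (simp add: square_summable_def)
next
  case (Cons \<zeta> \<zeta>s)
  have "square_summable ((\<lambda>h. [h]) ` honb) \<zeta>"
    using Cons.prems by (intro square_summable_subset[OF sfock_square_summable]) auto
  then have "square_summable honb (\<lambda>h. \<zeta> [h])"
    using square_summable_reindex[of "\<lambda>h. [h]" honb "(\<lambda>h. [h]) ` honb" \<zeta>] by (simp add: bij_betw_def inj_on_def)
  then have "square_summable (honb \<times> words honb (length \<zeta>s)) (\<lambda>(h, hs). gmult (\<zeta> [h]) (zmix \<zeta>s hs))"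
    using Cons by (intro square_summable_gmult) auto
  then show ?case
    using square_summable_reindex[OF bij_betw_words_Suc, of honb "length \<zeta>s" "zmix (\<zeta> # \<zeta>s)"]
    by (simp add: case_prod_unfold)
qed

lemma bij_betw_rev_star_words:
  "bij_betw (\<lambda>hs. rev (map star hs)) (words honb n) (words (honb :: 'h::super_chilbert_space set) n)"
proof -
  have "inj_on (\<lambda>hs. rev (map star hs)) (words (honb :: 'h set) n)"
    using bij_betw_imp_inj_on[OF bij_betw_rev_star] by (rule inj_on_subset) (auto simp: words_def)
  moreover have "(\<lambda>hs. rev (map star hs)) ` words honb n = words (honb :: 'h set) n"
  proof -
    have "(\<lambda>hs. rev (map star hs)) ` words honb n = {hs \<in> (\<lambda>hs. rev (map star hs)) ` lists (honb :: 'h set). length hs = n}"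
      by (auto simp: words_def)
    then show ?thesis by (simp add: words_def bij_betw_imp_surj_on[OF bij_betw_rev_star])
  qed
  ultimately show ?thesis by (simp add: bij_betw_def)
qed

text \<open>Up to normalisation the pairing of the product of the \<open>\<zeta>s\<close> with the
  part of \<open>D\<close> in that degree; the graded symmetry of \<open>D\<close> takes care of the
  symmetrisation. Reversal and \<open>star\<close> are put on the side of \<open>D\<close> so that
  the \<open>i\<close>-th factor meets the \<open>i\<close>-th letter.\<close>

definition mixed_pairing ::
    "('h::super_chilbert_space, 'l) stensor \<Rightarrow> 'l list \<Rightarrow> ('h, 'l) stensor list \<Rightarrow> complex" where
  "mixed_pairing D ls \<zeta>s = (\<Sum>\<^sub>\<infinity>hs\<in>words honb (length \<zeta>s). gmult (zmix \<zeta>s hs) (D (rev (map star hs))) ls)"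

lemma mixed_pairing_summable:
  fixes \<zeta>s :: "('h::super_chilbert_space, 'l::grassmann_generators) stensor list"
  assumes "D \<in> sfock" "set \<zeta>s \<subseteq> sfock"
  shows "(\<lambda>hs. gmult (zmix \<zeta>s hs) (D (rev (map star hs))) ls) summable_on words honb (length \<zeta>s)"
proof (rule summable_on_gmult[OF square_summable_zmix[OF assms(2)]])
  have "square_summable (words honb (length \<zeta>s)) D"
    by (rule square_summable_subset[OF sfock_square_summable[OF assms(1)]]) (auto simp: words_def)
  then show "square_summable (words honb (length \<zeta>s)) (\<lambda>hs. D (rev (map star hs)))"
    by (simp add: square_summable_reindex[OF bij_betw_rev_star_words])
qed

lemma mixed_pairing_add_scale:
  fixes x y :: "('h::super_chilbert_space, 'l::grassmann_generators) stensor"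
  assumes D: "D \<in> sfock" and sets: "set us \<union> set vs \<subseteq> sfock" "x \<in> sfock" "y \<in> sfock"
  shows "mixed_pairing D ls (us @ (\<lambda>hs ls. x hs ls + c * y hs ls) # vs)
    = mixed_pairing D ls (us @ x # vs) + c * mixed_pairing D ls (us @ y # vs)"
proof -
  let ?z = "\<lambda>hs ls. x hs ls + c * y hs ls" and ?n = "length us + Suc (length vs)"
  let ?F = "\<lambda>z hs. gmult (zmix (us @ z # vs) hs) (D (rev (map star hs))) ls"
  have eq: "?F ?z hs = ?F x hs + c * ?F y hs" if mem: "hs \<in> words honb ?n" for hs
  proof -
    obtain gs h js where hs: "hs = gs @ h # js" "length gs = length us"
    proof
      show "hs = take (length us) hs @ hs ! length us # drop (Suc (length us)) hs"
        by (rule id_take_nth_drop) (use mem in \<open>simp add: words_def\<close>)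
      show "length (take (length us) hs) = length us" using mem by (simp add: words_def)
    qed
    have *: "zmix (us @ z # vs) hs = gmult (zmix us gs) (gmult (z [h]) (zmix vs js))" for z :: "('h, 'l) stensor"
      by (simp add: hs zmix_append)
    have "zmix (us @ ?z # vs) hs = (\<lambda>ls. zmix (us @ x # vs) hs ls + c * zmix (us @ y # vs) hs ls)"
      unfolding * by (simp only: gmult_add_left[abs_def] gmult_scale_left[abs_def] gmult_add_right[abs_def] gmult_scale_right[abs_def])
    then show ?thesis by (simp only: gmult_add_left gmult_scale_left)
  qed
  have sx: "?F x summable_on words honb ?n" and sy: "?F y summable_on words honb ?n"
    using mixed_pairing_summable[OF D, of "us @ _ # vs" ls] sets by simp_all
  have "mixed_pairing D ls (us @ ?z # vs) = (\<Sum>\<^sub>\<infinity>hs\<in>words honb ?n. ?F x hs + c * ?F y hs)"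
    unfolding mixed_pairing_def length_append length_Cons by (rule infsum_cong) (rule eq)
  also have "\<dots> = mixed_pairing D ls (us @ x # vs) + c * mixed_pairing D ls (us @ y # vs)"
    unfolding mixed_pairing_def using sx summable_on_cmult_right[OF sy, of c]
    by (simp add: infsum_add infsum_cmult_right')
  finally show ?thesis .
qed

text \<open>Exchanging the two summation letters along with the factors produces the same sign
  twice, from the Grassmann product and from the graded symmetry of \<open>D\<close>.\<close>

lemma mixed_pairing_swap:
  fixes x y :: "('h::super_chilbert_space, 'l::grassmann_generators) stensor"
  assumes D: "D \<in> sfock" and x: "x \<in> HL" and y: "y \<in> HL"
  shows "mixed_pairing D ls (us @ y # x # vs) = mixed_pairing D ls (us @ x # y # vs)"
proof -
  let ?n = "length us + Suc (Suc (length vs))"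
  let ?F = "\<lambda>\<zeta>s hs. gmult (zmix \<zeta>s hs) (D (rev (map star hs))) ls"
  let ?\<tau> = "adjacent (length us)"
  have \<tau>: "?\<tau> permutes {..<?n}" by (rule permutes_swap_id) auto
  have eq: "?F (us @ y # x # vs) (permute_list ?\<tau> hs) = ?F (us @ x # y # vs) hs" if hs: "hs \<in> words honb ?n" for hs
  proof -
    have "Suc (length us) < length hs" using hs by (simp add: words_def)
    then obtain gs a b js where eq: "hs = gs @ a # b # js" "length gs = length us"
      by (rule split_adjacent)
    then have set: "set gs \<subseteq> honb" "set js \<subseteq> honb" "a \<in> honb" "b \<in> honb"
      using hs by (auto simp: words_def)
    obtain k l where kl: "a \<in> hpart k" "b \<in> hpart l"
      using honb_homogeneous[OF set(3)] honb_homogeneous[OF set(4)] by blast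
    let ?\<epsilon> = "if k \<and> l then -1 else 1 :: complex"
    have perm: "permute_list ?\<tau> hs = gs @ b # a # js"
      using permute_list_adjacent[of gs a b js] by (simp add: eq)
    have z: "zmix (us @ y # x # vs) (gs @ b # a # js) = (\<lambda>ls. ?\<epsilon> * zmix (us @ x # y # vs) hs ls)"
    proof
      fix ls
      show "zmix (us @ y # x # vs) (gs @ b # a # js) ls = ?\<epsilon> * zmix (us @ x # y # vs) hs ls"
        using gprod_swap[OF HL_parity[OF x kl(1)] HL_parity[OF y kl(2)],
            of "map2 (\<lambda>\<zeta> h. \<zeta> [h]) us gs" "map2 (\<lambda>\<zeta> h. \<zeta> [h]) vs js" ls] eq(2)
        by (simp add: zmix_def eq(1) del: gprod_Cons)
    qed
    have hom: "star h \<in> hpart False \<union> hpart True" if h: "h \<in> honb" for h :: 'h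
    proof -
      obtain j where "h \<in> hpart j" using honb_homogeneous[OF h] by blast
      then have "star h \<in> hpart j" by (rule hpart_star)
      then show ?thesis by (cases j) auto
    qed
    have "set (rev (map star js)) \<union> set (rev (map star gs)) \<subseteq> hpart False \<union> hpart True"
      using hom set by auto
    from graded_symmetricD[OF sfock_graded_symmetric[OF D] this hpart_star[OF kl(2)] hpart_star[OF kl(1)]]
    have d: "D (rev (map star (gs @ b # a # js))) = (\<lambda>ls. ?\<epsilon> * D (rev (map star hs)) ls)"
      by (simp add: eq(1) fun_eq_iff conj_commute)
    show ?thesis
      unfolding perm z d by (simp add: gmult_scale_left gmult_scale_right)
  qed
  have "mixed_pairing D ls (us @ y # x # vs) = (\<Sum>\<^sub>\<infinity>hs\<in>words honb ?n. ?F (us @ y # x # vs) (permute_list ?\<tau> hs))"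
    unfolding mixed_pairing_def
    by (subst infsum_reindex_bij_betw[OF bij_betw_words_permute[OF \<tau>]]) simp
  also have "\<dots> = (\<Sum>\<^sub>\<infinity>hs\<in>words honb ?n. ?F (us @ x # y # vs) hs)"
    by (rule infsum_cong) (rule eq)
  finally show ?thesis by (simp add: mixed_pairing_def)
qed

text \<open>Scaling \<open>\<zeta>\<close> by a real number turns the pairing into a power series, whose coefficients vanish separately.\<close>

lemma mixed_pairing_replicate:
  fixes D :: "('h::super_chilbert_space, 'l::grassmann_generators) stensor"
  assumes D: "D \<in> sfock" and 0: "\<And>\<zeta>. \<zeta> \<in> HLD \<Longrightarrow> spair (sexp \<zeta>) D ls = 0" and \<zeta>: "\<zeta> \<in> HLD"
  shows "mixed_pairing D ls (replicate n \<zeta>) = 0"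
proof -
  \<comment> \<open>Scaling by \<open>t\<close> multiplies the terms on words of length
    \<open>n\<close> by \<open>t ^ n\<close>, so the sums \<open>a n\<close> are the coefficients of
    a power series in \<open>t\<close>.\<close>
  define f where "f hs = gmult (sexp \<zeta> (rev (map star hs))) (D hs) ls" for hs
  define a where "a n = infsum f (words honb n)" for n
  have "f summable_on lists honb"
    unfolding f_def by (rule spair_summable[OF sexp_sfock[OF HLD_HL[OF \<zeta>]] D])
  then have f: "(f has_sum a n) (words honb n)" for n
    unfolding a_def by (intro has_sum_infsum) (auto intro: summable_on_subset simp: words_def)
  have sums: "(\<lambda>n. of_real t ^ n * a n) sums 0" for t
  proof (rule has_sum_lists_by_length)
    let ?\<zeta> = "\<lambda>hs ls. of_real t * \<zeta> hs ls"
    have t\<zeta>: "?\<zeta> \<in> HLD" by (rule HLD_scale[OF \<zeta>])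
    have "sexp ?\<zeta> hs = (\<lambda>ls. of_real t ^ length hs * sexp \<zeta> hs ls)" for hs
      by (simp add: fun_eq_iff sexp_eq[OF HLD_HL[OF t\<zeta>]] sexp_eq[OF HLD_HL[OF \<zeta>]] zprod_scale)
    then have "gmult (sexp ?\<zeta> (rev (map star hs))) (D hs) ls = of_real t ^ length hs * f hs" for hs
      by (simp add: f_def gmult_scale_left)
    moreover have "((\<lambda>hs. gmult (sexp ?\<zeta> (rev (map star hs))) (D hs) ls) has_sum spair (sexp ?\<zeta>) D ls) (lists honb)"
      unfolding spair_def by (rule has_sum_infsum[OF spair_summable[OF sexp_sfock[OF HLD_HL[OF t\<zeta>]] D]])
    ultimately show "((\<lambda>hs. of_real t ^ length hs * f hs) has_sum 0) (lists honb)"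
      by (simp add: 0[OF t\<zeta>])
    fix n
    have "((\<lambda>hs. of_real t ^ n * f hs) has_sum of_real t ^ n * a n) (words honb n)"
      by (rule has_sum_cmult_right[OF f])
    also have "?this \<longleftrightarrow> ((\<lambda>hs. of_real t ^ length hs * f hs) has_sum of_real t ^ n * a n) (words honb n)"
      by (rule has_sum_cong) (simp add: words_def)
    finally show "((\<lambda>hs. of_real t ^ length hs * f hs) has_sum of_real t ^ n * a n) (words honb n)" .
  qed
  have "Re (a n) = 0"
    by (rule power_series_eq_0[where a="\<lambda>n. Re (a n)"])
      (use sums_Re[OF sums] in \<open>simp add: mult.commute flip: of_real_power\<close>)
  moreover have "Im (a n) = 0"
    by (rule power_series_eq_0[where a="\<lambda>n. Im (a n)"])
      (use sums_Im[OF sums] in \<open>simp add: mult.commute flip: of_real_power\<close>)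
  ultimately have "a n = 0" by (simp add: complex_eq_iff)
  let ?c = "inverse (complex_of_real (sqrt (fact n)))"
  have eq: "f (rev (map star hs)) = ?c * gmult (zmix (replicate n \<zeta>) hs) (D (rev (map star hs))) ls"
    if "hs \<in> words honb n" for hs
  proof -
    have "sexp \<zeta> hs = (\<lambda>ls. ?c * zprod \<zeta> hs ls)"
      using that by (simp add: fun_eq_iff sexp_eq[OF HLD_HL[OF \<zeta>]] words_def divide_inverse mult.commute)
    moreover have "rev (map star (rev (map star hs))) = hs"
      by (simp add: rev_map comp_def star_star)
    ultimately show ?thesis
      using that by (simp add: f_def gmult_scale_left zmix_replicate words_def)
  qed
  have "a n = (\<Sum>\<^sub>\<infinity>hs\<in>words honb n. f (rev (map star hs)))"
    unfolding a_def by (rule infsum_reindex_bij_betw[OF bij_betw_rev_star_words, symmetric])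
  also have "\<dots> = (\<Sum>\<^sub>\<infinity>hs\<in>words honb n. ?c * gmult (zmix (replicate n \<zeta>) hs) (D (rev (map star hs))) ls)"
    by (rule infsum_cong) (rule eq)
  also have "\<dots> = ?c * mixed_pairing D ls (replicate n \<zeta>)"
    by (simp add: mixed_pairing_def infsum_cmult_right')
  finally show ?thesis using \<open>a n = 0\<close> by simp
qed

lemma mixed_pairing_real:
  fixes D :: "('h::super_chilbert_space, 'l::grassmann_generators) stensor"
  assumes D: "D \<in> sfock" and 0: "\<And>\<zeta>. \<zeta> \<in> HLD \<Longrightarrow> spair (sexp \<zeta>) D ls = 0" and \<zeta>s: "set \<zeta>s \<subseteq> HLD"
  shows "mixed_pairing D ls \<zeta>s = 0"
proof (rule polarisation[where V=HLD and lin="\<lambda>x y t hs ls. x hs ls + of_real t * y hs ls"])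
  have sf: "HLD \<subseteq> (sfock :: ('h, 'l) stensor set)" using HL_sfock HLD_HL by blast
  show "mixed_pairing D ls (us @ (\<lambda>hs ls. x hs ls + of_real t * y hs ls) # vs)
      = mixed_pairing D ls (us @ x # vs) + of_real t * mixed_pairing D ls (us @ y # vs)"
    if "set us \<union> set vs \<subseteq> HLD" "x \<in> HLD" "y \<in> HLD" for us vs x y t
    by (rule mixed_pairing_add_scale[OF D]) (use that sf in auto)
  show "mixed_pairing D ls (us @ y # x # vs) = mixed_pairing D ls (us @ x # y # vs)"
    if "x \<in> HLD" "y \<in> HLD" for us vs x y
    by (rule mixed_pairing_swap[OF D HLD_HL[OF that(1)] HLD_HL[OF that(2)]])
  \<comment> \<open>For \<open>n = 0\<close> nothing is known of \<open>x\<close>, and the empty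
    pairing is obtained from some real element, here one constructed from the zero vector.\<close>
  obtain \<zeta>0 :: "('h, 'l) stensor" where "\<zeta>0 \<in> HLD"
    by (rule stimes_complexification[of "0 :: 'h" False "gone :: 'l tensor"]) (auto simp: hpart_zero elementary_def)
  then show "mixed_pairing D ls (replicate n x) = 0" if "set (replicate n x) \<subseteq> HLD" for n x
    using mixed_pairing_replicate[OF D 0, of \<zeta>0 0] mixed_pairing_replicate[OF D 0, of x n] that
    by (cases n) auto
qed (use HLD_add_scale \<zeta>s in auto)

text \<open>The last complex factor is split into its real and imaginary parts, which then join the
  real factors on its right.\<close>

lemma mixed_pairing_complex:
  fixes D :: "('h::super_chilbert_space, 'l::grassmann_generators) stensor"
  assumes D: "D \<in> sfock" and 0: "\<And>\<zeta>. \<zeta> \<in> HLD \<Longrightarrow> spair (sexp \<zeta>) D ls = 0"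
    and us: "\<And>u. u \<in> set us \<Longrightarrow> u \<in> sfock \<and> (\<exists>x\<in>HLD. \<exists>y\<in>HLD. u = (\<lambda>hs ls. x hs ls + \<i> * y hs ls))"
    and vs: "set vs \<subseteq> HLD"
  shows "mixed_pairing D ls (us @ vs) = 0"
  using us vs
proof (induction us arbitrary: vs rule: rev_induct)
  case Nil
  then show ?case using mixed_pairing_real[OF D 0] by simp
next
  case (snoc u us)
  obtain x y where u: "x \<in> HLD" "y \<in> HLD" "u = (\<lambda>hs ls. x hs ls + \<i> * y hs ls)"
    using snoc.prems(1)[of u] by auto
  have sf: "HLD \<subseteq> (sfock :: ('h, 'l) stensor set)" using HL_sfock HLD_HL by blast
  have "mixed_pairing D ls (us @ u # vs) = mixed_pairing D ls (us @ x # vs) + \<i> * mixed_pairing D ls (us @ y # vs)"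
    unfolding u(3) by (rule mixed_pairing_add_scale[OF D]) (use snoc.prems sf u in auto)
  also have "mixed_pairing D ls (us @ x # vs) = 0" by (rule snoc.IH) (use snoc.prems u in auto)
  also have "mixed_pairing D ls (us @ y # vs) = 0" by (rule snoc.IH) (use snoc.prems u in auto)
  finally show ?case by simp
qed

section \<open>Separation of Fock space elements by elementary products\<close>

lemma zmix_stimes:
  fixes bs hs :: "'h::super_chilbert_space list"
  assumes "length \<kappa>s = length bs" "length bs = length hs" "set bs \<subseteq> honb" "set hs \<subseteq> honb"
  shows "zmix (map2 (\<lambda>\<kappa> b. stimes \<kappa> (vtensor b)) \<kappa>s bs) hs = (if hs = bs then gprod \<kappa>s else (\<lambda>_. 0))"
  using assms
proof (induction \<kappa>s bs hs rule: list_induct3)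
  case (Cons \<kappa> \<kappa>s b bs h hs)
  have on: "orthonormal (honb :: 'h set)" using honb(1) unfolding is_onb_def by blast
  have "stimes \<kappa> (vtensor b) [h] = (if h = b then \<kappa> else (\<lambda>_. 0))"
    using cinner_orthonormal[OF on, of h b] Cons.prems by (auto simp: stimes_def fun_eq_iff)
  then show ?case
    using Cons by (cases "h = b") (simp_all add: gmult_zero_left[abs_def] gmult_zero_right[abs_def])
qed simp

text \<open>The first factor is stripped off at each step: by \<open>gmult_vtensor_eq_0\<close> if
  it ranges over the generators, trivially if it is the unit.\<close>

lemma gprod_elementary_eq_0:
  fixes T :: "'l::grassmann_generators tensor"
  assumes "\<And>\<kappa>s. list_all2 (\<lambda>k \<kappa>. \<kappa> \<in> elementary k) ks \<kappa>s \<Longrightarrow> gmult (gprod \<kappa>s) T = (\<lambda>_. 0)"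
    and T: "alternating T"
  shows "T = (\<lambda>_. 0)"
  using assms(1)
proof (induction ks)
  case Nil
  then show ?case by (simp add: gmult_gone_left alt_alternating[OF T])
next
  case (Cons k ks)
  show ?case
  proof (rule Cons.IH)
    fix \<kappa>s :: "'l tensor list" assume \<kappa>s: "list_all2 (\<lambda>k \<kappa>. \<kappa> \<in> elementary k) ks \<kappa>s"
    have 0: "gmult \<kappa> (gmult (gprod \<kappa>s) T) = (\<lambda>_. 0)" if "\<kappa> \<in> elementary k" for \<kappa>
      using Cons.prems[of "\<kappa> # \<kappa>s"] \<kappa>s that by (simp add: gmult_assoc)
    show "gmult (gprod \<kappa>s) T = (\<lambda>_. 0)"
    proof (cases k)
      case True
      then have "vtensor \<theta> \<in> elementary k" for \<theta> by (simp add: elementary_def)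
      then show ?thesis
        by (rule gmult_vtensor_eq_0[OF alternating_gmult 0])
    next
      case False
      then show ?thesis
        using 0[of gone] by (simp add: elementary_def gmult_gone_left alt_alternating[OF alternating_gmult])
    qed
  qed
qed

text \<open>Against elementary tensors over basis vectors \<open>bs\<close>, orthonormality leaves a
  single term of the mixed pairing, namely a product of test factors with one coefficient of
  \<open>D\<close>.\<close>

lemma spair_sexp_eq_0:
  fixes D :: "('h::super_chilbert_space, 'l::grassmann_generators) stensor"
  assumes D: "D \<in> sfock" and 0: "\<And>\<zeta> ls. \<zeta> \<in> HLD \<Longrightarrow> spair (sexp \<zeta>) D ls = 0"
  shows "D = (\<lambda>hs ls. 0)"
proof -
  have zero: "D (rev (map star bs)) = (\<lambda>_. 0)" if bs: "bs \<in> lists honb" for bs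
  proof -
    have "\<exists>ks. homogeneous ks bs"
      using bs by (induction bs) (auto simp: homogeneous_def dest!: honb_homogeneous intro: list_all2_Cons[THEN iffD2])
    then obtain ks where ks: "homogeneous ks bs" by blast
    show ?thesis
    proof (rule gprod_elementary_eq_0)
      show "alternating (D (rev (map star bs)))" by (rule sfock_alternating[OF D])
      fix \<kappa>s :: "'l tensor list" assume \<kappa>s: "list_all2 (\<lambda>k \<kappa>. \<kappa> \<in> elementary k) ks \<kappa>s"
      have len: "length \<kappa>s = length bs"
        using list_all2_lengthD[OF \<kappa>s] homogeneous_length[OF ks] by simp
      let ?us = "map2 (\<lambda>\<kappa> b. stimes \<kappa> (vtensor b)) \<kappa>s bs"
      have u: "u \<in> sfock \<and> (\<exists>x\<in>HLD. \<exists>y\<in>HLD. u = (\<lambda>hs ls. x hs ls + \<i> * y hs ls))" if u: "u \<in> set ?us" for u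
      proof -
        obtain i where i: "i < length bs" "u = stimes (\<kappa>s ! i) (vtensor (bs ! i))"
        proof -
          obtain i where "i < length ?us" "?us ! i = u"
            using u unfolding in_set_conv_nth by blast
          then show thesis using that[of i] len by simp
        qed
        have el: "\<kappa>s ! i \<in> elementary (ks ! i)" and part: "bs ! i \<in> hpart (ks ! i)"
          using i(1) \<kappa>s ks len by (auto simp: list_all2_conv_all_nth homogeneous_def)
        obtain x y where "x \<in> HLD" "y \<in> HLD" "u = (\<lambda>hs ls. x hs ls + \<i> * y hs ls)"
          unfolding i(2) by (rule stimes_complexification[OF part el])
        moreover have "u \<in> sfock" unfolding i(2) by (rule HL_sfock[OF stimes_HL[OF part el]])
        ultimately show ?thesis by blast
      qed
      show "gmult (gprod \<kappa>s) (D (rev (map star bs))) = (\<lambda>_. 0)"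
      proof
        fix ls
        let ?F = "\<lambda>hs. gmult (zmix ?us hs) (D (rev (map star hs))) ls"
        have mix: "zmix ?us hs = (if hs = bs then gprod \<kappa>s else (\<lambda>_. 0))" if "hs \<in> words honb (length bs)" for hs
          using that bs len by (intro zmix_stimes) (auto simp: words_def)
        have bsw: "bs \<in> words honb (length bs)" using bs by (simp add: words_def)
        have "(?F has_sum (\<Sum>hs\<in>{bs}. ?F hs)) (words honb (length bs))"
          by (rule has_sum_finite_neutralI[where B="{bs}"]) (use bsw in \<open>auto simp: mix\<close>)
        then have "(?F has_sum gmult (gprod \<kappa>s) (D (rev (map star bs))) ls) (words honb (length bs))"
          by (simp add: mix[OF bsw])
        then have "mixed_pairing D ls ?us = gmult (gprod \<kappa>s) (D (rev (map star bs))) ls"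
          using len by (simp add: mixed_pairing_def infsumI)
        moreover have "mixed_pairing D ls (?us @ []) = 0"
          by (rule mixed_pairing_complex[OF D 0]) (use u in auto)
        ultimately show "gmult (gprod \<kappa>s) (D (rev (map star bs))) ls = 0" by simp
      qed
    qed
  qed
  show ?thesis
  proof (rule sfock_eq_0[OF D])
    fix hs :: "'h list" and ls assume "hs \<in> lists honb"
    then obtain bs where "bs \<in> lists honb" "hs = rev (map star bs)"
      using bij_betw_imp_surj_on[OF bij_betw_rev_star] by blast
    then show "D hs ls = 0" by (simp add: zero)
  qed
qed

lemma spair_add_scale:
  assumes "\<Phi> \<in> sfock" "\<Xi> \<in> sfock" "\<Psi> \<in> sfock"
  shows "spair \<Phi> (\<lambda>hs ls. \<Xi> hs ls + c * \<Psi> hs ls) ls = spair \<Phi> \<Xi> ls + c * spair \<Phi> \<Psi> ls"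
  using spair_summable[OF assms(1,2), of ls] summable_on_cmult_right[OF spair_summable[OF assms(1,3), of ls], of c]
  by (simp add: spair_def gmult_add_right gmult_scale_right infsum_add infsum_cmult_right')

lemma inj_on_phi: "inj_on phi (sfock :: ('h::super_chilbert_space, 'l::grassmann_generators) stensor set)"
proof (rule inj_onI)
  fix \<Xi> \<Psi> :: "('h, 'l) stensor"
  assume *: "\<Xi> \<in> sfock" "\<Psi> \<in> sfock" "phi \<Xi> = phi \<Psi>"
  let ?D = "\<lambda>hs ls. \<Xi> hs ls + (-1) * \<Psi> hs ls"
  have "?D = (\<lambda>hs ls. 0)"
  proof (rule spair_sexp_eq_0)
    show "?D \<in> sfock" by (rule sfock_add_scale[OF *(1,2)])
    fix \<zeta> :: "('h, 'l) stensor" and ls assume \<zeta>: "\<zeta> \<in> HLD"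
    have "spair (sexp \<zeta>) \<Xi> = spair (sexp \<zeta>) \<Psi>"
      using fun_cong[OF *(3), of \<zeta>] \<zeta> by (simp add: phi_def)
    then show "spair (sexp \<zeta>) ?D ls = 0"
      by (subst spair_add_scale[OF sexp_sfock[OF HLD_HL[OF \<zeta>]] *(1,2)]) simp
  qed
  then show "\<Xi> = \<Psi>" by (simp add: fun_eq_iff)
qed

theorem lemma7:
  shows "(\<forall>\<zeta>\<^sub>1 \<in> (HLD :: ('h::super_chilbert_space, 'l::grassmann_generators) stensor set). \<forall>\<zeta>\<^sub>2 \<in> HLD.
            rep_kernel \<zeta>\<^sub>1 \<zeta>\<^sub>2 = gexp (sform \<zeta>\<^sub>1 \<zeta>\<^sub>2) \<and>
            rep_kernel \<zeta>\<^sub>1 \<zeta>\<^sub>2 = gexp (spair \<zeta>\<^sub>1 \<zeta>\<^sub>2)) \<and>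
         (\<forall>\<phi> \<in> (fun_space :: (('h, 'l) stensor \<Rightarrow> 'l tensor) set). \<forall>\<eta> \<in> HLD.
            fun_form (\<lambda>\<zeta>\<in>HLD. rep_kernel \<zeta> \<eta>) \<phi> = \<phi> \<eta>)"
proof (intro conjI ballI)
  fix \<zeta>\<^sub>1 \<zeta>\<^sub>2 :: "('h, 'l) stensor" assume "\<zeta>\<^sub>1 \<in> HLD" "\<zeta>\<^sub>2 \<in> HLD"
  then show "rep_kernel \<zeta>\<^sub>1 \<zeta>\<^sub>2 = gexp (sform \<zeta>\<^sub>1 \<zeta>\<^sub>2)" "rep_kernel \<zeta>\<^sub>1 \<zeta>\<^sub>2 = gexp (spair \<zeta>\<^sub>1 \<zeta>\<^sub>2)"
    by (simp_all add: rep_kernel_eq_gexp sform_eq_spair)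
next
  fix \<phi> :: "('h, 'l) stensor \<Rightarrow> 'l tensor" and \<eta> :: "('h, 'l) stensor"
  assume "\<phi> \<in> fun_space" and \<eta>: "\<eta> \<in> HLD"
  then obtain \<Xi> where \<Xi>: "\<Xi> \<in> sfock" "\<phi> = phi \<Xi>" by (auto simp: fun_space_def)
  \<comment> \<open>Since \<open>exp \<zeta>\<close> is fixed by the involution, the sesquilinear
    form in the kernel agrees with the bilinear one in \<open>phi\<close>. Injectivity on
    \<open>sfock\<close> then lets \<open>fun_form\<close> recover both representatives.\<close>
  have "(\<lambda>\<zeta>\<in>HLD. rep_kernel \<zeta> \<eta>) = phi (sexp \<eta>)"
    unfolding phi_def by (rule restrict_ext) (rule rep_kernel_eq_spair)
  then have "fun_form (\<lambda>\<zeta>\<in>HLD. rep_kernel \<zeta> \<eta>) \<phi> = sform (sexp \<eta>) \<Xi>"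
    by (simp add: fun_form_def \<Xi> inv_into_f_f[OF inj_on_phi] sexp_sfock[OF HLD_HL[OF \<eta>]])
  \<comment> \<open>The same reality, now of \<open>exp \<eta>\<close>, makes the form the value of
    the function at \<open>\<eta>\<close>.\<close>
  also have "\<dots> = \<phi> \<eta>"
    using \<eta> by (simp add: sform_def sstar_sexp phi_def \<Xi>(2))
  finally show "fun_form (\<lambda>\<zeta>\<in>HLD. rep_kernel \<zeta> \<eta>) \<phi> = \<phi> \<eta>" .
qed

end
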